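(* Let $A=\mathbb{C}[a_{ij}\,:\,0\leq i\leq j,\ j>0]$ be the polynomial ring in the variables $a_{ij}$, and let $GW$ be the minimal Gromov–Witten ring defined in the context. Let $r\colon A\to GW$ be the $\mathbb{C}$-algebra homomorphism sending $a_{ij}$ to the class of the symbol $\langle H^1,H^j,H_i\rangle$. Then $r$ is an isomorphism.
   Context: Consider formal symbols $\langle \tau_{d_1}H^{i_1},\ldots,\tau_{d_{n-1}}H^{i_{n-1}},\tau_{d_n}H_r\rangle$ with $n\geq 1$ and $i_1,\ldots,i_{n-1},r,d_1,\ldots,d_n\in\mathbb{Z}_{\geq 0}$. The last entry carries a subscript, all the others carry superscripts. Write $H^i$ for $\tau_0H^i$ and $H_j$ for $\tau_0H_j$. The degree of such a symbol is $\sum_s d_s+\sum_{s=1}^{n-1} i_s-r+(3-n)$. Let $F$ be the set of all symbols of non-negative degree. The minimal Gromov–Witten ring is $GW=\mathbb{C}[F]/\mathrm{Rel}$, where $\mathbb{C}[F]$ is the polynomial ring whose variables are the elements of $F$. Convention: any symbol with a negative index or of negative degree that appears on a right-hand side below is interpreted as $0$. The ideal $\mathrm{Rel}$ is generated by the following relations. (GW1) Permuting the first $n-1$ entries $\tau_{d_s}H^{i_s}$ of a symbol does not change it. The last entry $\tau_{d_n}H_r$ stays in place. (GW2) Suppose $r=\sum d_s+\sum i_s+(3-n)$, i.e. the symbol has degree $0$. Then $\langle \tau_{d_1}H^{i_1},\ldots,\tau_{d_n}H_r\rangle=\frac{(d_1+\cdots+d_n)!}{d_1!\cdots d_n!}M$,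 where $M=1$ if $\sum d_j=n-3$ and $M=0$ otherwise. (GW3) $\langle H^0,\tau_{d_1}H^{i_1},\ldots,\tau_{d_{n-1}}H^{i_{n-1}},\tau_{d_n}H_r\rangle$ equals the sum of the following terms: - for each $j=1,\ldots,n-1$, the symbol obtained from $\langle\tau_{d_1}H^{i_1},\ldots,\tau_{d_{n-1}}H^{i_{n-1}},\tau_{d_n}H_r\rangle$ by replacing $d_j$ with $d_j-1$; - the term $\langle\tau_{d_1}H^{i_1},\ldots,\tau_{d_{n-1}}H^{i_{n-1}},\tau_{d_n-1}H_r\rangle$. The symbols $\langle H^0,H^i,H_i\rangle$ are excluded from (GW3); they are given by (GW2). (GW4) Let $d>0$ be the degree of the left-hand side. Then $\langle H^1,\tau_{d_1}H^{i_1},\ldots,\tau_{d_{n-1}}H^{i_{n-1}},\tau_{d_n}H_r\rangle = d\,\langle\tau_{d_1}H^{i_1},\ldots,\tau_{d_n}H_r\rangle+\sum_{s=1}^{n-1}\langle\tau_{d_1}H^{i_1},\ldots,\tau_{d_s-1}H^{i_s+1},\ldots,\tau_{d_n}H_r\rangle+\langle\tau_{d_1}H^{i_1},\ldots,\tau_{d_n-1}H_{r-1}\rangle$. (GW5) Fix $n\geq 0$ and numbers $c_1,\ldots,c_n,i_1,\ldots,i_n$. For $S\subset\{1,\ldots,n\}$ let $\coprod_S$ denote the sequence of entries $\tau_{c_s}H^{i_s}$, $s\in S$. Then two relations hold. - If $d_1\geq 1$: $\langle\coprod_{\{1,\ldots,n\}},\tau_{d_1}H^{j_1},\tau_{d_2}H^{j_2},\tau_{d_3}H_r\rangle=\sum\langle\tau_{d_1-1}H^{j_1},\coprod_{S_1},H_a\rangle\langle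 H^a,\coprod_{S_2},\tau_{d_2}H^{j_2},\tau_{d_3}H_r\rangle$. - If $d_3\geq 1$: $\langle\coprod_{\{1,\ldots,n\}},\tau_{d_1}H^{j_1},\tau_{d_2}H^{j_2},\tau_{d_3}H_r\rangle=\sum\langle\coprod_{S_1},\tau_{d_1}H^{j_1},\tau_{d_2}H^{j_2},H_a\rangle\langle H^a,\coprod_{S_2},\tau_{d_3-1}H_r\rangle$. In both relations the sum runs over all splittings $S_1\sqcup S_2=\{1,\ldots,n\}$ and all $a\in\mathbb{Z}_{\geq 0}$ for which every symbol involved has non-negative degree. Such sums are finite. *)

theory Defs
  imports Complex_Main "HOL-Library.Poly_Mapping" "HOL-Library.Multiset"
begin

text \<open>A symbol <tau_{d_1}H^{i_1},...,tau_{d_{n-1}}H^{i_{n-1}}, tau_{d_n}H_r> is represented as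
  Br es dn r, where es = [(d_1,i_1),...,(d_{n-1},i_{n-1})] (so n = length es + 1).\<close>

datatype gwsym = Br "(nat \<times> nat) list" nat nat

fun deg :: "gwsym \<Rightarrow> int" where
  "deg (Br es dn r) =
     int (sum_list (map fst es) + dn) + int (sum_list (map snd es)) - int r
     + (3 - int (length es + 1))"

typedef fsym = "{s. 0 \<le> deg s}"
  by (rule exI[of _ "Br [] 0 0"]) simp

type_synonym fpoly = "(fsym \<Rightarrow>\<^sub>0 nat) \<Rightarrow>\<^sub>0 complex"

definition cst :: "complex \<Rightarrow> ('v \<Rightarrow>\<^sub>0 nat) \<Rightarrow>\<^sub>0 complex" where
  "cst c = Poly_Mapping.single 0 c"

definition X :: "gwsym \<Rightarrow> fpoly" where
  "X s = (if 0 \<le> deg s then Poly_Mapping.single (Poly_Mapping.single (Abs_fsym s) 1) 1 else 0)"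

definition XI :: "(int \<times> int) list \<Rightarrow> int \<Rightarrow> int \<Rightarrow> fpoly" where
  "XI es dn r = (if (\<forall>p\<in>set es. 0 \<le> fst p \<and> 0 \<le> snd p) \<and> 0 \<le> dn \<and> 0 \<le> r
      then X (Br (map (\<lambda>(a,b). (nat a, nat b)) es) (nat dn) (nat r)) else 0)"

definition ilist :: "(nat \<times> nat) list \<Rightarrow> (int \<times> int) list" where
  "ilist es = map (\<lambda>(a,b). (int a, int b)) es"

definition GW1 :: "fpoly set" where
  "GW1 = {X (Br es dn r) - X (Br es' dn r) | es es' dn r. mset es = mset es'}"

definition GW2 :: "fpoly set" where
  "GW2 = {X (Br es dn r) -
           cst ((of_nat (fact (sum_list (map fst es @ [dn]))) /
                 of_nat (prod_list (map fact (map fst es @ [dn]))))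
                * (if int (sum_list (map fst es @ [dn])) = int (length es + 1) - 3 then 1 else 0))
          | es dn r. deg (Br es dn r) = 0}"

definition GW3 :: "fpoly set" where
  "GW3 = {X (Br ((0,0) # es) dn r)
          - (\<Sum>j<length es. XI ((ilist es)[j := (fst (ilist es ! j) - 1, snd (ilist es ! j))]) (int dn) (int r))
          - XI (ilist es) (int dn - 1) (int r)
          | es dn r. \<not> (es = [(0, r)] \<and> dn = 0)}"

definition GW4 :: "fpoly set" where
  "GW4 = {X (Br ((0,1) # es) dn r)
          - cst (of_int (deg (Br ((0,1) # es) dn r))) * X (Br es dn r)
          - (\<Sum>s<length es. XI ((ilist es)[s := (fst (ilist es ! s) - 1, snd (ilist es ! s) + 1)]) (int dn) (int r))
          - XI (ilist es) (int dn - 1) (int r - 1)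
          | es dn r. 0 < deg (Br ((0,1) # es) dn r)}"

text \<open>GW5, first relation (d_1 \<ge> 1).  cs = [(c_1,i_1),...,(c_n,i_n)];
  the entries of the splitting S1 \<union> S2 are given by nths.\<close>
definition GW5a :: "fpoly set" where
  "GW5a = {X (Br (cs @ [(d1,j1),(d2,j2)]) d3 r)
          - (\<Sum>S1\<in>Pow {..<length cs}.
               \<Sum>a\<in>{a. 0 \<le> deg (Br ((d1 - 1, j1) # nths cs S1) 0 a) \<and>
                       0 \<le> deg (Br ((0, a) # nths cs ({..<length cs} - S1) @ [(d2, j2)]) d3 r)}.
                 X (Br ((d1 - 1, j1) # nths cs S1) 0 a) *
                 X (Br ((0, a) # nths cs ({..<length cs} - S1) @ [(d2, j2)]) d3 r))
          | cs d1 j1 d2 j2 d3 r. 1 \<le> d1 \<and> 0 \<le> deg (Br (cs @ [(d1,j1),(d2,j2)]) d3 r)}"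

definition GW5b :: "fpoly set" where
  "GW5b = {X (Br (cs @ [(d1,j1),(d2,j2)]) d3 r)
          - (\<Sum>S1\<in>Pow {..<length cs}.
               \<Sum>a\<in>{a. 0 \<le> deg (Br (nths cs S1 @ [(d1, j1), (d2, j2)]) 0 a) \<and>
                       0 \<le> deg (Br ((0, a) # nths cs ({..<length cs} - S1)) (d3 - 1) r)}.
                 X (Br (nths cs S1 @ [(d1, j1), (d2, j2)]) 0 a) *
                 X (Br ((0, a) # nths cs ({..<length cs} - S1)) (d3 - 1) r))
          | cs d1 j1 d2 j2 d3 r. 1 \<le> d3 \<and> 0 \<le> deg (Br (cs @ [(d1,j1),(d2,j2)]) d3 r)}"

inductive_set ideal_gen :: "'a::comm_ring_1 set \<Rightarrow> 'a set" for G where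
  zero: "0 \<in> ideal_gen G"
| gen: "g \<in> G \<Longrightarrow> g \<in> ideal_gen G"
| add: "a \<in> ideal_gen G \<Longrightarrow> b \<in> ideal_gen G \<Longrightarrow> a + b \<in> ideal_gen G"
| mult: "a \<in> ideal_gen G \<Longrightarrow> c * a \<in> ideal_gen G"

definition Rel :: "fpoly set" where
  "Rel = ideal_gen (GW1 \<union> GW2 \<union> GW3 \<union> GW4 \<union> GW5a \<union> GW5b)"

definition rel_eq :: "fpoly \<Rightarrow> fpoly \<Rightarrow> bool" where
  "rel_eq p q \<longleftrightarrow> p - q \<in> Rel"

lemma equivp_rel_eq: "equivp rel_eq"
proof (rule equivpI)
  show "reflp rel_eq" by (rule reflpI) (simp add: rel_eq_def Rel_def ideal_gen.zero)
  show "symp rel_eq"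
  proof (rule sympI)
    fix p q assume "rel_eq p q"
    then have "(-1) * (p - q) \<in> Rel" unfolding rel_eq_def Rel_def by (rule ideal_gen.mult)
    then show "rel_eq q p" by (simp add: rel_eq_def)
  qed
  show "transp rel_eq"
  proof (rule transpI)
    fix p q s assume "rel_eq p q" "rel_eq q s"
    then have "(p - q) + (q - s) \<in> Rel" unfolding rel_eq_def Rel_def by (rule ideal_gen.add)
    then show "rel_eq p s" by (simp add: rel_eq_def)
  qed
qed

quotient_type gw = fpoly / rel_eq
  by (rule equivp_rel_eq)

typedef avar = "{(i::nat, j::nat). i \<le> j \<and> 0 < j}"
  by (rule exI[of _ "(0,1)"]) simp

type_synonym apoly = "(avar \<Rightarrow>\<^sub>0 nat) \<Rightarrow>\<^sub>0 complex"

definition subst_hom :: "('v \<Rightarrow> fpoly) \<Rightarrow> (('v \<Rightarrow>\<^sub>0 nat) \<Rightarrow>\<^sub>0 complex) \<Rightarrow> fpoly" where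
  "subst_hom f p = (\<Sum>mon\<in>Poly_Mapping.keys p.
      cst (Poly_Mapping.lookup p mon) * (\<Prod>v\<in>Poly_Mapping.keys (mon::'v \<Rightarrow>\<^sub>0 nat). f v ^ Poly_Mapping.lookup mon v))"

definition phi :: "avar \<Rightarrow> fpoly" where
  "phi v = X (Br [(0,1), (0, snd (Rep_avar v))] 0 (fst (Rep_avar v)))"

definition r_map :: "apoly \<Rightarrow> gw" where
  "r_map q = abs_gw (subst_hom phi q)"

end

theory Submission
  imports Defs "HOL-Computational_Algebra.Polynomial"
begin

text \<open>
  Surjectivity is reconstruction: the topological recursion (GW5) lowers the total number of
  \<open>\<tau>\<close>'s, the divisor relation (GW4) brings one- and two-point symbols back to three points, and for
  primary symbols \<open>H\<^sup>i\<close> with \<open>i \<ge> 2\<close> is traded for \<open>H\<^sup>1\<close> and \<open>H\<^bsup>i-1\<^esup>\<close> by applying (GW5) and (GW4) to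
  \<open>\<langle>H\<^sup>1, \<tau>\<^sub>1H\<^bsup>i-1\<^esup>, \<dots>\<rangle>\<close> with \<open>H\<^sup>1\<close> on the far side of the splitting.

  Injectivity needs a model over \<open>A\<close> in which \<open>\<langle>H\<^sup>1, H\<^sup>j, H\<^sub>i\<rangle>\<close> is \<open>a\<^bsub>ij\<^esub>\<close>. Correlators are the
  coefficients of power series in variables \<open>t\<^bsub>d,i\<^esub>\<close> with values in the endomorphisms of
  \<open>A[x]\<close>, where \<open>x\<^sup>i\<close> stands for \<open>H\<^sup>i\<close>. The unknowns are the two-point matrices \<open>S\<^sub>n\<close>, with entries
  \<open>\<langle>\<langle>\<tau>\<^bsub>n-1\<^esub>H\<^sup>i, H\<^sub>a\<rangle>\<rangle>\<close>; they satisfy \<open>\<partial>\<^sub>x S\<^sub>n = N\<^sub>x S\<^bsub>n-1\<^esub>\<close>, where \<open>N\<^sub>x\<close> is quantum multiplication. The divisor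
  relation expresses multiplication by \<open>H\<^sup>1\<close> as \<open>M = \<delta>S\<^sub>1 + x\<close>, the string relation gives the unit vector \<open>\<zeta>\<close> as
  an explicit expression in the \<open>S\<^sub>n\<close>, and \<open>N\<^bsub>(d,i)\<^esub>\<close> is the unique operator that commutes with the cyclic
  operator \<open>M\<close> and sends \<open>\<zeta>\<close> to \<open>S\<^sub>d x\<^sup>i\<close>. This makes the equations for \<open>S\<close> a closed evolution system.
  Integrability, \<open>\<partial>\<^sub>y N\<^sub>x = \<partial>\<^sub>x N\<^sub>y\<close>, holds because the difference commutes with \<open>M\<close> and kills \<open>\<zeta>\<close>.

  The series are functions on words of letters \<open>(d, i)\<close> with the shuffle product, so that the
  derivatives \<open>\<partial>\<^sub>x\<close> need not commute a priori: the system can be solved by recursion on words without any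
  compatibility check, and symmetry of the solution is a consequence of integrability.
\<close>

section \<open>Shuffle series\<close>

text \<open>The relations overdetermine the symbols, so values cannot be assigned symbol by symbol;
  injectivity needs one object from which all relations follow. Its rigidity comes from cyclicity:
  an intertwiner for \<open>M\<close> is determined by its value on a single vector. By (GW2) the
  leading part of \<open>M\<close> at the origin is the shift \<open>x^j \<mapsto> x^(j+1)\<close>;
  the entries \<open>a_ij\<close> below it may be chosen freely, which is why they are coordinates.
  The variable \<open>a_ij\<close> has weight j + 1 - i, the degree of its symbol. These weights are
  positive, so in characteristic zero the Euler operator is invertible on polynomials without
  constant term, and this produces the values of \<open>S\<close> at the origin. The same grading
  forces correlators of negative degree to vanish and turns (GW2) into a computation modulo
  polynomials without constant term, where only the classical product is left. Vectors are encoded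
  as operators: an identity at the vacuum is written as an identity after right multiplication by
  the projection \<open>p\<close>, so the whole calculus takes place in one ring of operator-valued
  series.\<close>

typedef ('x, 'e) ser = "UNIV :: ('x list \<Rightarrow> 'e) set"
  morphisms scoef Ser by simp

lemma scoef_Ser [simp]: "scoef (Ser f) = f"
  by (simp add: Ser_inverse)

lemma ser_eqI: "(\<And>xs. scoef f xs = scoef g xs) \<Longrightarrow> f = g"
  by (metis scoef_inject ext)

text \<open>The recursion is the Leibniz rule for stripping the first letter, so \<open>der\<close>
  is a derivation by construction. The coefficients need not commute; \<open>f\<close> always stays
  to the left of \<open>g\<close>.\<close>

primrec shuf :: "'x list \<Rightarrow> ('x list \<Rightarrow> 'e::ring_1) \<Rightarrow> ('x list \<Rightarrow> 'e) \<Rightarrow> 'e" where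
  "shuf [] f g = f [] * g []"
| "shuf (x # xs) f g = shuf xs (\<lambda>l. f (x # l)) g + shuf xs f (\<lambda>l. g (x # l))"

instantiation ser :: (type, ring_1) ring_1
begin

definition "0 = Ser (\<lambda>xs. 0)"
definition "1 = Ser (\<lambda>xs. if xs = [] then 1 else 0)"
definition "f + g = Ser (\<lambda>xs. scoef f xs + scoef g xs)"
definition "f - g = Ser (\<lambda>xs. scoef f xs - scoef g xs)"
definition "- f = Ser (\<lambda>xs. - scoef f xs)"
definition "f * g = Ser (\<lambda>xs. shuf xs (scoef f) (scoef g))"

lemma shuf_add_left: "shuf xs (\<lambda>l. f l + f' l) g = shuf xs f g + shuf xs f' g"
  by (induction xs arbitrary: f f' g) (simp_all add: algebra_simps)

lemma shuf_add_right: "shuf xs f (\<lambda>l. g l + g' l) = shuf xs f g + shuf xs f g'"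
  by (induction xs arbitrary: f g g') (simp_all add: algebra_simps)

lemma shuf_assoc: "shuf xs (\<lambda>l. shuf l f g) h = shuf xs f (\<lambda>l. shuf l g h)"
  by (induction xs arbitrary: f g h) (simp_all add: algebra_simps shuf_add_left shuf_add_right)

lemma shuf_0: "shuf xs (\<lambda>l. 0) g = 0" "shuf xs f (\<lambda>l. 0) = 0"
  by (induction xs arbitrary: f g) auto

lemma shuf_1: "shuf xs (\<lambda>l. if l = [] then 1 else 0) g = g xs"
  "shuf xs f (\<lambda>l. if l = [] then 1 else 0) = f xs"
  by (induction xs arbitrary: f g) (auto simp: shuf_0)

instance
proof
  fix a b c :: "('a, 'b) ser"
  show "a * b * c = a * (b * c)"
    by (simp add: times_ser_def shuf_assoc)
  show "(a + b) * c = a * c + b * c"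
    by (simp add: times_ser_def plus_ser_def shuf_add_left)
  show "a * (b + c) = a * b + a * c"
    by (simp add: times_ser_def plus_ser_def shuf_add_right)
  show "1 * a = a" "a * 1 = a"
    by (simp_all add: times_ser_def one_ser_def shuf_1 scoef_inverse)
  show "(0 :: ('a, 'b) ser) \<noteq> 1"
  proof
    assume "(0 :: ('a, 'b) ser) = 1"
    then have "scoef (0 :: ('a, 'b) ser) [] = scoef 1 []" by simp
    then show False by (simp add: zero_ser_def one_ser_def)
  qed
qed (simp_all add: zero_ser_def plus_ser_def minus_ser_def uminus_ser_def add_ac scoef_inverse)

end

lemma scoef_ring [simp]:
  "scoef 0 xs = 0" "scoef (f + g) xs = scoef f xs + scoef g xs"
  "scoef (f - g) xs = scoef f xs - scoef g xs" "scoef (- f) xs = - scoef f xs"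
  by (simp_all add: zero_ser_def plus_ser_def minus_ser_def uminus_ser_def)

lemma scoef_1: "scoef 1 xs = (if xs = [] then 1 else 0)"
  by (simp add: one_ser_def)

lemma scoef_sum: "scoef (sum f A) xs = (\<Sum>a\<in>A. scoef (f a) xs)"
  by (induction A rule: infinite_finite_induct) auto

definition der :: "'x \<Rightarrow> ('x, 'e) ser \<Rightarrow> ('x, 'e) ser" where
  "der x f = Ser (\<lambda>xs. scoef f (x # xs))"

lemma scoef_Cons: "scoef f (x # xs) = scoef (der x f) xs"
  by (simp add: der_def)

lemma scoef_mult_Nil [simp]: "scoef (f * g) [] = scoef f [] * scoef g []"
  by (simp add: times_ser_def)

lemma der_mult: "der x (f * g) = der x f * g + f * der x g"
  by (simp add: der_def times_ser_def plus_ser_def)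

lemma der_ring [simp]:
  "der x 0 = 0" "der x 1 = 0" "der x (f + g) = der x f + der x g"
  "der x (f - g) = der x f - der x g" "der x (- f) = - der x f"
  by (rule ser_eqI, simp add: scoef_Cons[symmetric] scoef_1)+

lemma der_sum: "der x (sum f A) = (\<Sum>a\<in>A. der x (f a))"
  by (induction A rule: infinite_finite_induct) auto

text \<open>Uniqueness for an initial value problem: the identities of the flow are checked at the
  origin and then after one derivative.\<close>

lemma ser_der_eqI: "scoef f [] = scoef g [] \<Longrightarrow> (\<And>x. der x f = der x g) \<Longrightarrow> f = g"
  by (rule ser_eqI) (metis list.exhaust scoef_Cons)

definition cs :: "'e \<Rightarrow> ('x, 'e::ring_1) ser" where
  "cs a = Ser (\<lambda>xs. if xs = [] then a else 0)"

lemma scoef_cs: "scoef (cs a) xs = (if xs = [] then a else 0)"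
  by (simp add: cs_def)

lemma scoef_cs_Nil [simp]: "scoef (cs a) [] = a"
  by (simp add: cs_def)

lemma der_cs [simp]: "der x (cs a) = 0"
  by (rule ser_eqI) (simp add: scoef_Cons[symmetric] scoef_cs)

lemma cs_mult: "cs (a * b) = cs a * cs b"
  by (rule ser_der_eqI) (simp_all add: der_mult)

lemma cs_ring: "cs 0 = 0" "cs 1 = 1" "cs (a + b) = cs a + cs b" "cs (a - b) = cs a - cs b" "cs (- a) = - cs a"
  by (rule ser_eqI, simp add: scoef_cs scoef_1)+

lemma cs_power: "cs (a ^ n) = cs a ^ n"
  by (induction n) (simp_all add: cs_ring cs_mult)

lemma scoef_cs_mult: "scoef (cs a * f) xs = a * scoef f xs"
  by (induction xs arbitrary: f) (simp_all add: scoef_Cons der_mult)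

lemma scoef_mult_cs: "scoef (f * cs a) xs = scoef f xs * a"
  by (induction xs arbitrary: f) (simp_all add: scoef_Cons der_mult)

text \<open>The shape in which a product of series meets (GW5): the entries are distributed over the
  two factors in all possible ways.\<close>

lemma scoef_mult_split:
  "scoef (f * g) xs = (\<Sum>S\<in>Pow {..<length xs}. scoef f (nths xs S) * scoef g (nths xs ({..<length xs} - S)))"
proof (induction xs arbitrary: f g)
  case (Cons x xs)
  let ?n = "length xs"
  let ?F = "\<lambda>S. scoef f (nths (x # xs) S) * scoef g (nths (x # xs) ({..<Suc ?n} - S))"
  have 1: "Pow {..<Suc ?n} = (\<lambda>S. insert 0 (Suc ` S)) ` Pow {..<?n} \<union> (\<lambda>S. Suc ` S) ` Pow {..<?n}"
    by (simp add: lessThan_Suc_eq_insert_0 Pow_insert image_Pow_surj[symmetric] image_image Un_commute)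
  have 2: "inj_on (\<lambda>S. insert 0 (Suc ` S)) (Pow {..<?n})" "inj_on (\<lambda>S. Suc ` S) (Pow {..<?n})"
    by (rule inj_onI, simp add: inj_image_eq_iff insert_ident)+
  have "sum ?F (Pow {..<Suc ?n}) = (\<Sum>S\<in>Pow {..<?n}. ?F (insert 0 (Suc ` S))) + (\<Sum>S\<in>Pow {..<?n}. ?F (Suc ` S))"
    unfolding 1 by (subst sum.union_disjoint) (auto simp: sum.reindex 2)
  also have "(\<Sum>S\<in>Pow {..<?n}. ?F (insert 0 (Suc ` S))) = scoef (der x f * g) xs"
    unfolding Cons.IH
  proof (rule sum.cong[OF refl])
    fix S assume "S \<in> Pow {..<?n}"
    have "{j. Suc j < Suc ?n \<and> Suc j \<notin> insert 0 (Suc ` S)} = {..<?n} - S" by auto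
    then show "?F (insert 0 (Suc ` S)) = scoef (der x f) (nths xs S) * scoef g (nths xs ({..<?n} - S))"
      by (simp add: nths_Cons scoef_Cons image_iff)
  qed
  also have "(\<Sum>S\<in>Pow {..<?n}. ?F (Suc ` S)) = scoef (f * der x g) xs"
    unfolding Cons.IH
  proof (rule sum.cong[OF refl])
    fix S assume "S \<in> Pow {..<?n}"
    have "{j. Suc j < Suc ?n \<and> Suc j \<notin> (Suc ` S)} = {..<?n} - S" by auto
    then show "?F (Suc ` S) = scoef f (nths xs S) * scoef (der x g) (nths xs ({..<?n} - S))"
      by (simp add: nths_Cons scoef_Cons image_iff)
  qed
  finally show ?case by (simp add: scoef_Cons der_mult)
qed simp

subsection \<open>Derivations\<close>

definition derivation :: "('a::ring_1 \<Rightarrow> 'a) \<Rightarrow> bool" where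
  "derivation D \<longleftrightarrow> (\<forall>f g. D (f + g) = D f + D g) \<and> (\<forall>f g. D (f * g) = D f * g + f * D g)"

lemma derivation_add: "derivation D \<Longrightarrow> D (f + g) = D f + D g"
  and derivation_mult: "derivation D \<Longrightarrow> D (f * g) = D f * g + f * D g"
  by (simp_all add: derivation_def)

lemma derivation_0: "derivation D \<Longrightarrow> D 0 = 0"
  by (metis add_cancel_right_left derivation_add)

lemma derivation_1: "derivation D \<Longrightarrow> D 1 = 0"
  by (metis add_cancel_right_left derivation_mult mult.right_neutral mult_1)

lemma derivation_minus: "derivation D \<Longrightarrow> D (- f) = - D f"
  by (metis add.right_inverse derivation_0 derivation_add minus_unique)

lemma derivation_diff: "derivation D \<Longrightarrow> D (f - g) = D f - D g"
  by (metis add_uminus_conv_diff derivation_add derivation_minus)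

lemma derivation_sum: "derivation D \<Longrightarrow> D (sum f A) = (\<Sum>a\<in>A. D (f a))"
  by (induction A rule: infinite_finite_induct) (auto simp: derivation_0 derivation_add)

lemmas derivation_simps = derivation_0 derivation_1 derivation_add derivation_minus derivation_diff

lemma derivation_power_0: "derivation D \<Longrightarrow> D a = 0 \<Longrightarrow> D (a ^ n) = 0"
  by (induction n) (simp_all add: derivation_1 derivation_mult)

lemma derivation_der: "derivation (der x)"
  by (simp add: derivation_def der_mult)

lemma derivation_plus: "derivation D \<Longrightarrow> derivation D' \<Longrightarrow> derivation (\<lambda>f. D f + D' f)"
  by (simp add: derivation_def algebra_simps)

lemma derivation_minus_fun: "derivation D \<Longrightarrow> derivation D' \<Longrightarrow> derivation (\<lambda>f. D f - D' f)"
  by (simp add: derivation_def algebra_simps)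

lemma derivation_comm: "derivation (\<lambda>f. a * f - f * a)"
  by (simp add: derivation_def algebra_simps)

lemma derivation_bracket:
  assumes "derivation D" "derivation D'"
  shows "derivation (\<lambda>f. D (D' f) - D' (D f))"
  unfolding derivation_def
  by (simp add: derivation_add[OF assms(1)] derivation_add[OF assms(2)] derivation_mult[OF assms(1)]
      derivation_mult[OF assms(2)] algebra_simps)

definition smap :: "('e \<Rightarrow> 'e) \<Rightarrow> ('x, 'e) ser \<Rightarrow> ('x, 'e) ser" where
  "smap d f = Ser (\<lambda>xs. d (scoef f xs))"

lemma scoef_smap [simp]: "scoef (smap d f) xs = d (scoef f xs)"
  by (simp add: smap_def)

lemma der_smap: "der x (smap d f) = smap d (der x f)"
  by (rule ser_eqI) (simp add: scoef_Cons[symmetric])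

lemma smap_add: "derivation d \<Longrightarrow> smap d (f + g) = smap d f + smap d g"
  by (rule ser_eqI) (simp add: derivation_add)

lemma derivation_smap:
  assumes "derivation d" shows "derivation (smap d :: ('x, 'a::ring_1) ser \<Rightarrow> ('x, 'a) ser)"
proof -
  have "scoef (smap d (f * g)) xs = scoef (smap d f * g + f * smap d g) xs" for f g :: "('x, 'a) ser" and xs
    by (induction xs arbitrary: f g)
      (simp_all add: derivation_mult[OF assms] derivation_add[OF assms] scoef_Cons der_smap der_mult smap_add[OF assms]
        algebra_simps)
  then have "smap d (f * g) = smap d f * g + f * smap d g" for f g :: "('x, 'a) ser"
    by (intro ser_eqI)
  then show ?thesis
    by (simp add: derivation_def smap_add[OF assms])
qed

lemma smap_cs: "derivation d \<Longrightarrow> smap d (cs a) = cs (d a)"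
  by (rule ser_eqI) (simp add: scoef_cs derivation_0)

section \<open>Linear vector fields and the Euler field\<close>

definition dero :: "'x option \<Rightarrow> ('x, 'e::ring_1) ser \<Rightarrow> ('x, 'e) ser" where
  "dero z f = (case z of None \<Rightarrow> 0 | Some y \<Rightarrow> der y f)"

lemma dero_simps [simp]: "dero None f = 0" "dero (Some y) f = der y f"
  by (simp_all add: dero_def)

lemma dero_add: "dero y (f + g) = dero y f + dero y g"
  by (cases y) auto

lemma dero_mult: "dero y (f * g) = dero y f * g + f * dero y g"
  by (cases y) (auto simp: der_mult)

primrec tshf :: "('x \<Rightarrow> 'x option) \<Rightarrow> 'x list \<Rightarrow> ('x list \<Rightarrow> 'e::ring_1) \<Rightarrow> 'e" where
  "tshf \<phi> [] f = 0"
| "tshf \<phi> (x # xs) f = (case \<phi> x of None \<Rightarrow> 0 | Some y \<Rightarrow> f (y # xs)) + tshf \<phi> xs (\<lambda>l. f (x # l))"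

text \<open>The vector field \<open>\<Sum>\<^sub>x t\<^sub>x \<partial>\<^bsub>\<phi> x\<^esub>\<close>.\<close>

definition tsh :: "('x \<Rightarrow> 'x option) \<Rightarrow> ('x, 'e::ring_1) ser \<Rightarrow> ('x, 'e) ser" where
  "tsh \<phi> f = Ser (\<lambda>xs. tshf \<phi> xs (scoef f))"

lemma scoef_tsh_Nil [simp]: "scoef (tsh \<phi> f) [] = 0"
  by (simp add: tsh_def)

lemma der_tsh: "der x (tsh \<phi> f) = dero (\<phi> x) f + tsh \<phi> (der x f)"
  by (rule ser_eqI) (simp add: tsh_def der_def dero_def split: option.splits)

lemma tsh_add: "tsh \<phi> (f + g) = tsh \<phi> f + tsh \<phi> g"
proof (rule ser_eqI)
  show "scoef (tsh \<phi> (f + g)) xs = scoef (tsh \<phi> f + tsh \<phi> g) xs" for xs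
    by (induction xs arbitrary: f g) (simp_all add: scoef_Cons der_tsh dero_add)
qed

lemma derivation_tsh: "derivation (tsh \<phi> :: ('x, 'a::ring_1) ser \<Rightarrow> ('x, 'a) ser)"
proof -
  have "scoef (tsh \<phi> (f * g)) xs = scoef (tsh \<phi> f * g + f * tsh \<phi> g) xs" for f g :: "('x, 'a) ser" and xs
    by (induction xs arbitrary: f g)
      (simp_all add: scoef_Cons der_tsh der_mult tsh_add dero_mult algebra_simps)
  then have "tsh \<phi> (f * g) = tsh \<phi> f * g + f * tsh \<phi> g" for f g :: "('x, 'a) ser"
    by (intro ser_eqI)
  then show ?thesis
    by (simp add: derivation_def tsh_add)
qed

lemma tsh_cs [simp]: "tsh \<phi> (cs a) = 0"
proof (rule ser_eqI)
  show "scoef (tsh \<phi> (cs a)) xs = scoef 0 xs" for xs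
    by (cases xs) (simp_all add: scoef_Cons der_tsh dero_def derivation_0[OF derivation_tsh] split: option.splits)
qed

text \<open>The Euler field \<open>\<Sum> w_x t_x \<partial>_x\<close>, diagonal on words. Weights
  are integers because the entry \<open>H^0\<close> will get weight -1.\<close>

definition wtd :: "('x \<Rightarrow> int) \<Rightarrow> ('x, 'e::ring_1) ser \<Rightarrow> ('x, 'e) ser" where
  "wtd w f = Ser (\<lambda>xs. of_int (sum_list (map w xs)) * scoef f xs)"

lemma scoef_wtd: "scoef (wtd w f) xs = of_int (sum_list (map w xs)) * scoef f xs"
  by (simp add: wtd_def)

lemma cs_of_nat: "cs (of_nat n) = of_nat n"
  by (induction n) (simp_all add: cs_ring)

lemma cs_of_int: "cs (of_int k) = of_int k"
  by (cases k rule: int_diff_cases) (simp add: cs_ring cs_of_nat)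

lemma scoef_of_int_mult: "scoef (of_int k * f) xs = of_int k * scoef f xs"
  by (metis cs_of_int scoef_cs_mult)

lemma der_of_int_mult: "der x (of_int k * f) = of_int k * der x f"
  by (rule ser_eqI) (simp add: scoef_Cons[symmetric] scoef_of_int_mult)

lemma der_wtd: "der x (wtd w f) = of_int (w x) * der x f + wtd w (der x f)"
  by (rule ser_eqI) (simp add: scoef_Cons[symmetric] scoef_of_int_mult scoef_wtd algebra_simps)

lemma wtd_add: "wtd w (f + g) = wtd w f + wtd w g"
  by (rule ser_eqI) (simp add: scoef_wtd algebra_simps)

lemma of_int_commute: "of_int k * a = a * (of_int k :: 'a::ring_1)"
  by (rule mult_of_int_commute)

lemma derivation_wtd: "derivation (wtd w :: ('x, 'a::ring_1) ser \<Rightarrow> ('x, 'a) ser)"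
proof -
  have "scoef (wtd w (f * g)) xs = scoef (wtd w f * g + f * wtd w g) xs" for f g :: "('x, 'a) ser" and xs
  proof (induction xs arbitrary: f g)
    case Nil then show ?case by (simp add: scoef_wtd)
  next
    case (Cons x xs)
    have "f * (of_int (w x) * der x g) = of_int (w x) * (f * der x g)"
      by (metis mult.assoc of_int_commute)
    then show ?case
      by (simp add: scoef_Cons der_wtd der_mult wtd_add Cons algebra_simps)
  qed
  then have "wtd w (f * g) = wtd w f * g + f * wtd w g" for f g :: "('x, 'a) ser"
    by (intro ser_eqI)
  then show ?thesis
    by (simp add: derivation_def wtd_add)
qed

section \<open>Locally finite sums over the coordinates\<close>

primrec bsumf :: "'x list \<Rightarrow> ('x \<Rightarrow> 'x list \<Rightarrow> 'e::ring_1) \<Rightarrow> 'e" where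
  "bsumf [] h = 0"
| "bsumf (y # xs) h = h y xs + bsumf xs (\<lambda>x l. h x (y # l))"

text \<open>The locally finite sum \<open>\<Sum>\<^sub>x t\<^sub>x h\<^sub>x\<close>.\<close>

definition bsum :: "('x \<Rightarrow> ('x, 'e::ring_1) ser) \<Rightarrow> ('x, 'e) ser" where
  "bsum h = Ser (\<lambda>xs. bsumf xs (\<lambda>x. scoef (h x)))"

lemma scoef_bsum_Nil [simp]: "scoef (bsum h) [] = 0"
  by (simp add: bsum_def)

lemma der_bsum: "der y (bsum h) = h y + bsum (\<lambda>x. der y (h x))"
  by (rule ser_eqI) (simp add: bsum_def der_def)

lemma bsum_add: "bsum (\<lambda>x. f x + g x) = bsum f + bsum g"
proof (rule ser_eqI)
  show "scoef (bsum (\<lambda>x. f x + g x)) xs = scoef (bsum f + bsum g) xs" for xs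
    by (induction xs arbitrary: f g) (simp_all add: scoef_Cons der_bsum)
qed

lemma bsum_uminus: "bsum (\<lambda>x. - f x) = - bsum f"
proof (rule ser_eqI)
  show "scoef (bsum (\<lambda>x. - f x)) xs = scoef (- bsum f) xs" for xs
    by (induction xs arbitrary: f) (simp_all add: scoef_Cons der_bsum)
qed

lemma bsum_diff: "bsum (\<lambda>x. f x - g x) = bsum f - bsum g"
  using bsum_add[of f "\<lambda>x. - g x"] by (simp add: bsum_uminus)

lemma bsum_mult_left: "bsum (\<lambda>x. a * h x) = a * bsum h"
proof (rule ser_eqI)
  show "scoef (bsum (\<lambda>x. a * h x)) xs = scoef (a * bsum h) xs" for xs
    by (induction xs arbitrary: a h) (simp_all add: scoef_Cons der_bsum der_mult bsum_add algebra_simps)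
qed

lemma bsum_mult_right: "bsum (\<lambda>x. h x * a) = bsum h * a"
proof (rule ser_eqI)
  show "scoef (bsum (\<lambda>x. h x * a)) xs = scoef (bsum h * a) xs" for xs
    by (induction xs arbitrary: a h) (simp_all add: scoef_Cons der_bsum der_mult bsum_add algebra_simps)
qed

text \<open>The second sum arises when the vector field differentiates the coordinates
  themselves.\<close>

lemma tsh_bsum:
  "tsh \<phi> (bsum h) = bsum (\<lambda>x. tsh \<phi> (h x)) + bsum (\<lambda>x. case \<phi> x of None \<Rightarrow> 0 | Some y \<Rightarrow> h y)"
proof (rule ser_eqI)
  have *: "dero z (bsum h) = (case z of None \<Rightarrow> 0 | Some y \<Rightarrow> h y) + bsum (\<lambda>x. dero z (h x))"
    for z and h :: "'a \<Rightarrow> ('a, 'b) ser"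
    by (cases z) (simp_all add: der_bsum bsum_diff[of "\<lambda>x. 0" "\<lambda>x. 0", simplified])
  have **: "der x (case z of None \<Rightarrow> 0 | Some y \<Rightarrow> h y) = (case z of None \<Rightarrow> 0 | Some y \<Rightarrow> der x (h y))"
    for x z and h :: "'a \<Rightarrow> ('a, 'b) ser"
    by (cases z) simp_all
  show "scoef (tsh \<phi> (bsum h)) xs = scoef (bsum (\<lambda>x. tsh \<phi> (h x)) + bsum (\<lambda>x. case \<phi> x of None \<Rightarrow> 0 | Some y \<Rightarrow> h y)) xs" for xs
    by (induction xs arbitrary: h) (simp_all add: scoef_Cons der_bsum der_tsh bsum_add tsh_add * ** algebra_simps)
qed

lemma smap_bsum: assumes "derivation d" shows "smap d (bsum h) = bsum (\<lambda>x. smap d (h x))"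
proof (rule ser_eqI)
  show "scoef (smap d (bsum h)) xs = scoef (bsum (\<lambda>x. smap d (h x))) xs" for xs
    by (induction xs arbitrary: h)
      (simp_all add: scoef_Cons der_bsum der_smap smap_add[OF assms] derivation_0[OF assms])
qed

lemma wtd_bsum: "wtd w (bsum h) = bsum (\<lambda>x. wtd w (h x) + of_int (w x) * h x)"
proof (rule ser_eqI)
  show "scoef (wtd w (bsum h)) xs = scoef (bsum (\<lambda>x. wtd w (h x) + of_int (w x) * h x)) xs" for xs
  proof (induction xs arbitrary: h)
    case Nil then show ?case by (simp add: scoef_wtd)
  next
    case (Cons y xs)
    show ?case
      by (simp add: scoef_Cons der_bsum der_wtd wtd_add Cons algebra_simps der_of_int_mult bsum_add bsum_mult_left)
  qed
qed

lemma tsh_smap: assumes "derivation d" shows "tsh \<phi> (smap d f) = smap d (tsh \<phi> f)"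
proof (rule ser_eqI)
  have *: "dero z (smap d f) = smap d (dero z f)" for z and f :: "('b, 'a) ser"
    by (cases z) (simp_all add: der_smap derivation_0[OF derivation_smap[OF assms]])
  show "scoef (tsh \<phi> (smap d f)) xs = scoef (smap d (tsh \<phi> f)) xs" for xs
    by (induction xs arbitrary: f)
      (simp_all add: scoef_Cons der_smap der_tsh * smap_add[OF assms] derivation_0[OF assms])
qed

subsection \<open>Approximation modulo an ideal\<close>

definition tideal :: "'e::ring_1 set \<Rightarrow> bool" where
  "tideal J \<longleftrightarrow> 0 \<in> J \<and> (\<forall>a\<in>J. \<forall>b\<in>J. a + b \<in> J) \<and> (\<forall>a\<in>J. \<forall>r. r * a \<in> J \<and> a * r \<in> J)"

lemma tideal_0: "tideal J \<Longrightarrow> 0 \<in> J"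
  and tideal_add: "tideal J \<Longrightarrow> a \<in> J \<Longrightarrow> b \<in> J \<Longrightarrow> a + b \<in> J"
  and tideal_left: "tideal J \<Longrightarrow> a \<in> J \<Longrightarrow> r * a \<in> J"
  and tideal_right: "tideal J \<Longrightarrow> a \<in> J \<Longrightarrow> a * r \<in> J"
  by (auto simp: tideal_def)

lemma tideal_uminus: "tideal J \<Longrightarrow> a \<in> J \<Longrightarrow> - a \<in> J"
  using tideal_left[of J a "- 1"] by simp

lemma tideal_diff: "tideal J \<Longrightarrow> a \<in> J \<Longrightarrow> b \<in> J \<Longrightarrow> a - b \<in> J"
  using tideal_add[of J a "- b"] tideal_uminus by fastforce

lemma tideal_cancel: "tideal J \<Longrightarrow> a - b \<in> J \<Longrightarrow> a \<in> J \<longleftrightarrow> b \<in> J"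
  by (metis add.commute diff_add_cancel minus_diff_eq tideal_add tideal_uminus)

lemma tideal_zero: "tideal {0}"
  by (simp add: tideal_def)

text \<open>Two uses: with \<open>J = {0}\<close> it expresses agreement of series up to a word
  length, for inductions on that length; with \<open>J = K\<close> it expresses the classical
  limit.\<close>

definition ap :: "'e::ring_1 set \<Rightarrow> nat \<Rightarrow> ('x, 'e) ser \<Rightarrow> bool" where
  "ap J n f \<longleftrightarrow> (\<forall>xs. length xs \<le> n \<longrightarrow> scoef f xs \<in> J)"

lemma ap_0_iff: "ap J 0 f \<longleftrightarrow> scoef f [] \<in> J"
  by (simp add: ap_def)

lemma ap_Suc_iff: "ap J (Suc n) f \<longleftrightarrow> scoef f [] \<in> J \<and> (\<forall>x. ap J n (der x f))"
proof
  assume "ap J (Suc n) f"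
  then show "scoef f [] \<in> J \<and> (\<forall>x. ap J n (der x f))"
    by (auto simp: ap_def scoef_Cons[symmetric])
next
  assume A: "scoef f [] \<in> J \<and> (\<forall>x. ap J n (der x f))"
  have "scoef f xs \<in> J" if "length xs \<le> Suc n" for xs
    using A that by (cases xs) (auto simp: ap_def scoef_Cons)
  then show "ap J (Suc n) f" by (simp add: ap_def)
qed

lemma ap_mono: "ap J n f \<Longrightarrow> m \<le> n \<Longrightarrow> ap J m f"
  by (auto simp: ap_def)

lemma ap_zero_iff: "(\<forall>n. ap {0} n f) \<longleftrightarrow> f = 0"
proof
  assume "\<forall>n. ap {0} n f"
  then have "scoef f xs = scoef 0 xs" for xs
    using le_refl[of "length xs"] unfolding ap_def by auto
  then show "f = 0" by (rule ser_eqI)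
qed (simp add: ap_def)

context
  fixes J :: "'e::ring_1 set" assumes J: "tideal J"
begin

lemma ap_0: "ap J n 0"
  by (simp add: ap_def tideal_0[OF J])

lemma ap_add: "ap J n f \<Longrightarrow> ap J n g \<Longrightarrow> ap J n (f + g)"
  by (simp add: ap_def tideal_add[OF J])

lemma ap_uminus: "ap J n f \<Longrightarrow> ap J n (- f)"
  by (simp add: ap_def tideal_uminus[OF J])

lemma ap_diff: "ap J n f \<Longrightarrow> ap J n g \<Longrightarrow> ap J n (f - g)"
  by (simp add: ap_def tideal_diff[OF J])

lemma ap_mult: "ap J n f \<Longrightarrow> ap J n (f * g) \<and> ap J n (g * f)"
proof (induction n arbitrary: f g)
  case 0 then show ?case by (simp add: ap_0_iff tideal_left[OF J] tideal_right[OF J])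
next
  case (Suc n)
  then have 1: "scoef f [] \<in> J" "\<And>x. ap J n (der x f)" "ap J n f"
    by (auto simp: ap_Suc_iff intro: ap_mono[OF Suc.prems])
  then show ?case
    by (simp add: ap_Suc_iff der_mult ap_add Suc.IH tideal_left[OF J] tideal_right[OF J])
qed

lemmas ap_right = ap_mult[THEN conjunct1] and ap_left = ap_mult[THEN conjunct2]

lemma ap_dero: "ap J (Suc n) f \<Longrightarrow> ap J n (dero z f)"
  by (cases z) (auto simp: ap_0 ap_Suc_iff)

lemma ap_tsh: "ap J n f \<Longrightarrow> ap J n (tsh \<phi> f)"
proof (induction n arbitrary: f)
  case 0 then show ?case by (simp add: ap_0_iff tideal_0[OF J])
next
  case (Suc n)
  then have "\<And>x. ap J n (der x f)" by (simp add: ap_Suc_iff)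
  with Suc show ?case
    by (simp add: ap_Suc_iff[of J n "tsh \<phi> f"] der_tsh ap_add ap_dero tideal_0[OF J])
qed

lemma ap_bsum: "(\<And>x. ap J n (h x)) \<Longrightarrow> ap J (Suc n) (bsum h)"
proof (induction n arbitrary: h)
  case 0
  have "scoef (bsum h') [] \<in> J" for h' :: "'a \<Rightarrow> ('a, 'e) ser" by (simp add: tideal_0[OF J])
  with 0 show ?case by (simp add: ap_Suc_iff ap_0_iff der_bsum)
next
  case (Suc n)
  then have "ap J (Suc n) (bsum (\<lambda>x. der y (h x)))" for y
    by (intro Suc.IH) (simp add: ap_Suc_iff)
  with Suc show ?case
    by (subst ap_Suc_iff) (simp add: der_bsum ap_add tideal_0[OF J])
qed

lemma ap_smap: "(\<And>a. a \<in> J \<Longrightarrow> d a \<in> J) \<Longrightarrow> ap J n f \<Longrightarrow> ap J n (smap d f)"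
  by (simp add: ap_def)

lemma ap_comm:
  "(\<And>xs ys. length xs \<le> n \<Longrightarrow> length ys \<le> n \<Longrightarrow> scoef f xs * scoef g ys - scoef g ys * scoef f xs \<in> J)
   \<Longrightarrow> ap J n (f * g - g * f)"
proof (induction n arbitrary: f g)
  case 0 then show ?case using "0.prems"[of "[]" "[]"] by (simp add: ap_0_iff)
next
  case (Suc n)
  have 1: "ap J n (der x f * g - g * der x f)" for x
    by (rule Suc.IH) (use Suc.prems in \<open>auto simp: scoef_Cons[symmetric]\<close>)
  have 2: "ap J n (f * der x g - der x g * f)" for x
    by (rule Suc.IH) (use Suc.prems in \<open>auto simp: scoef_Cons[symmetric]\<close>)
  have "der x (f * g - g * f) = (der x f * g - g * der x f) + (f * der x g - der x g * f)" for x
    by (simp add: der_mult algebra_simps)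
  then show ?case
    using Suc.prems[of "[]" "[]"] by (simp add: ap_Suc_iff ap_add[OF 1 2])
qed

text \<open>Among the splittings of \<open>xs\<close>, all but the one that gives the whole word to
  \<open>f\<close> evaluate \<open>f\<close> at a shorter word and so contribute an element of
  \<open>J\<close>.\<close>

lemma leading_left:
  "(\<And>ys. length ys < length xs \<Longrightarrow> scoef f ys \<in> J) \<Longrightarrow> scoef (f * g) xs - scoef f xs * scoef g [] \<in> J"
proof (induction xs arbitrary: f g)
  case (Cons x xs)
  have 1: "scoef (der x f * g) xs - scoef (der x f) xs * scoef g [] \<in> J"
    using Cons.prems by (intro Cons.IH) (simp add: scoef_Cons[symmetric])
  have 2: "scoef (f * der x g) xs - scoef f xs * scoef (der x g) [] \<in> J"
    using Cons.prems by (intro Cons.IH) simp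
  have 3: "scoef f xs * scoef (der x g) [] \<in> J"
    using Cons.prems by (simp add: tideal_right[OF J])
  show ?case
    using tideal_add[OF J 1 tideal_add[OF J 2 3]] by (simp add: scoef_Cons der_mult algebra_simps)
qed (simp add: tideal_0[OF J])

lemma leading_right:
  "(\<And>ys. length ys < length xs \<Longrightarrow> scoef g ys \<in> J) \<Longrightarrow> scoef (f * g) xs - scoef f [] * scoef g xs \<in> J"
proof (induction xs arbitrary: f g)
  case (Cons x xs)
  have 1: "scoef (f * der x g) xs - scoef f [] * scoef (der x g) xs \<in> J"
    using Cons.prems by (intro Cons.IH) (simp add: scoef_Cons[symmetric])
  have 2: "scoef (der x f * g) xs - scoef (der x f) [] * scoef g xs \<in> J"
    using Cons.prems by (intro Cons.IH) simp
  have 3: "scoef (der x f) [] * scoef g xs \<in> J"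
    using Cons.prems by (simp add: tideal_left[OF J])
  show ?case
    using tideal_add[OF J 1 tideal_add[OF J 2 3]] by (simp add: scoef_Cons der_mult algebra_simps)
qed (simp add: tideal_0[OF J])

end

subsection \<open>Intertwiners of a cyclic operator\<close>

text \<open>In the application \<open>p\<close> projects onto the vacuum, so \<open>L * p\<close>
  records the value of \<open>L\<close> there. For an operator with cyclic vacuum, a value there and
  a defect of intertwining can be prescribed at will; \<open>determined\<close> is the matching
  uniqueness modulo \<open>J\<close>.\<close>

definition solvable :: "'e::ring_1 \<Rightarrow> 'e \<Rightarrow> bool" where
  "solvable C p \<longleftrightarrow> (\<forall>P W V. \<exists>L. L * C - P * L = W \<and> L * p = V * p)"

definition determined :: "'e::ring_1 set \<Rightarrow> 'e \<Rightarrow> 'e \<Rightarrow> bool" where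
  "determined J C p \<longleftrightarrow> (\<forall>L P. L * C - P * L \<in> J \<and> L * p \<in> J \<longrightarrow> L \<in> J)"

text \<open>By induction on the word: once the shorter coefficients of \<open>L\<close> lie in
  \<open>J\<close>, both hypotheses at \<open>xs\<close> reduce to equations for
  \<open>scoef L xs\<close> over the constant terms, where \<open>C\<close> applies.\<close>

lemma ser_determined:
  assumes J: "tideal J" and C: "determined J (scoef M []) p" and Y: "scoef Y [] = 1"
    and 1: "ap J n (L * M - P * L)" and 2: "ap J n (L * Y * cs p)"
  shows "ap J n L"
proof -
  have "scoef L xs \<in> J" if "length xs \<le> n" for xs
    using that
  proof (induction xs rule: length_induct)
    case (1 xs)
    then have lo: "\<And>ys. length ys < length xs \<Longrightarrow> scoef L ys \<in> J" by simp
    have "scoef (L * M) xs - scoef (P * L) xs \<in> J"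
      using assms(4) "1.prems" by (simp add: ap_def)
    moreover have "scoef (L * M) xs - scoef L xs * scoef M [] \<in> J"
      "scoef (P * L) xs - scoef P [] * scoef L xs \<in> J"
      using leading_left[OF J lo] leading_right[OF J lo] by auto
    moreover have "scoef L xs * scoef M [] - scoef P [] * scoef L xs = (scoef (L * M) xs - scoef (P * L) xs)
        - (scoef (L * M) xs - scoef L xs * scoef M []) + (scoef (P * L) xs - scoef P [] * scoef L xs)"
      by (simp add: algebra_simps)
    ultimately have "scoef L xs * scoef M [] - scoef P [] * scoef L xs \<in> J"
      by (metis tideal_diff[OF J] tideal_add[OF J])
    moreover have "scoef L xs * p \<in> J"
    proof -
      have "scoef (L * (Y * cs p)) xs - scoef L xs * p \<in> J"
        using leading_left[OF J lo, where g = "Y * cs p"] Y by simp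
      moreover have "scoef (L * (Y * cs p)) xs \<in> J"
        using assms(5) "1.prems" by (simp add: ap_def mult.assoc)
      ultimately show ?thesis using tideal_cancel[OF J] by blast
    qed
    ultimately show ?case using C unfolding determined_def by blast
  qed
  then show ?thesis by (simp add: ap_def)
qed

lemma ser_determined_0:
  assumes "determined {0} (scoef M []) p" "scoef Y [] = 1" "L * M = P * L" "L * Y * cs p = 0"
  shows "L = 0"
proof -
  have "ap {0} n L" for n
    by (rule ser_determined[OF tideal_zero assms(1,2), of _ _ P]) (simp_all add: assms ap_0[OF tideal_zero])
  then show ?thesis using ap_zero_iff by blast
qed

lemma ser_solvable:
  fixes M Y P W V :: "('x, 'e::ring_1) ser"
  assumes C: "solvable (scoef M []) p" and Y: "scoef Y [] = 1"
  shows "\<exists>L. L * M - P * L = W \<and> L * Y * cs p = V * cs p"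
proof -
  \<comment> \<open>\<open>K r xs\<close> is the part of the solution already known at
    \<open>xs\<close>. What remains is an equation for the single coefficient at \<open>xs\<close>,
    with the constant terms of \<open>M\<close>, \<open>P\<close> and \<open>Y\<close> as its
    data.\<close>
  define K where "K r xs = Ser (\<lambda>ys. if length ys < length xs then r ys else 0)" for r :: "'x list \<Rightarrow> 'e" and xs :: "'x list"
  define F where "F r xs = (SOME l. l * scoef M [] - scoef P [] * l = scoef W xs - (scoef (K r xs * M) xs - scoef (P * K r xs) xs)
      \<and> l * p = (scoef V xs - scoef (K r xs * Y) xs) * p)" for r :: "'x list \<Rightarrow> 'e" and xs
  define r where "r = wfrec (measure length) F"
  have adm: "adm_wf (measure length) F"
    unfolding adm_wf_def
  proof (intro allI impI)
    fix f g :: "'x list \<Rightarrow> 'e" and x assume "\<forall>z. (z, x) \<in> measure length \<longrightarrow> f z = g z"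
    then have "K f x = K g x" by (auto simp: K_def intro!: ser_eqI)
    then show "F f x = F g x" by (simp add: F_def)
  qed
  have r: "r = F r"
    unfolding r_def by (rule wfrec_fixpoint[OF wf_measure adm])
  define L where "L = Ser r"
  have rs: "r xs * scoef M [] - scoef P [] * r xs = scoef W xs - (scoef (K r xs * M) xs - scoef (P * K r xs) xs)
      \<and> r xs * p = (scoef V xs - scoef (K r xs * Y) xs) * p" for xs
    by (subst (1 2 5) r, subst (1 2 3) F_def, rule someI_ex, use C in \<open>simp add: solvable_def\<close>)
  have lo: "length ys < length xs \<Longrightarrow> scoef (L - K r xs) ys \<in> {0}" for xs ys
    by (simp add: L_def K_def)
  have at: "scoef (L - K r xs) xs = r xs" for xs
    by (simp add: L_def K_def)
  have 1: "scoef (L * g) xs = scoef (K r xs * g) xs + r xs * scoef g []" for g xs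
    using leading_left[OF tideal_zero lo, of xs xs g] at[of xs] by (simp add: algebra_simps)
  have 2: "scoef (g * L) xs = scoef (g * K r xs) xs + scoef g [] * r xs" for g xs
    using leading_right[OF tideal_zero lo, of xs xs g] at[of xs] by (simp add: algebra_simps)
  have "L * M - P * L = W"
  proof (rule ser_eqI)
    show "scoef (L * M - P * L) xs = scoef W xs" for xs
      using rs[of xs] by (simp add: 1 2 algebra_simps)
  qed
  moreover have "L * Y * cs p = V * cs p"
  proof (rule ser_eqI)
    show "scoef (L * Y * cs p) xs = scoef (V * cs p) xs" for xs
      using rs[of xs] by (simp add: scoef_mult_cs 1 Y distrib_right left_diff_distrib)
  qed
  ultimately show ?thesis by blast
qed

text \<open>The commutant of \<open>M\<close> is conjugate to the commutant of the constant operator \<open>sg\<close>.\<close>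

lemma commutant_commutative:
  fixes sg p :: "'e::ring_1" and M Y :: "('x, 'e) ser"
  assumes J: "tideal J"
    and sg: "solvable sg p" "determined {0} sg p"
    and M: "solvable (scoef M []) p" "determined {0} (scoef M []) p" and Y: "scoef Y [] = 1"
    and comm: "\<And>a b. a * sg - sg * a \<in> J \<Longrightarrow> b * sg - sg * b \<in> J \<Longrightarrow> a * b - b * a \<in> J"
    and A: "ap J n (A * M - M * A)" and B: "ap J n (B * M - M * B)"
  shows "ap J n (A * B - B * A)"
proof -
  \<comment> \<open>\<open>g\<close> transports the pair (\<open>sg\<close>, vacuum) to
    (\<open>M\<close>, \<open>Y\<close> at the vacuum), and \<open>h\<close> transports it back.
    Uniqueness of intertwiners makes them mutually inverse.\<close>
  obtain g where g: "g * cs sg - M * g = 0" "g * 1 * cs p = Y * cs p"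
    using ser_solvable[of "cs sg" p "1 :: ('x, 'e) ser" M 0 Y] sg by (auto simp: scoef_1)
  obtain h where h: "h * M - cs sg * h = 0" "h * Y * cs p = 1 * cs p"
    using ser_solvable[of M p Y "cs sg" 0 1] M Y by auto
  have gM: "g * cs sg = M * g" and hM: "h * M = cs sg * h" using g h by auto
  have "h * g - 1 = 0"
  proof (rule ser_determined_0[of "cs sg" p 1])
    have "h * g * cs sg = cs sg * (h * g)" by (metis gM hM mult.assoc)
    then show "(h * g - 1) * cs sg = cs sg * (h * g - 1)"
      by (simp add: left_diff_distrib right_diff_distrib)
    have "h * g * cs p = cs p" using g(2) h(2) by (simp add: mult.assoc)
    then show "(h * g - 1) * 1 * cs p = 0"
      by (simp add: left_diff_distrib)
  qed (simp_all add: sg scoef_1)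
  then have hg: "h * g = 1" by simp
  have "g * h - 1 = 0"
  proof (rule ser_determined_0[of M p Y])
    have "g * h * M = M * (g * h)" by (metis gM hM mult.assoc)
    then show "(g * h - 1) * M = M * (g * h - 1)"
      by (simp add: left_diff_distrib right_diff_distrib)
    have "g * h * Y * cs p = Y * cs p" using g(2) h(2) by (simp add: mult.assoc)
    then show "(g * h - 1) * Y * cs p = 0"
      by (simp add: left_diff_distrib)
  qed (simp_all add: M Y)
  then have gh: "g * h = 1" by simp
  \<comment> \<open>After conjugation the operator to commute with is the constant
    \<open>sg\<close>, so commutation can be read off each coefficient and \<open>comm\<close>
    applies to pairs of coefficients.\<close>
  have key: "scoef (h * A * g) xs * sg - sg * scoef (h * A * g) xs \<in> J"
    if "ap J n (A * M - M * A)" "length xs \<le> n" for A xs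
  proof -
    have "h * A * g * cs sg = h * (A * M) * g" "cs sg * (h * A * g) = h * (M * A) * g"
      by (simp_all add: mult.assoc gM) (simp add: mult.assoc[symmetric] hM)
    then have "h * A * g * cs sg - cs sg * (h * A * g) = h * (A * M - M * A) * g"
      by (simp add: left_diff_distrib right_diff_distrib)
    then have "ap J n (h * A * g * cs sg - cs sg * (h * A * g))"
      by (simp add: ap_left[OF J] ap_right[OF J] that(1))
    then show ?thesis using that(2) by (simp add: ap_def scoef_mult_cs scoef_cs_mult)
  qed
  have "ap J n ((h * A * g) * (h * B * g) - (h * B * g) * (h * A * g))"
  proof (rule ap_comm[OF J])
    fix xs ys :: "'x list" assume "length xs \<le> n" "length ys \<le> n"
    from comm[OF key[OF A this(1)] key[OF B this(2)]]
    show "scoef (h * A * g) xs * scoef (h * B * g) ys - scoef (h * B * g) ys * scoef (h * A * g) xs \<in> J" .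
  qed
  moreover have "(h * A * g) * (h * B * g) - (h * B * g) * (h * A * g) = h * (A * B - B * A) * g"
  proof -
    have "(h * A * g) * (h * B * g) = h * A * (g * h) * B * g" for A B by (simp add: mult.assoc)
    then show ?thesis by (simp add: gh left_diff_distrib right_diff_distrib mult.assoc)
  qed
  ultimately have "ap J n (g * (h * (A * B - B * A) * g) * h)"
    by (simp add: ap_left[OF J] ap_right[OF J])
  moreover have "g * (h * Z * g) * h = Z" for Z
  proof -
    have "g * (h * Z * g) * h = (g * h) * Z * (g * h)" by (simp add: mult.assoc)
    then show ?thesis by (simp add: gh)
  qed
  ultimately show ?thesis by metis
qed

section \<open>The descendant flow\<close>

type_synonym letter = "nat \<times> nat"

text \<open>The index shifts of the string and of the divisor relation; \<open>None\<close> stands for a negative index.\<close>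

definition lower :: "letter \<Rightarrow> letter option" where
  "lower x = (if fst x = 0 then None else Some (fst x - 1, snd x))"

definition twist :: "letter \<Rightarrow> letter option" where
  "twist x = (if fst x = 0 then None else Some (fst x - 1, Suc (snd x)))"

text \<open>What an upper entry adds to the degree: d + i, less one because it increases n in the
  summand 3 - n.\<close>

definition wt :: "letter \<Rightarrow> int" where
  "wt x = int (fst x) + int (snd x) - 1"

text \<open>Integer indices let k - 1 and k - 2 be formed without truncation; a negative index gives
  zero, as for symbols.\<close>

definition intidx :: "(nat \<Rightarrow> 'a::zero) \<Rightarrow> int \<Rightarrow> 'a" where
  "intidx S k = (if 0 \<le> k then S (nat k) else 0)"

lemma intidx_of_nat [simp]: "intidx S (int n) = S n" "intidx S 0 = S 0"
  by (simp_all add: intidx_def)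

lemma intidx_Suc [simp]: "intidx S (1 + int n) = S (Suc n)"
  by (simp add: intidx_def nat_add_distrib)

lemma int_cases_Suc:
  obtains "k < 0" | "k = 0" | n where "k = int (Suc n)"
  by (metis int_cases not0_implies_Suc negative_zless of_nat_0)

lemma intidx_neg [simp]: "k < 0 \<Longrightarrow> intidx S k = 0"
  by (simp add: intidx_def)

text \<open>Data at the origin: \<open>sg\<close> is classical multiplication by \<open>H^1\<close>,
  \<open>dE\<close> the Euler derivative of matrix entries, \<open>S0\<close> the value of
  \<open>S\<close>. Then \<open>dE (S0 1) + sg\<close> is quantum multiplication by
  \<open>H^1\<close>, \<open>S0_Suc\<close> is the divisor relation for two points, and
  \<open>S0_1\<close> says that \<open><H^0, H_a>\<close> vanishes.\<close>

locale seed =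
  fixes sg p :: "'e::ring_1" and dE :: "'e \<Rightarrow> 'e" and S0 :: "nat \<Rightarrow> 'e"
  assumes dE: "derivation dE" and dE_sg: "dE sg = 0" and dE_p: "dE p = 0"
    and S0_0: "S0 0 = 1"
    and S0_Suc: "dE (S0 (Suc n)) = (dE (S0 1) + sg) * S0 n - S0 n * sg"
    and S0_1: "S0 1 * p = 0"
    and solv_sg: "solvable sg p" and solv_C: "solvable (dE (S0 1) + sg) p"
    and det_sg: "determined {0} sg p" and det_C: "determined {0} (dE (S0 1) + sg) p"
    and comm_sg: "a * sg = sg * a \<Longrightarrow> b * sg = sg * b \<Longrightarrow> a * b = b * a"
begin

text \<open>The right side of (GW4) as a vector field: \<open>dE\<close> supplies the degree factor,
  \<open>twist\<close> replaces \<tau>_d H^i by \<tau>_(d-1) H^(i+1).\<close>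

definition delta :: "(letter, 'e) ser \<Rightarrow> (letter, 'e) ser" where
  "delta f = smap dE f + tsh twist f"

definition gM :: "(nat \<Rightarrow> (letter, 'e) ser) \<Rightarrow> (letter, 'e) ser" where
  "gM S = delta (S 1) + cs sg"

text \<open>The index \<open>k\<close> counts derivatives: along the flow each derivative lowers the
  index of \<open>S\<close>, hence raises \<open>k\<close>, at the cost of a factor
  \<open>N x\<close>.\<close>

definition gW :: "(nat \<Rightarrow> (letter, 'e) ser) \<Rightarrow> int \<Rightarrow> letter \<Rightarrow> (letter, 'e) ser" where
  "gW S k x = intidx S (int (fst x) - k) * cs (sg ^ snd x)"

text \<open>Applied to the vacuum, \<open>gY S\<close> is the unit vector field \<open>\<zeta>\<close>.\<close>

definition gY :: "(nat \<Rightarrow> (letter, 'e) ser) \<Rightarrow> (letter, 'e) ser" where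
  "gY S = 1 - bsum (gW S 1)"

lemma derivation_delta: "derivation delta"
  unfolding delta_def by (rule derivation_plus[OF derivation_smap[OF dE] derivation_tsh])

lemmas delta_simps = derivation_simps[OF derivation_delta] derivation_mult[OF derivation_delta]

text \<open>The extra term comes from differentiating the coordinate t_x inside
  \<open>delta\<close>: the commutator of \<open>der x\<close> and \<open>delta\<close> is the
  derivative along \<open>twist x\<close>.\<close>

lemma der_delta: "der x (delta f) = delta (der x f) + dero (twist x) f"
  by (simp add: delta_def der_smap der_tsh)

lemma delta_sgs [simp]: "delta (cs sg) = 0"
  by (simp add: delta_def smap_cs[OF dE] dE_sg cs_ring)

lemma delta_ps [simp]: "delta (cs p) = 0"
  by (simp add: delta_def smap_cs[OF dE] dE_p cs_ring)

lemma delta_sg_power [simp]: "delta (cs (sg ^ n)) = 0"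
  by (simp add: cs_power derivation_power_0[OF derivation_delta])

lemma scoef_delta_Nil [simp]: "scoef (delta f) [] = dE (scoef f [])"
  by (simp add: delta_def)

lemma ap_delta: "ap {0} n f \<Longrightarrow> ap {0} n (delta f)"
  unfolding delta_def
  by (intro ap_add[OF tideal_zero] ap_tsh[OF tideal_zero] ap_smap[OF tideal_zero]) (auto simp: derivation_0[OF dE])

end

locale flow = seed sg p dE S0 for sg p :: "'e::ring_1" and dE S0 +
  fixes S :: "nat \<Rightarrow> (letter, 'e) ser" and N :: "letter \<Rightarrow> (letter, 'e) ser"
  assumes S_0: "S 0 = 1" and S_Nil: "scoef (S n) [] = S0 n"
    and der_S: "der x (S (Suc n)) = N x * S n"
    and N_M: "N x * gM S = gM S * N x"
    and N_Y: "N x * gY S * cs p = S (fst x) * cs (sg ^ snd x) * cs p"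

lemma (in seed) flow_exists: "\<exists>S N. flow sg p dE S0 S N"
proof -
  let ?C = "dE (S0 1) + sg"
  define SS where "SS s n = Ser (\<lambda>xs. if xs = [] then S0 n else if n = 0 then 0 else s xs n)"
    for s :: "letter list \<Rightarrow> nat \<Rightarrow> 'e" and n :: nat
  define isN where "isN s x L \<longleftrightarrow> L * gM (SS s) - gM (SS s) * L = 0
      \<and> L * gY (SS s) * cs p = SS s (fst x) * cs (sg ^ snd x) * cs p" for s x L
  define NN where "NN s x = (SOME L. isN s x L)" for s x
  define F where "F s xs n = (case xs of [] \<Rightarrow> 0 | x # l \<Rightarrow> scoef (NN s x * SS s (n - 1)) l)" for s xs n
  define s where "s = wfrec (measure length) F"
  have M0: "scoef (gM (SS s)) [] = ?C" and Y0: "scoef (gY (SS s)) [] = 1" for s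
    by (simp_all add: gM_def gY_def SS_def scoef_1)
  have isN: "isN s x (NN s x)" for s x
    unfolding NN_def
    by (rule someI_ex) (use ser_solvable[of "gM (SS s)" p "gY (SS s)" "gM (SS s)" 0 "SS s (fst x) * cs (sg ^ snd x)"] solv_C M0 Y0
        in \<open>auto simp: isN_def\<close>)
  note z = tideal_zero
  have adm: "adm_wf (measure length) F"
    unfolding adm_wf_def
  proof (intro allI impI ext)
    fix s t :: "letter list \<Rightarrow> nat \<Rightarrow> 'e" and xs n
    assume st: "\<forall>z. (z, xs) \<in> measure length \<longrightarrow> s z = t z"
    show "F s xs n = F t xs n"
    proof (cases xs)
      case (Cons x l)
      define k where "k = length l"
      have S: "ap {0} k (SS s n - SS t n)" for n
        using st by (auto simp: ap_def SS_def Cons k_def)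
      have M: "ap {0} k (gM (SS s) - gM (SS t))"
        using ap_delta[OF S, of 1] by (simp add: gM_def delta_simps)
      have W: "ap {0} k (gW (SS s) 1 x - gW (SS t) 1 x)" for x
        using ap_right[OF z S] by (simp add: gW_def intidx_def left_diff_distrib[symmetric] ap_0[OF z])
      have "gY (SS s) - gY (SS t) = - bsum (\<lambda>x. gW (SS s) 1 x - gW (SS t) 1 x)"
        by (simp add: gY_def bsum_diff)
      then have Y: "ap {0} k (gY (SS s) - gY (SS t))"
        using ap_bsum[OF z W] by (simp add: ap_uminus[OF z] ap_mono[of _ "Suc k"])
      let ?L = "NN s x - NN t x"
      have "ap {0} k ?L"
      proof (rule ser_determined[OF z])
        show "determined {0} (scoef (gM (SS s)) []) p" "scoef (gY (SS s)) [] = 1"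
          using det_C M0 Y0 by auto
        \<comment> \<open>Two candidates for \<open>N\<close> satisfy the same equations up to the
          differences of \<open>M\<close>, \<open>Y\<close> and \<open>S\<close>, which vanish up to
          length k.\<close>
        have "?L * gM (SS s) - gM (SS s) * ?L = (gM (SS s) - gM (SS t)) * NN t x - NN t x * (gM (SS s) - gM (SS t))"
          using isN[of s x] isN[of t x] by (simp add: isN_def algebra_simps)
        then show "ap {0} k (?L * gM (SS s) - gM (SS s) * ?L)"
          using M by (simp add: ap_diff[OF z] ap_left[OF z] ap_right[OF z])
        have "?L * gY (SS s) * cs p = NN s x * gY (SS s) * cs p - NN t x * gY (SS t) * cs p
            - NN t x * (gY (SS s) - gY (SS t)) * cs p"
          by (simp add: algebra_simps)
        also have "NN s x * gY (SS s) * cs p - NN t x * gY (SS t) * cs p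
            = (SS s (fst x) - SS t (fst x)) * cs (sg ^ snd x) * cs p"
          using isN[of s x] isN[of t x] by (simp add: isN_def left_diff_distrib)
        finally show "ap {0} k (?L * gY (SS s) * cs p)"
          using S Y by (simp add: ap_diff[OF z] ap_left[OF z] ap_right[OF z])
      qed
      then have "ap {0} k (?L * SS s (n - 1) + NN t x * (SS s (n - 1) - SS t (n - 1)))"
        using S by (simp add: ap_add[OF z] ap_left[OF z] ap_right[OF z])
      then have "scoef (NN s x * SS s (n - 1) - NN t x * SS t (n - 1)) l = 0"
        by (simp add: ap_def k_def algebra_simps)
      then show ?thesis by (simp add: F_def Cons)
    qed (simp add: F_def)
  qed
  have s: "s = F s"
    unfolding s_def by (rule wfrec_fixpoint[OF wf_measure adm])
  have "flow sg p dE S0 (SS s) (NN s)"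
  proof unfold_locales
    show "SS s 0 = 1"
      by (rule ser_eqI) (simp add: SS_def S0_0 scoef_1)
    show "scoef (SS s n) [] = S0 n" for n by (simp add: SS_def)
    show "der x (SS s (Suc n)) = NN s x * SS s n" for x n
    proof (rule ser_eqI)
      fix l
      have "scoef (der x (SS s (Suc n))) l = s (x # l) (Suc n)"
        by (simp add: scoef_Cons[symmetric] SS_def)
      also have "\<dots> = scoef (NN s x * SS s n) l"
        by (subst s) (simp add: F_def)
      finally show "scoef (der x (SS s (Suc n))) l = scoef (NN s x * SS s n) l" .
    qed
    show "NN s x * gM (SS s) = gM (SS s) * NN s x" for x
      using isN[of s x] by (simp add: isN_def)
    show "NN s x * gY (SS s) * cs p = SS s (fst x) * cs (sg ^ snd x) * cs p" for x
      using isN[of s x] by (simp add: isN_def)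
  qed
  then show ?thesis by blast
qed

section \<open>Integrability, the divisor equation and the unit vector\<close>

context flow
begin

abbreviation "M \<equiv> gM S"
abbreviation "Y \<equiv> gY S"
abbreviation "Y' \<equiv> - bsum (gW S 2)"
abbreviation "Sx \<equiv> intidx S"
abbreviation "sgs \<equiv> cs sg"
abbreviation "ps \<equiv> cs p"

lemma M_Nil: "scoef M [] = dE (S0 1) + sg"
  by (simp add: gM_def S_Nil)

lemma Y_Nil: "scoef Y [] = 1"
  by (simp add: gY_def scoef_1)

lemma determined_0: assumes "L * M = P * L" "L * Y * ps = 0" shows "L = 0"
proof -
  have "determined {0} (scoef M []) p" using det_C M_Nil by simp
  from ser_determined_0[OF this Y_Nil assms] show ?thesis .
qed

lemma N_comm: "N x * N y = N y * N x"
proof -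
  have M: "solvable (scoef M []) p" "determined {0} (scoef M []) p"
    using solv_C det_C M_Nil by simp_all
  have C: "a * b - b * a \<in> {0}" if "a * sg - sg * a \<in> {0}" "b * sg - sg * b \<in> {0}" for a b
    using comm_sg[of a b] that by simp
  have N: "ap {0} n (N x * M - M * N x)" for n x
    using N_M[of x] by (simp add: ap_0[OF tideal_zero])
  have "ap {0} n (N x * N y - N y * N x)" for n
    using commutant_commutative[OF tideal_zero solv_sg det_sg M Y_Nil C N N] .
  then have "N x * N y - N y * N x = 0" using ap_zero_iff by blast
  then show ?thesis by simp
qed

lemma der_Sx: "der x (Sx k) = N x * Sx (k - 1)"
proof -
  show ?thesis
  proof (cases k rule: int_cases_Suc)
    case (3 n)
    then have "Sx k = S (Suc n)" "Sx (k - 1) = S n" by simp_all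
    then show ?thesis by (simp add: der_S)
  qed (simp_all add: S_0)
qed

lemma der_gW: "der x (gW S k y) = N x * gW S (k + 1) y"
  by (simp add: gW_def der_mult der_Sx diff_diff_eq mult.assoc)

lemma der_bsum_gW: "der x (bsum (gW S k)) = gW S k x + N x * bsum (gW S (k + 1))"
  by (simp add: der_bsum der_gW bsum_mult_left)

lemma N_Y': "N x * Y * ps = gW S 0 x * ps"
  by (simp add: N_Y gW_def)

lemma der_Y: "der x Y = N x * Y' - gW S 1 x"
  by (simp add: gY_def der_bsum_gW)

definition "dN x = (case twist x of None \<Rightarrow> 0 | Some y \<Rightarrow> N y)"

lemma dN_comm: "dN x * N y = N y * dN x"
  by (cases "twist x") (simp_all add: dN_def N_comm)

lemma dero_S: "dero (twist x) (S (Suc n)) = dN x * S n"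
  by (cases "twist x") (simp_all add: dN_def der_S)

lemma der_M: "der x M = delta (N x) + dN x"
  using dero_S[of x 0] by (simp add: gM_def der_delta der_S S_0)

lemma der_N: "der y (N x) = der x (N y)"
proof -
  let ?Z = "der y (N x) - der x (N y)"
  \<comment> \<open>Differentiate \<open>N_M\<close> in both directions and insert
    \<open>der_M\<close>: the mixed terms assemble into \<open>delta\<close> of a commutator of two
    \<open>N\<close> and commutators of \<open>N\<close> with \<open>dN\<close>, all of which
    vanish.\<close>
  have "?Z * M - M * ?Z = der y (N x * M - M * N x) - der x (N y * M - M * N y)
      - delta (N x * N y - N y * N x) + (dN y * N x - N x * dN y) - (dN x * N y - N y * dN x)"
    by (simp add: der_mult der_M delta_simps algebra_simps)
  also have "\<dots> = 0"
    by (simp only: N_M dN_comm) (simp add: N_comm[of x y] delta_simps)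
  finally have 1: "?Z * M = M * ?Z" by simp
  \<comment> \<open>After commuting the two \<open>N\<close>, the right side is symmetric in x and
    y, so the difference \<open>?Z\<close> kills the unit vector.\<close>
  have 2: "der y (N x) * Y * ps = N y * gW S 1 x * ps + N x * gW S 1 y * ps - N x * N y * Y' * ps" for x y
  proof -
    have "der y (N x * Y * ps) = der y (gW S 0 x * ps)" by (simp add: N_Y')
    then show ?thesis
      by (simp add: der_mult der_gW der_Y algebra_simps)
  qed
  have "?Z * Y * ps = 0"
    by (simp add: left_diff_distrib 2 N_comm[of x y])
  with 1 have "?Z = 0" by (rule determined_0)
  then show ?thesis by simp
qed

text \<open>The seed gives the identity at the origin. It propagates because \<open>N x\<close>
  commutes with \<open>M\<close> and the terms \<open>delta (N x)\<close> and \<open>dN x\<close>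
  add up to the derivative of \<open>M\<close>.\<close>

lemma delta_S: "delta (S (Suc n)) = M * S n - S n * sgs"
proof (induction n)
  case 0 then show ?case by (simp add: gM_def S_0)
next
  case (Suc n)
  show ?case
  proof (rule ser_der_eqI)
    show "scoef (delta (S (Suc (Suc n)))) [] = scoef (M * S (Suc n) - S (Suc n) * sgs) []"
      using S0_Suc[of "Suc n"] by (simp add: S_Nil M_Nil)
    show "der x (delta (S (Suc (Suc n)))) = der x (M * S (Suc n) - S (Suc n) * sgs)" for x
    proof -
      have "N x * (M * S n) = M * (N x * S n)" by (metis N_M mult.assoc)
      then show ?thesis
        by (simp add: der_delta der_S dero_S der_mult der_M delta_simps Suc algebra_simps)
    qed
  qed
qed

lemma delta_Sx: "delta (Sx k) = M * Sx (k - 1) - Sx (k - 1) * sgs"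
proof -
  show ?thesis
  proof (cases k rule: int_cases_Suc)
    case (3 n)
    then have "Sx k = S (Suc n)" "Sx (k - 1) = S n" by simp_all
    then show ?thesis by (simp add: delta_S)
  qed (simp_all add: S_0 delta_simps)
qed

lemma delta_bsum: "delta (bsum h) = bsum (\<lambda>x. delta (h x) + (case twist x of None \<Rightarrow> 0 | Some y \<Rightarrow> h y))"
  by (simp add: delta_def smap_bsum[OF dE] tsh_bsum bsum_add)

text \<open>In each summand the twisted letter carries one more power of \<open>sg\<close>; this
  cancels the \<open>- S * sg\<close> part of the divisor equation and leaves only the term with
  \<open>M\<close> in front.\<close>

lemma delta_Y: "delta Y = M * Y'"
proof -
  have "delta (gW S 1 x) + (case twist x of None \<Rightarrow> 0 | Some y \<Rightarrow> gW S 1 y) = M * gW S 2 x" for x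
  proof (cases "fst x")
    case 0 then show ?thesis by (simp add: gW_def twist_def delta_simps)
  next
    case (Suc d)
    have "delta (S d) = M * Sx (int d - 1) - Sx (int d - 1) * sgs"
      using delta_Sx[of "int d"] by simp
    then show ?thesis using Suc
      by (simp add: gW_def twist_def delta_simps left_diff_distrib mult.assoc cs_mult)
  qed
  then show ?thesis
    by (simp add: gY_def delta_simps delta_bsum bsum_mult_left)
qed

text \<open>\<open>H^1\<close> times the unit is \<open>H^1\<close>. At the origin this is
  \<open>S0_1\<close>; the derivative vanishes after applying \<open>delta\<close> to
  \<open>N_Y'\<close>. By uniqueness it identifies \<open>M\<close> with
  \<open>N (0, 1)\<close>.\<close>

lemma M_Y: "M * Y * ps = sgs * ps"
proof (rule ser_der_eqI)
  have "dE (S0 1) * p = dE (S0 1 * p)" by (simp only: derivation_mult[OF dE] dE_p) simp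
  then have "dE (S0 1) * p = 0" by (simp add: S0_1[simplified] derivation_0[OF dE])
  then show "scoef (M * Y * ps) [] = scoef (sgs * ps) []"
    by (simp add: M_Nil Y_Nil distrib_right)
next
  fix x
  have 1: "delta (N x) * Y * ps + N x * (M * Y') * ps = delta (gW S 0 x) * ps"
  proof -
    have "delta (N x * Y * ps) = delta (gW S 0 x * ps)" by (simp add: N_Y')
    then show ?thesis by (simp add: delta_simps delta_Y algebra_simps)
  qed
  have 2: "delta (gW S 0 x) * ps + dN x * Y * ps = M * gW S 1 x * ps"
  proof (cases "fst x")
    case 0 then show ?thesis by (simp add: gW_def dN_def twist_def delta_simps delta_Sx S_0)
  next
    case (Suc d)
    with Suc show ?thesis
      by (simp add: dN_def twist_def N_Y') (simp add: gW_def delta_simps delta_S cs_mult algebra_simps)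
  qed
  have 3: "N x * (M * Y') * ps = M * N x * Y' * ps" by (simp add: N_M mult.assoc[symmetric])
  have "der x (M * Y * ps) = (delta (N x) * Y * ps + dN x * Y * ps + M * N x * Y' * ps) - M * gW S 1 x * ps"
    by (simp add: der_mult der_M der_Y algebra_simps)
  also have "\<dots> = 0" using 1 2 3 by (simp add: algebra_simps)
  finally show "der x (M * Y * ps) = der x (sgs * ps)" by (simp add: der_mult)
qed

lemma N_01: "N (0, 1) = M"
proof -
  have "(N (0, 1) - M) * M = M * (N (0, 1) - M)"
    by (simp add: left_diff_distrib right_diff_distrib N_M)
  moreover have "(N (0, 1) - M) * Y * ps = 0"
    by (simp add: left_diff_distrib N_Y M_Y S_0)
  ultimately have "N (0, 1) - M = 0" by (rule determined_0)
  then show ?thesis by simp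
qed

lemma N_S_sym: "N x * (S (fst y) * cs (sg ^ snd y) * ps) = N y * (S (fst x) * cs (sg ^ snd x) * ps)"
  by (metis N_Y N_comm mult.assoc)

end

subsection \<open>Symmetric series\<close>

text \<open>Symmetry is graded by the number of preceding derivatives: level k for all
  \<open>S\<close> gives level k for \<open>N\<close>, and through the flow equation level k + 1 for
  \<open>S\<close>.\<close>

primrec symk :: "nat \<Rightarrow> ('x, 'e::ring_1) ser \<Rightarrow> bool" where
  "symk 0 f \<longleftrightarrow> (\<forall>x y. der x (der y f) = der y (der x f))"
| "symk (Suc k) f \<longleftrightarrow> (\<forall>x y. der x (der y f) = der y (der x f)) \<and> (\<forall>z. symk k (der z f))"

definition symmetric :: "('x, 'e::ring_1) ser \<Rightarrow> bool" where
  "symmetric f \<longleftrightarrow> (\<forall>k. symk k f)"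

lemma symk_swap: "symk k f \<Longrightarrow> der x (der y f) = der y (der x f)"
  by (cases k) auto

lemma symk_SucD: "symk (Suc k) f \<Longrightarrow> symk k f"
  by (induction k arbitrary: f) auto

lemma symk_add: "symk k f \<Longrightarrow> symk k g \<Longrightarrow> symk k (f + g)"
  by (induction k arbitrary: f g) auto

lemma symk_diff: "symk k f \<Longrightarrow> symk k g \<Longrightarrow> symk k (f - g)"
  by (induction k arbitrary: f g) auto

lemma symk_uminus: "symk k f \<Longrightarrow> symk k (- f)"
  by (induction k arbitrary: f) auto

lemma symk_zero: "symk k 0"
  by (induction k) auto

lemma symk_one: "symk k 1"
  by (cases k) (auto simp: symk_zero)

lemma symk_cs: "symk k (cs a)"
  by (cases k) (auto simp: symk_zero)

lemma symk_mult: "symk k f \<Longrightarrow> symk k g \<Longrightarrow> symk k (f * g)"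
proof (induction k arbitrary: f g)
  case 0 then show ?case by (auto simp: der_mult algebra_simps)
next
  case (Suc k)
  have "der x (der y (f * g)) = der y (der x (f * g))" for x y
    using symk_swap[OF Suc.prems(1), of x y] symk_swap[OF Suc.prems(2), of x y]
    by (simp add: der_mult algebra_simps)
  moreover have "symk k (der z (f * g))" for z
    using Suc.prems Suc.prems[THEN symk_SucD] by (simp add: der_mult symk_add Suc.IH)
  ultimately show ?case by simp
qed

lemma symk_sum: "(\<And>a. a \<in> A \<Longrightarrow> symk k (f a)) \<Longrightarrow> symk k (sum f A)"
  by (induction A rule: infinite_finite_induct) (auto simp: symk_add symk_zero)

lemma symk_bsum: "(\<And>x. symk k (h x)) \<Longrightarrow> symk k (bsum h)"
proof (induction k arbitrary: h)
  case 0 then show ?case by (simp add: der_bsum algebra_simps)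
next
  case (Suc k)
  have "der x (der y (bsum h)) = der y (der x (bsum h))" for x y
    by (simp add: der_bsum symk_swap[OF Suc.prems, of x y] algebra_simps)
  moreover have "symk k (der z (bsum h))" for z
    using Suc.prems symk_SucD[OF Suc.prems] by (simp add: der_bsum symk_add Suc.IH)
  ultimately show ?case by simp
qed

lemma symk_dero: "symk (Suc k) f \<Longrightarrow> symk k (dero z f)"
  by (cases z) (auto simp: symk_zero)

lemma symk_tsh: "symk k f \<Longrightarrow> symk k (tsh \<phi> f)"
proof (induction k arbitrary: f)
  case 0
  have "der x (dero z f) = dero z (der x f)" for x z using 0 by (cases z) auto
  with 0 show ?case by (simp add: der_tsh dero_add)
next
  case (Suc k)
  have "der x (dero z f) = dero z (der x f)" for x z using Suc.prems by (cases z) auto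
  then have "der x (der y (tsh \<phi> f)) = der y (der x (tsh \<phi> f))" for x y
    using symk_swap[OF Suc.prems, of x y] by (simp add: der_tsh dero_add)
  moreover have "symk k (der z (tsh \<phi> f))" for z
    using Suc.prems by (simp add: der_tsh symk_add Suc.IH symk_dero)
  ultimately show ?case by simp
qed

lemma symk_smap: "derivation d \<Longrightarrow> symk k f \<Longrightarrow> symk k (smap d f)"
  by (induction k arbitrary: f) (auto simp: der_smap)

lemma symmetric_der: "symmetric f \<Longrightarrow> symmetric (der z f)"
  unfolding symmetric_def by (metis symk.simps(2))

lemma symmetric_swap: "symmetric f \<Longrightarrow> der x (der y f) = der y (der x f)"
  by (metis symmetric_def symk_swap)

lemma symmetricI:
  assumes "\<And>x y. der x (der y f) = der y (der x f)" "\<And>z. symmetric (der z f)"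
  shows "symmetric f"
proof -
  have "symk k f" for k using assms by (cases k) (auto simp: symmetric_def)
  then show ?thesis by (simp add: symmetric_def)
qed

lemma symmetric_scoef_swap: "symmetric f \<Longrightarrow> scoef f (zs @ x # y # ws) = scoef f (zs @ y # x # ws)"
  by (induction zs arbitrary: f) (auto simp: scoef_Cons symmetric_swap[of _ x y] symmetric_der)

lemma symmetric_scoef_front: "symmetric f \<Longrightarrow> scoef f (as @ x # bs) = scoef f (x # as @ bs)"
proof (induction as arbitrary: bs rule: rev_induct)
  case (snoc a as)
  then show ?case using symmetric_scoef_swap[OF snoc.prems, of as a x bs] by simp
qed simp

lemma symmetric_scoef_mset: "symmetric f \<Longrightarrow> mset xs = mset ys \<Longrightarrow> scoef f xs = scoef f ys"
proof (induction xs arbitrary: f ys)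
  case (Cons x xs)
  from Cons.prems(2) have "x \<in> set ys" by (metis list.set_intros(1) mset_eq_setD)
  then obtain as bs where ys: "ys = as @ x # bs" by (meson split_list)
  then have "mset xs = mset (as @ bs)" using Cons.prems(2) by simp
  then have "scoef (der x f) xs = scoef (der x f) (as @ bs)"
    using Cons.IH[OF symmetric_der[OF Cons.prems(1)]] by blast
  then show ?case
    by (simp add: ys symmetric_scoef_front[OF Cons.prems(1)] scoef_Cons)
qed simp

text \<open>For a symmetric series a derivative in an inner slot can be moved to the front, so the
  vector field becomes the literal sum over letters.\<close>

lemma symmetric_tsh: assumes "symmetric f" shows "tsh \<phi> f = bsum (\<lambda>x. dero (\<phi> x) f)"
proof (rule ser_eqI)
  have *: "der y (dero z f) = dero z (der y f)" if "symmetric f" for y z and f :: "('a, 'b) ser"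
    using symmetric_swap[OF that] by (cases z) auto
  show "scoef (tsh \<phi> f) xs = scoef (bsum (\<lambda>x. dero (\<phi> x) f)) xs" for xs
    using assms by (induction xs arbitrary: f) (simp_all add: scoef_Cons der_tsh der_bsum * symmetric_der)
qed

definition alt :: "nat \<Rightarrow> 'a::ab_group_add \<Rightarrow> 'a" where
  "alt n a = (if even n then a else - a)"

context flow
begin

lemma symk_delta: "symk k f \<Longrightarrow> symk k (delta f)"
  by (simp add: delta_def symk_add symk_smap[OF dE] symk_tsh)

text \<open>The curvature \<open>\<partial>_x \<partial>_y - \<partial>_y \<partial>_x\<close> is a
  derivation that kills the data, so its value on \<open>L\<close> commutes with \<open>M\<close>
  and kills the unit vector. A derivative of \<open>L\<close> solves an equation of the same form,
  one level lower.\<close>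

lemma symk_determined:
  assumes "symk k M" "symk k Y"
  shows "L * M - M * L = w \<Longrightarrow> L * Y * ps = u \<Longrightarrow> symk k w \<Longrightarrow> symk k u \<Longrightarrow> symk k L"
  using assms
proof (induction k arbitrary: L w u)
  case (0 L w u)
  have "der x (der y L) - der y (der x L) = 0" for x y
  proof (rule determined_0)
    let ?K = "\<lambda>f. der x (der y f) - der y (der x f)"
    have d: "derivation ?K" by (rule derivation_bracket[OF derivation_der derivation_der])
    have "?K M = 0" "?K w = 0" "?K Y = 0" "?K u = 0"
      using 0(3-6)[THEN symk_swap, of x y] by simp_all
    moreover have "?K ps = 0" by simp
    moreover have "?K (L * M - M * L) = ?K w" "?K (L * Y * ps) = ?K u"
      using "0.prems" by metis+
    ultimately show "?K L * M = M * ?K L" "?K L * Y * ps = 0"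
      by (simp_all only: derivation_diff[OF d] derivation_mult[OF d]) simp_all
  qed
  then show ?case by simp
next
  case (Suc k)
  have L: "symk k L"
    by (rule Suc.IH[OF Suc.prems(1,2)]) (use Suc.prems(3-6)[THEN symk_SucD] in auto)
  have "der x (der y L) = der y (der x L)" for x y
    using symk_swap[OF L] .
  moreover have "symk k (der z L)" for z
  proof (rule Suc.IH)
    show "der z L * M - M * der z L = der z w - L * der z M + der z M * L"
      by (simp add: Suc.prems(1)[symmetric] der_mult algebra_simps)
    show "der z L * Y * ps = der z u - L * der z Y * ps"
      by (simp add: Suc.prems(2)[symmetric] der_mult algebra_simps)
    show "symk k M" "symk k Y" using Suc.prems(5,6)[THEN symk_SucD] by auto
    have d: "symk k (der z w)" "symk k (der z u)" "symk k (der z M)" "symk k (der z Y)"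
      using Suc.prems(3-6) by (simp_all del: split_paired_All)
    show "symk k (der z w - L * der z M + der z M * L)"
      using d L by (simp add: symk_add symk_diff symk_mult)
    show "symk k (der z u - L * der z Y * ps)"
      using d L by (simp add: symk_diff symk_mult symk_cs)
  qed
  ultimately show ?case by simp
qed

lemma symk_S_0: "der x (der y (S n)) = der y (der x (S n))"
proof (cases n)
  case (Suc m)
  show ?thesis
  proof (cases m)
    case 0 then show ?thesis using der_N[of x y] by (simp add: Suc der_S der_mult S_0)
  next
    case (Suc l)
    have "N y * (N x * S l) = N x * (N y * S l)" by (metis N_comm mult.assoc)
    then show ?thesis using der_N[of x y] by (simp add: \<open>n = Suc m\<close> Suc der_S der_mult)
  qed
qed (simp add: S_0)

lemma symk_N: assumes "\<And>n. symk k (S n)" shows "symk k (N x)"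
proof (rule symk_determined)
  show "symk k M" by (simp add: gM_def symk_add symk_delta symk_cs assms)
  have "symk k (gW S i x)" for i x
    by (simp add: gW_def intidx_def symk_mult symk_cs assms symk_zero)
  then show "symk k Y" by (simp add: gY_def symk_diff symk_bsum symk_one)
  show "N x * M - M * N x = 0" by (simp add: N_M)
  show "N x * Y * ps = S (fst x) * cs (sg ^ snd x) * ps" by (rule N_Y)
qed (simp_all add: symk_zero symk_mult symk_cs assms)

lemma symk_S: "symk k (S n)"
proof (induction k arbitrary: n)
  case 0 then show ?case by (simp add: symk_S_0)
next
  case (Suc k)
  have "symk k (der z (S n))" for z
    by (cases n) (simp_all add: S_0 symk_zero der_S symk_mult Suc symk_N)
  then show ?case by (simp add: symk_S_0)
qed

subsection \<open>The dual solution and the one-point series\<close>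

text \<open>\<open>\<Sum>\<^sub>k T\<^sub>k w\<^sup>k\<close> is the inverse of \<open>\<Sum>\<^sub>k S\<^sub>k w\<^sup>k\<close>; \<open>R\<close> is obtained from it by \<open>w \<mapsto> -w\<close>.\<close>

fun T :: "nat \<Rightarrow> (letter, 'e) ser" where
  "T n = (if n = 0 then 1 else - (\<Sum>k<n. T k * S (n - k)))"

declare T.simps [simp del]

lemma T_0: "T 0 = 1"
  by (simp add: T.simps)

lemma T_Suc: "T (Suc n) = - (\<Sum>k\<le>n. T k * S (Suc n - k))"
  by (subst T.simps) (simp add: lessThan_Suc_atMost)

lemma T_S: "(\<Sum>k\<le>n. T k * S (n - k)) = (if n = 0 then 1 else 0)"
  by (cases n) (simp_all add: T_0 S_0, simp add: T_Suc S_0)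

text \<open>The inverse solves the adjoint equation, with \<open>N\<close> on the right; the sign is
  what passing to \<open>R\<close> removes.\<close>

lemma der_T: "der x (T (Suc n)) = - (T n * N x)"
proof (induction n rule: less_induct)
  case (less n)
  have "der x (T (Suc n)) = - (\<Sum>k\<le>n. der x (T k) * S (Suc n - k)) - (\<Sum>k\<le>n. T k * N x * S (n - k))"
    by (simp add: T_Suc der_sum der_mult Suc_diff_le der_S sum.distrib mult.assoc)
  also have "(\<Sum>k\<le>n. der x (T k) * S (Suc n - k)) = (\<Sum>k<n. der x (T (Suc k)) * S (n - k))"
    by (simp add: lessThan_Suc_atMost[symmetric] sum.lessThan_Suc_shift T_0 del: sum.lessThan_Suc)
  also have "\<dots> = - (\<Sum>k<n. T k * N x * S (n - k))"
    by (simp add: less sum_negf)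
  also have "- (- (\<Sum>k<n. T k * N x * S (n - k))) - (\<Sum>k\<le>n. T k * N x * S (n - k)) = - (T n * N x)"
    by (simp add: lessThan_Suc_atMost[symmetric] S_0)
  finally show ?case .
qed

lemma delta_T: "delta (T (Suc n)) = sgs * T n - T n * M"
proof (induction n rule: less_induct)
  case (less n)
  have s: "T k * (M * S (n - k) - S (n - k) * sgs) = T k * M * S (n - k) - T k * S (n - k) * sgs" for k
    by (simp add: algebra_simps)
  have "delta (T (Suc n)) = - (\<Sum>k\<le>n. delta (T k) * S (Suc n - k)) - (\<Sum>k\<le>n. T k * (M * S (n - k) - S (n - k) * sgs))"
    by (simp add: T_Suc derivation_sum[OF derivation_delta] delta_simps Suc_diff_le delta_S sum.distrib mult.assoc)
  also have "(\<Sum>k\<le>n. delta (T k) * S (Suc n - k)) = (\<Sum>k<n. delta (T (Suc k)) * S (n - k))"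
    by (simp add: lessThan_Suc_atMost[symmetric] sum.lessThan_Suc_shift T_0 delta_simps del: sum.lessThan_Suc)
  also have "\<dots> = sgs * (\<Sum>k<n. T k * S (n - k)) - (\<Sum>k<n. T k * M * S (n - k))"
    by (simp add: less sum_distrib_left sum_subtractf left_diff_distrib mult.assoc)
  also have "(\<Sum>k<n. T k * S (n - k)) = (\<Sum>k\<le>n. T k * S (n - k)) - T n"
    by (simp add: lessThan_Suc_atMost[symmetric] S_0)
  also have "(\<Sum>k<n. T k * M * S (n - k)) = (\<Sum>k\<le>n. T k * M * S (n - k)) - T n * M"
    by (simp add: lessThan_Suc_atMost[symmetric] S_0)
  also have "(\<Sum>k\<le>n. T k * (M * S (n - k) - S (n - k) * sgs)) = (\<Sum>k\<le>n. T k * M * S (n - k)) - (\<Sum>k\<le>n. T k * S (n - k)) * sgs"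
    by (simp only: s sum_subtractf sum_distrib_right)
  finally show ?case
    by (cases "n = 0") (simp_all add: T_S T_0 S_0 algebra_simps)
qed

definition R :: "nat \<Rightarrow> (letter, 'e) ser" where
  "R n = alt n (T n)"

lemma R_0: "R 0 = 1"
  by (simp add: R_def alt_def T_0)

lemma der_R: "der x (R (Suc n)) = R n * N x"
  by (simp add: R_def alt_def der_T)

lemma delta_R: "delta (R (Suc n)) = R n * M - sgs * R n"
  by (simp add: R_def alt_def delta_T delta_simps)

text \<open>The recursion is coefficient extraction from
  \<open>(z + w) * Q(z, w) = R(z) * S(w) - 1\<close>, where \<open>Q c d\<close> belongs to
  \<open>w^c z^d\<close>. Its entries will be the two-point series
  \<open><<\<tau>_c H^i, \<tau>_d H_a>>\<close>.\<close>

primrec Q :: "nat \<Rightarrow> nat \<Rightarrow> (letter, 'e) ser" where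
  "Q 0 d = R (Suc d)"
| "Q (Suc c) d = R (Suc d) * S (Suc c) - Q c (Suc d)"

lemma der_Q: "der x (Q c d) = R d * N x * S c"
  by (induction c arbitrary: d) (simp_all add: der_R S_0 der_mult der_S mult.assoc)

lemma Q_T: "alt d (Q c d) = - (\<Sum>k\<le>c. T (Suc d + k) * S (c - k))"
proof (induction c arbitrary: d)
  case 0 then show ?case by (simp add: S_0 R_def alt_def)
next
  case (Suc c)
  have "alt d (Q (Suc c) d) = - (T (Suc d) * S (Suc c)) + alt (Suc d) (Q c (Suc d))"
    by (simp add: R_def alt_def)
  also have "\<dots> = - (\<Sum>k\<le>Suc c. T (Suc d + k) * S (Suc c - k))"
    by (simp add: Suc lessThan_Suc_atMost[symmetric] sum.lessThan_Suc_shift[of _ "Suc c"] del: sum.lessThan_Suc)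
  finally show ?case .
qed

text \<open>Here the inverse is used: \<open>R(z) * S(w) - 1\<close> is divisible by z + w precisely
  because it vanishes at z = -w, that is, because \<open>T\<close> inverts \<open>S\<close>.\<close>

lemma Q_c_0: "Q c 0 = S (Suc c)"
proof -
  have "(\<Sum>k\<le>Suc c. T k * S (Suc c - k)) = S (Suc c) + (\<Sum>k\<le>c. T (Suc k) * S (c - k))"
    by (simp add: lessThan_Suc_atMost[symmetric] sum.lessThan_Suc_shift[of _ "Suc c"] T_0 del: sum.lessThan_Suc)
  then have "S (Suc c) + (\<Sum>k\<le>c. T (Suc k) * S (c - k)) = 0"
    by (simp add: T_S)
  then have "S (Suc c) = - (\<Sum>k\<le>c. T (Suc k) * S (c - k))" by (simp add: eq_neg_iff_add_eq_0)
  then show ?thesis using Q_T[of 0 c] by (simp add: alt_def)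
qed

definition Qp :: "nat \<Rightarrow> nat \<Rightarrow> (letter, 'e) ser" where
  "Qp c d = (case c of 0 \<Rightarrow> 0 | Suc c' \<Rightarrow> Q c' d)"

text \<open>Lowering d below zero leaves only the value 1 at c = 0. It records the unstable term:
  \<open>delta (S 1)\<close> equals \<open>M - sg\<close>, and this \<open>sg\<close> must be
  accounted for in \<open>delta_Q\<close>.\<close>

definition Qd :: "nat \<Rightarrow> nat \<Rightarrow> (letter, 'e) ser" where
  "Qd c d = (case d of 0 \<Rightarrow> (if c = 0 then 1 else 0) | Suc d' \<Rightarrow> Q c d')"

lemma Q_Qp: "Q c d = R (Suc d) * S c - Qp c (Suc d)"
  by (cases c) (simp_all add: Qp_def S_0)

lemma Qd_Suc: "R d * S (Suc c) - Q c d = Qd (Suc c) d"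
  by (cases d) (simp_all add: Qd_def Q_c_0 R_0)

lemma delta_Q: "delta (Q c d) = R d * M * S c - Qp c d * sgs - sgs * Qd c d"
proof (induction c arbitrary: d)
  case 0 then show ?case by (cases d) (simp_all add: delta_R S_0 Qp_def Qd_def R_0)
next
  case (Suc c)
  have "delta (Q (Suc c) d) = (R d * M - sgs * R d) * S (Suc c) + R (Suc d) * (M * S c - S c * sgs)
      - (R (Suc d) * M * S c - Qp c (Suc d) * sgs - sgs * Q c d)"
    by (simp add: delta_simps delta_R delta_S Suc Qd_def)
  also have "\<dots> = R d * M * S (Suc c) - (R (Suc d) * S c - Qp c (Suc d)) * sgs - sgs * (R d * S (Suc c) - Q c d)"
    by (simp add: algebra_simps)
  also have "\<dots> = R d * M * S (Suc c) - Q c d * sgs - sgs * Qd (Suc c) d"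
    by (simp only: Q_Qp[symmetric] Qd_Suc)
  finally show ?case by (simp add: Qp_def)
qed

text \<open>\<open>J d\<close> applied to the unit vector is the generating series of \<open>\<langle>\<dots>, \<tau>\<^sub>d H\<^sub>r\<rangle>\<close>; \<open>Jp d\<close> stands for
  \<open>J (d - 1)\<close>, where \<open>J (- 1)\<close> is read as \<open>\<Sum>\<^sub>i t\<^bsub>0,i\<^esub> sg\<^sup>i\<close>.\<close>

definition J :: "nat \<Rightarrow> (letter, 'e) ser" where
  "J d = R (Suc (Suc d)) - bsum (\<lambda>x. Qp (fst x) (Suc d) * cs (sg ^ snd x))"

definition Jp :: "nat \<Rightarrow> (letter, 'e) ser" where
  "Jp d = (case d of 0 \<Rightarrow> bsum (\<lambda>x. if fst x = 0 then cs (sg ^ snd x) else 0) | Suc d' \<Rightarrow> J d')"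

lemma der_Qp: "der x (Qp c (Suc d)) = R (Suc d) * N x * Sx (int c - 1)"
  by (cases c) (simp_all add: Qp_def der_Q)

text \<open>On the vacuum \<open>N x * Y\<close> becomes \<open>S\<close> times a power of
  \<open>sg\<close>, and subtracting the \<open>Qp\<close> term is exactly one step of the recursion
  for \<open>Q\<close>.\<close>

lemma der_J: "der x (J d) * ps = Q (fst x) d * cs (sg ^ snd x) * ps"
proof -
  have "der x (J d) = R (Suc d) * N x * Y - Qp (fst x) (Suc d) * cs (sg ^ snd x)"
    by (simp add: J_def der_R der_bsum der_mult der_Qp mult.assoc gW_def[symmetric] bsum_mult_left gY_def right_diff_distrib)
  then have "der x (J d) * ps = R (Suc d) * (N x * Y * ps) - Qp (fst x) (Suc d) * cs (sg ^ snd x) * ps"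
    by (simp add: left_diff_distrib mult.assoc)
  then show ?thesis
    unfolding N_Y by (simp add: Q_Qp left_diff_distrib mult.assoc)
qed

lemma der_J': "der x (J d * ps) = Q (fst x) d * cs (sg ^ snd x) * ps"
  by (simp add: der_mult der_J)

text \<open>The factorization behind both halves of (GW5): \<open>R d\<close> carries the
  descendants of the lower entry, \<open>S (fst y)\<close> those of an upper entry, and
  \<open>N x\<close> joins them. Each recursion splits off one outer factor.\<close>

lemma der_der_J: "der x (der y (J d * ps)) = R d * N x * S (fst y) * cs (sg ^ snd y) * ps"
  unfolding der_J' by (simp add: der_mult der_Q)

lemma symmetric_J: "symmetric (J d * ps)"
proof (rule symmetricI)
  show "der x (der y (J d * ps)) = der y (der x (J d * ps))" for x y
    using N_S_sym[of x y] by (simp add: der_der_J mult.assoc)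
  have "symk k (R n)" for k n
  proof -
    have "symk k (T n)"
    proof (induction n rule: less_induct)
      case (less n)
      then show ?case by (subst T.simps) (auto simp: symk_one intro!: symk_uminus symk_sum symk_mult symk_S)
    qed
    then show ?thesis by (simp add: R_def alt_def symk_uminus)
  qed
  then have "symk k (Q c d)" for k c d
    by (induction c arbitrary: d) (simp_all add: symk_diff symk_mult symk_S)
  then show "symmetric (der z (J d * ps))" for z
    by (simp add: der_J' symmetric_def symk_mult symk_cs)
qed

text \<open>The string relation for \<open><<H^0, H_a>>\<close>. On the right the derivative is
  \<open>N x\<close> applied to \<open>Y\<close> plus \<open>N x\<close> applied to
  \<open>1 - Y\<close>.\<close>

lemma S1_ps: "S 1 * ps = bsum (gW S 0) * ps"
proof (rule ser_der_eqI)
  show "scoef (S 1 * ps) [] = scoef (bsum (gW S 0) * ps) []"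
    using S0_1 by (simp add: S_Nil)
  show "der x (S 1 * ps) = der x (bsum (gW S 0) * ps)" for x
  proof -
    have "der x (bsum (gW S 0) * ps) = N x * Y * ps + N x * (1 - Y) * ps"
      unfolding N_Y' by (simp add: der_mult der_bsum_gW distrib_right gY_def)
    then show ?thesis
      by (simp add: der_mult der_S S_0 algebra_simps)
  qed
qed

text \<open>The formula for \<open>J\<close> continued one index down. At d = 0 it collapses, by
  \<open>S1_ps\<close>, to the sum of unstable terms.\<close>

lemma Jp_eq: "(R (Suc d) - bsum (\<lambda>x. Qp (fst x) d * cs (sg ^ snd x))) * ps = Jp d * ps"
proof (cases d)
  case 0
  have "gW S 0 x = Qp (fst x) 0 * cs (sg ^ snd x) + (if fst x = 0 then cs (sg ^ snd x) else 0)" for x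
    by (cases "fst x") (simp_all add: gW_def Qp_def Q_c_0 S_0)
  then have "gW S 0 = (\<lambda>x. Qp (fst x) 0 * cs (sg ^ snd x) + (if fst x = 0 then cs (sg ^ snd x) else 0))"
    by (rule ext)
  then have "bsum (gW S 0) = bsum (\<lambda>x. Qp (fst x) 0 * cs (sg ^ snd x)) + Jp 0"
    by (simp add: Jp_def bsum_add[symmetric])
  moreover have "R (Suc 0) = S 1" using Q_c_0[of 0] by simp
  ultimately show ?thesis
    using S1_ps by (simp add: 0 left_diff_distrib distrib_right)
qed (simp add: Jp_def J_def)

lemma string: "der (0, 0) (J d * ps) = tsh lower (J d * ps) + Jp d * ps"
proof -
  have "dero (lower x) (J d * ps) = Qp (fst x) d * cs (sg ^ snd x) * ps" for x
    by (cases "fst x") (simp_all add: lower_def Qp_def der_J')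
  then have "tsh lower (J d * ps) = bsum (\<lambda>x. Qp (fst x) d * cs (sg ^ snd x)) * ps"
    by (simp add: symmetric_tsh[OF symmetric_J] bsum_mult_right)
  then show ?thesis
    by (simp add: der_J' Jp_eq[symmetric] left_diff_distrib cs_ring)
qed

text \<open>Applying \<open>delta\<close> to \<open>J d\<close> produces
  \<open>R (Suc d) * M * Y\<close>. Since \<open>M_Y\<close> replaces \<open>M * Y\<close> by
  \<open>sg\<close> on the vacuum, this is the derivative in the direction (0, 1).\<close>

lemma divisor: "der (0, 1) (J d * ps) = delta (J d * ps) + sgs * (Jp d * ps)"
proof -
  have 1: "delta (Qp (fst x) (Suc d) * cs (sg ^ snd x))
      + (case twist x of None \<Rightarrow> 0 | Some y \<Rightarrow> Qp (fst y) (Suc d) * cs (sg ^ snd y))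
      = R (Suc d) * M * gW S 1 x - sgs * (Qp (fst x) d * cs (sg ^ snd x))" for x
    by (cases "fst x")
      (simp_all add: twist_def Qp_def gW_def delta_simps delta_Q Qd_def cs_mult algebra_simps)
  have "delta (J d) = R (Suc d) * M * Y - sgs * (R (Suc d) - bsum (\<lambda>x. Qp (fst x) d * cs (sg ^ snd x)))"
  proof -
    have "delta (bsum (\<lambda>x. Qp (fst x) (Suc d) * cs (sg ^ snd x)))
      = R (Suc d) * M * bsum (gW S 1) - sgs * bsum (\<lambda>x. Qp (fst x) d * cs (sg ^ snd x))"
      unfolding delta_bsum 1 by (simp add: bsum_diff bsum_mult_left)
    then show ?thesis
      by (simp add: J_def delta_simps(5) delta_R gY_def algebra_simps)
  qed
  then have "delta (J d) * ps = R (Suc d) * (M * Y * ps)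
      - sgs * ((R (Suc d) - bsum (\<lambda>x. Qp (fst x) d * cs (sg ^ snd x))) * ps)"
    by (simp add: left_diff_distrib mult.assoc)
  then show ?thesis
    unfolding M_Y Jp_eq by (simp add: delta_simps der_J' mult.assoc)
qed

end

subsection \<open>Grading and classical limit\<close>

lemma of_int_left_commute: "a * (of_int k * b) = of_int k * (a * (b :: 'a::ring_1))"
  by (simp only: mult.assoc[symmetric] of_int_commute[of k a])

lemma additive_of_int_mult:
  fixes D :: "'a::ring_1 \<Rightarrow> 'b::ring_1"
  assumes add: "\<And>f g. D (f + g) = D f + D g" shows "D (of_int k * f) = of_int k * D f"
proof -
  have 0: "D 0 = 0" using add[of 0 0] by simp
  have m: "D (- f) = - D f" for f using add[of f "- f"] by (simp add: 0 eq_neg_iff_add_eq_0 add.commute)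
  have d: "D (f - g) = D f - D g" for f g using add[of f "- g"] by (simp add: m)
  have n: "D (of_nat n * f) = of_nat n * D f" for n
    by (induction n) (simp_all add: 0 add distrib_right)
  show ?thesis
    by (cases k rule: int_diff_cases) (simp add: left_diff_distrib d n)
qed

lemma derivation_of_int_mult: "derivation D \<Longrightarrow> D (of_int k * f) = of_int k * D f"
  by (rule additive_of_int_mult) (rule derivation_add)

lemma scoef_of_int_Nil [simp]: "scoef (of_int k) [] = of_int k" "scoef (of_nat n) [] = of_nat n"
  by (metis cs_of_int scoef_cs_Nil) (metis cs_of_nat scoef_cs_Nil)

lemma scoef_of_nat_mult: "scoef (of_nat k * f) xs = of_nat k * scoef f xs"
  by (metis of_int_of_nat_eq scoef_of_int_mult)

lemma der_of_nat_mult: "der x (of_nat k * f) = of_nat k * der x f"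
  by (metis of_int_of_nat_eq der_of_int_mult)

lemma derivation_homogeneous_mult:
  fixes f g :: "'a::ring_1"
  assumes "derivation D" "D f = of_int m * f" "D g = of_int n * g"
  shows "D (f * g) = of_int (m + n) * (f * g)"
proof -
  have "f * (of_int n * g) = of_int n * (f * g)" by (rule of_int_left_commute)
  then show ?thesis by (simp add: derivation_mult[OF assms(1)] assms(2,3) distrib_right mult.assoc)
qed

lemma derivation_homogeneous_power:
  assumes "derivation D" "D f = (f :: 'a::ring_1)" shows "D (f ^ n) = of_int (int n) * f ^ n"
proof (induction n)
  case (Suc n)
  then show ?case
    using derivation_homogeneous_mult[OF assms(1), of f 1 "f ^ n" "int n"] assms(2) by simp
qed (simp add: derivation_1[OF assms(1)])

lemma tsh_wtd:
  assumes "\<And>x y. \<phi> x = Some y \<Longrightarrow> w y = w x"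
  shows "tsh \<phi> (wtd w f) = wtd w (tsh \<phi> f)"
proof (rule ser_eqI)
  have *: "dero (\<phi> x) (wtd w f) = of_int (w x) * dero (\<phi> x) f + wtd w (dero (\<phi> x) f)"
    for x and f :: "('a, 'b) ser"
    using assms[of x] by (cases "\<phi> x") (simp_all add: der_wtd derivation_0[OF derivation_wtd])
  show "scoef (tsh \<phi> (wtd w f)) xs = scoef (wtd w (tsh \<phi> f)) xs" for xs
    by (induction xs arbitrary: f)
      (simp_all add: scoef_Cons der_wtd der_tsh tsh_add wtd_add * scoef_wtd[of _ _ "[]"]
        derivation_of_int_mult[OF derivation_tsh] distrib_left)
qed

text \<open>The ideal \<open>K\<close> consists of the operators of positive degree in the \<open>a\<^bsub>ij\<^esub>\<close>: modulo \<open>K\<close> only the classical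
  product survives.\<close>

locale graded_flow = flow sg p dE S0 S N for sg p :: "'e::ring_1" and dE S0 S N +
  fixes grE :: "'e \<Rightarrow> 'e" and K :: "'e set"
  assumes grE: "derivation grE" and grE_sg: "grE sg = sg" and grE_p: "grE p = 0"
    and grE_S0: "grE (S0 n) = of_int (int n) * S0 n" and grE_dE: "grE (dE a) = dE (grE a)"
    and K: "tideal K" and dE_K: "dE a \<in> K" and S0_K: "S0 (Suc n) \<in> K"
    and det_K: "determined K (dE (S0 1) + sg) p"
    and comm_K: "a * sg - sg * a \<in> K \<Longrightarrow> b * sg - sg * b \<in> K \<Longrightarrow> a * b - b * a \<in> K"
begin

text \<open>\<open>gr f = n f\<close> means that the coefficient of \<open>f\<close> at a word has
  matrix degree n plus the weights of its letters.\<close>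

definition gr :: "(letter, 'e) ser \<Rightarrow> (letter, 'e) ser" where
  "gr f = smap grE f - wtd wt f"

lemma derivation_gr: "derivation gr"
  unfolding gr_def by (rule derivation_minus_fun[OF derivation_smap[OF grE] derivation_wtd])

lemmas gr_simps = derivation_simps[OF derivation_gr] derivation_mult[OF derivation_gr]
lemmas gr_hom = derivation_homogeneous_mult[OF derivation_gr]

lemma wtd_cs: "wtd wt (cs a) = 0"
  by (rule ser_eqI) (simp add: scoef_wtd scoef_cs)

lemma gr_cs: "gr (cs a) = cs (grE a)"
  by (simp add: gr_def smap_cs[OF grE] wtd_cs)

lemma gr_sgs [simp]: "gr sgs = sgs" and gr_ps [simp]: "gr ps = 0"
  by (simp_all add: gr_cs grE_sg grE_p cs_ring)

lemma gr_sg_power: "gr (cs (sg ^ n)) = of_int (int n) * cs (sg ^ n)"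
  by (simp only: gr_cs derivation_homogeneous_power[OF grE grE_sg] cs_mult cs_of_int)

lemma der_gr: "der x (gr f) = gr (der x f) - of_int (wt x) * der x f"
  by (simp add: gr_def der_smap der_wtd)

lemma gr_bsum: "gr (bsum h) = bsum (\<lambda>x. gr (h x) - of_int (wt x) * h x)"
  by (simp add: gr_def smap_bsum[OF grE] wtd_bsum bsum_diff bsum_add diff_diff_eq)

lemma gr_delta: "gr (delta f) = delta (gr f)"
proof -
  have 1: "smap grE (smap dE f) = smap dE (smap grE f)"
    by (rule ser_eqI) (simp add: grE_dE)
  have 2: "wtd wt (smap dE f) = smap dE (wtd wt f)"
    by (rule ser_eqI) (simp add: scoef_wtd derivation_of_int_mult[OF dE])
  have 3: "tsh twist (wtd wt f) = wtd wt (tsh twist f)"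
    by (rule tsh_wtd) (auto simp: twist_def wt_def split: if_splits)
  have "delta (smap grE f - wtd wt f) = delta (smap grE f) - delta (wtd wt f)" by (simp add: delta_simps)
  then show ?thesis
    by (simp add: gr_def delta_def smap_add[OF grE] wtd_add 1 2 3 tsh_smap[OF grE])
qed

text \<open>The defect \<open>H\<close> is shown to vanish by induction on word length: the defects
  of \<open>M\<close> and \<open>Y\<close> come from that of \<open>S\<close>, uniqueness carries
  them over to \<open>N\<close>, and the flow equation brings them back to \<open>S\<close> one
  letter further.\<close>

lemma gr_S: "gr (S n) = of_int (int n) * S n"
proof -
  note z = tideal_zero
  define H where "H n = gr (S n) - of_int (int n) * S n" for n
  have H0: "scoef (H n) [] = 0" for n
    by (simp add: H_def gr_def S_Nil grE_S0 scoef_wtd scoef_of_nat_mult)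
  have "ap {0} k (H n)" for k n
  proof (induction k arbitrary: n)
    case 0 then show ?case by (simp add: ap_0_iff H0)
  next
    case (Suc k)
    have Hx: "ap {0} k (gr (Sx j) - of_int j * Sx j)" for j
    proof (cases "j < 0")
      case False then show ?thesis using Suc[of "nat j"] by (simp add: H_def intidx_def)
    qed (simp add: gr_simps ap_0[OF z])
    have W: "ap {0} k (gr (gW S j x) - of_int (int (fst x) + int (snd x) - j) * gW S j x)" for j x
    proof -
      let ?m = "int (fst x) - j"
      have c: "Sx ?m * (of_int (int (snd x)) * cs (sg ^ snd x)) = of_int (int (snd x)) * (Sx ?m * cs (sg ^ snd x))"
        by (rule of_int_left_commute)
      have "gr (gW S j x) - of_int (int (fst x) + int (snd x) - j) * gW S j x = (gr (Sx ?m) - of_int ?m * Sx ?m) * cs (sg ^ snd x)"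
        by (simp add: gW_def gr_simps gr_sg_power c[simplified] algebra_simps)
      then show ?thesis using ap_right[OF z Hx[of ?m]] by simp
    qed
    have M: "ap {0} k (gr M - M)"
    proof -
      have "gr M - M = delta (H 1)"
        by (simp add: gM_def H_def gr_simps gr_delta delta_simps)
      then show ?thesis using ap_delta[OF Suc[of 1]] by simp
    qed
    have Y: "ap {0} k (gr Y)"
    proof -
      have "gr Y = - bsum (\<lambda>x. gr (gW S 1 x) - of_int (int (fst x) + int (snd x) - 1) * gW S 1 x)"
        by (simp add: gY_def gr_simps gr_bsum wt_def)
      then show ?thesis using ap_bsum[OF z W[of 1]] by (simp add: ap_uminus[OF z] ap_mono[of _ "Suc k"])
    qed
    have N: "ap {0} k (gr (N x) - of_int (int (fst x) + int (snd x)) * N x)" for x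
    proof (rule ser_determined[OF z])
      let ?m = "of_int (int (fst x) + int (snd x)) :: (letter, 'e) ser"
      let ?L = "gr (N x) - ?m * N x"
      show "determined {0} (scoef M []) p" "scoef Y [] = 1" using det_C M_Nil Y_Nil by auto
      have "gr (N x) * M + N x * gr M = gr M * N x + M * gr (N x)"
        using arg_cong[OF N_M[of x], of gr] by (simp add: gr_simps add.commute)
      moreover have "?m * N x * M = M * (?m * N x)"
        unfolding of_int_left_commute by (simp only: mult.assoc N_M)
      ultimately have "?L * M - M * ?L = (gr M - M) * N x - N x * (gr M - M)"
        by (simp add: left_diff_distrib right_diff_distrib N_M) (simp add: algebra_simps)
      then show "ap {0} k (?L * M - M * ?L)"
        using M by (simp add: ap_diff[OF z] ap_left[OF z] ap_right[OF z])
      have "gr (N x * Y * ps) = gr (gW S 0 x * ps)" by (simp add: N_Y')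
      then have "gr (N x) * Y * ps = gr (gW S 0 x) * ps - N x * gr Y * ps"
        by (simp add: gr_simps algebra_simps)
      moreover have "?m * N x * Y * ps = ?m * gW S 0 x * ps"
        using N_Y'[of x] by (simp add: mult.assoc)
      ultimately have "?L * Y * ps = (gr (gW S 0 x) - ?m * gW S 0 x) * ps - N x * gr Y * ps"
        by (simp add: left_diff_distrib)
      then show "ap {0} k (?L * Y * ps)"
        using W[of 0 x] Y by (simp add: ap_diff[OF z] ap_left[OF z] ap_right[OF z])
    qed
    have "ap {0} k (der x (H n))" for x
    proof (cases n)
      case 0
      then have "H n = 0" by (simp add: H_def S_0 gr_simps)
      then show ?thesis by (simp add: ap_0[OF z])
    next
      case (Suc m)
      have "N x * (of_int (int m) * S m) = of_int (int m) * (N x * S m)" by (rule of_int_left_commute)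
      then have "der x (H n) = (gr (N x) - of_int (int (fst x) + int (snd x)) * N x) * S m + N x * H m"
        by (simp add: H_def \<open>n = Suc m\<close> der_gr der_S der_of_int_mult der_of_nat_mult gr_simps wt_def algebra_simps)
      then show ?thesis
        using N[of x] Suc.IH[of m] by (simp add: ap_add[OF z] ap_left[OF z] ap_right[OF z])
    qed
    then show ?case by (simp add: ap_Suc_iff H0)
  qed
  then have "H n = 0" using ap_zero_iff by blast
  then show ?thesis by (simp add: H_def)
qed

lemma gr_R: "gr (R n) = of_int (int n) * R n"
proof -
  have "gr (T n) = of_int (int n) * T n"
  proof (induction n rule: less_induct)
    case (less n)
    show ?case
    proof (cases n)
      case 0 then show ?thesis by (simp add: T_0 gr_simps)
    next
      case (Suc m)
      have "gr (T k * S (n - k)) = of_int (int n) * (T k * S (n - k))" if "k \<le> m" for k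
        using gr_hom[OF less[of k] gr_S[of "n - k"]] that Suc by simp
      then have "gr (T n) = - (\<Sum>k\<le>m. of_int (int n) * (T k * S (n - k)))"
        by (simp add: Suc T_Suc gr_simps derivation_sum[OF derivation_gr])
      then show ?thesis by (simp add: Suc T_Suc sum_distrib_left)
    qed
  qed
  then show ?thesis by (simp add: R_def alt_def gr_simps)
qed

lemma gr_Q: "gr (Q c d) = of_int (int c + int d + 1) * Q c d"
proof (induction c arbitrary: d)
  case 0 then show ?case using gr_R[of "Suc d"] by (simp add: add.commute)
next
  case (Suc c)
  then show ?case
    using gr_hom[OF gr_R[of "Suc d"] gr_S[of "Suc c"]] by (simp add: gr_simps mult_2 algebra_simps)
qed

lemma gr_J: "gr (J d * ps) = of_int (int d + 2) * (J d * ps)"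
proof -
  have 1: "gr (Qp (fst x) (Suc d) * cs (sg ^ snd x)) - of_int (wt x) * (Qp (fst x) (Suc d) * cs (sg ^ snd x))
      = of_int (int d + 2) * (Qp (fst x) (Suc d) * cs (sg ^ snd x))" for x
  proof (cases "fst x")
    case 0 then show ?thesis by (simp add: Qp_def gr_simps)
  next
    case (Suc c)
    show ?thesis
      using gr_hom[OF gr_Q[of c "Suc d"] gr_sg_power[of "snd x"]]
      by (simp add: Suc Qp_def wt_def algebra_simps)
  qed
  have "gr (J d) = of_int (int d + 2) * J d"
    unfolding J_def derivation_diff[OF derivation_gr] gr_bsum 1
    using gr_R[of "Suc (Suc d)"] by (simp add: bsum_mult_left right_diff_distrib add.commute)
  then show ?thesis by (simp add: gr_simps mult.assoc)
qed

lemma scoef_gr_J: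
  "grE (scoef (J d * ps) xs) = of_int (int d + 2 + sum_list (map wt xs)) * scoef (J d * ps) xs"
  using arg_cong[OF gr_J, of "\<lambda>f. scoef f xs" d]
  unfolding gr_def by (simp only: scoef_ring scoef_smap scoef_wtd scoef_of_int_mult) (simp add: algebra_simps)

lemma sgs_M: assumes "ap K n (sgs * S 1 - S 1 * sgs)" shows "ap K n (sgs * M - M * sgs)"
proof -
  have d: "ap K n (smap dE (S 1))" by (simp add: ap_def dE_K)
  have "sgs * M - M * sgs = (sgs * smap dE (S 1) - smap dE (S 1) * sgs) + tsh twist (sgs * S 1 - S 1 * sgs)"
    by (simp add: gM_def delta_def derivation_mult[OF derivation_tsh] derivation_diff[OF derivation_tsh] algebra_simps)
  then show ?thesis
    using ap_tsh[OF K assms, of twist] d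
    by (simp add: ap_add[OF K] ap_diff[OF K] ap_left[OF K] ap_right[OF K])
qed

text \<open>Because \<open>dE\<close> maps into \<open>K\<close>, the operator \<open>sg\<close>
  commutes with \<open>M\<close> modulo \<open>K\<close> as soon as it commutes with
  \<open>S 1\<close>. It then lies in the commutant together with each \<open>N x\<close>, and the
  flow equation gives one more letter.\<close>

lemma S_sgs: "ap K n (sgs * S k - S k * sgs)"
proof (induction n arbitrary: k)
  case 0
  have "sg * S0 k - S0 k * sg \<in> K"
    by (cases k) (simp_all add: S0_0 tideal_0[OF K] tideal_diff[OF K] tideal_left[OF K] tideal_right[OF K] S0_K)
  then show ?case by (simp add: ap_0_iff S_Nil)
next
  case (Suc n)
  have "ap K n (sgs * M - M * sgs)" by (rule sgs_M[OF Suc])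
  moreover have "ap K n (N x * M - M * N x)" for x by (simp add: N_M ap_0[OF K])
  moreover have "solvable (scoef M []) p" "determined {0} (scoef M []) p"
    using solv_C det_C M_Nil by simp_all
  ultimately have N: "ap K n (sgs * N x - N x * sgs)" for x
    using commutant_commutative[OF K solv_sg det_sg _ _ Y_Nil comm_K] by blast
  have "ap K n (der x (sgs * S k - S k * sgs))" for x
  proof (cases k)
    case 0 then show ?thesis by (simp add: S_0 ap_0[OF K])
  next
    case (Suc m)
    have "der x (sgs * S k - S k * sgs) = (sgs * N x - N x * sgs) * S m + N x * (sgs * S m - S m * sgs)"
      by (simp add: Suc der_mult der_S algebra_simps)
    then show ?thesis
      using N[of x] Suc.IH[of m] by (simp add: ap_add[OF K] ap_left[OF K] ap_right[OF K])
  qed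
  moreover have "scoef (sgs * S k - S k * sgs) [] \<in> K"
    by (cases k) (simp_all add: S_Nil S0_0 tideal_0[OF K] tideal_diff[OF K] tideal_left[OF K] tideal_right[OF K] S0_K)
  ultimately show ?case by (simp add: ap_Suc_iff)
qed

definition central :: "(letter, 'e) ser \<Rightarrow> bool" where
  "central f \<longleftrightarrow> (\<forall>n. ap K n (sgs * f - f * sgs))"

lemma central_mult: assumes "central f" "central g" shows "central (f * g)"
proof -
  have "sgs * (f * g) - f * g * sgs = (sgs * f - f * sgs) * g + f * (sgs * g - g * sgs)" by (simp add: algebra_simps)
  then show ?thesis using assms by (simp add: central_def ap_add[OF K] ap_left[OF K] ap_right[OF K])
qed

lemma central_uminus: assumes "central f" shows "central (- f)"
proof -
  have "ap K n (- (sgs * f - f * sgs))" for n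
    using assms unfolding central_def by (intro ap_uminus[OF K]) simp
  then show ?thesis by (simp add: central_def)
qed

lemma central_add: assumes "central f" "central g" shows "central (f + g)"
proof -
  have "sgs * (f + g) - (f + g) * sgs = (sgs * f - f * sgs) + (sgs * g - g * sgs)" by (simp add: algebra_simps)
  then show ?thesis using assms by (simp add: central_def ap_add[OF K])
qed

lemma central_triv: "central 0" "central 1"
  by (simp_all add: central_def ap_0[OF K])

lemma central_sum: "(\<And>a. a \<in> A \<Longrightarrow> central (f a)) \<Longrightarrow> central (sum f A)"
  by (induction A rule: infinite_finite_induct) (auto simp: central_add central_triv)

lemma central_S: "central (S n)"
  by (simp add: central_def S_sgs)

lemma central_R: "central (R n)"
proof -
  have "central (T n)"
  proof (induction n rule: less_induct)
    case (less n)
    then show ?case by (subst T.simps) (auto simp: central_triv intro!: central_uminus central_sum central_mult central_S)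
  qed
  then show ?thesis by (simp add: R_def alt_def central_uminus)
qed

lemma central_power: "central f \<Longrightarrow> ap K n (cs (sg ^ i) * f - f * cs (sg ^ i))"
proof (induction i)
  case 0 then show ?case by (simp add: cs_ring ap_0[OF K])
next
  case (Suc i)
  have "cs (sg ^ Suc i) * f - f * cs (sg ^ Suc i) = sgs * (cs (sg ^ i) * f - f * cs (sg ^ i)) + (sgs * f - f * sgs) * cs (sg ^ i)"
    by (simp add: cs_mult algebra_simps)
  then show ?case using Suc by (simp add: central_def ap_add[OF K] ap_left[OF K] ap_right[OF K])
qed

lemma central_M: "central M"
  by (simp add: central_def sgs_M S_sgs[of _ 1, simplified])

text \<open>In the classical limit \<open>sg\<close> commutes with \<open>M\<close>, so both
  operators lie in its commutant, and they agree on the unit vector.\<close>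

lemma N_K: "ap K n (N (0, i) - cs (sg ^ i) * N (0, 0))"
proof (rule ser_determined[OF K])
  show "determined K (scoef M []) p" "scoef Y [] = 1" using det_K M_Nil Y_Nil by auto
  let ?L = "N (0, i) - cs (sg ^ i) * N (0, 0)"
  have "?L * M - M * ?L = - ((cs (sg ^ i) * M - M * cs (sg ^ i)) * N (0, 0))"
    using N_M[of "(0, 0)"] N_M[of "(0, i)"] by (simp add: algebra_simps)
  then show "ap K n (?L * M - M * ?L)"
    by (simp add: ap_uminus[OF K] ap_right[OF K] central_power central_M del: minus_diff_eq)
  have "N (0, 0) * (Y * ps) = ps" using N_Y[of "(0, 0)"] by (simp add: S_0 cs_ring mult.assoc)
  then have "?L * Y * ps = 0"
    using N_Y[of "(0, i)"] by (simp add: left_diff_distrib S_0 mult.assoc)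
  then show "ap K n (?L * Y * ps)" by (simp add: ap_0[OF K])
qed

lemma der_der_J_K: "ap K n (der (0, i) (der y (J d * ps)) - cs (sg ^ i) * der (0, 0) (der y (J d * ps)))"
proof -
  let ?u = "S (fst y) * cs (sg ^ snd y) * ps"
  have "der (0, i) (der y (J d * ps)) - cs (sg ^ i) * der (0, 0) (der y (J d * ps))
    = R d * (N (0, i) - cs (sg ^ i) * N (0, 0)) * ?u
      - (cs (sg ^ i) * R d - R d * cs (sg ^ i)) * (N (0, 0) * ?u)"
    by (simp add: der_der_J algebra_simps)
  then show ?thesis
    by (simp add: ap_diff[OF K] ap_left[OF K] ap_right[OF K] N_K central_power central_R)
qed

lemma N_Nil_Suc_K: "scoef (N (Suc d, i)) [] \<in> K"
proof -
  let ?L = "scoef (N (Suc d, i)) []"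
  have "?L * (dE (S0 1) + sg) - (dE (S0 1) + sg) * ?L \<in> K"
    using arg_cong[OF N_M[of "(Suc d, i)"], of "\<lambda>f. scoef f []"] by (simp add: M_Nil tideal_0[OF K])
  moreover have "?L * p \<in> K"
    using arg_cong[OF N_Y[of "(Suc d, i)"], of "\<lambda>f. scoef f []"]
    by (simp add: Y_Nil S_Nil S0_K tideal_right[OF K])
  ultimately show ?thesis using det_K unfolding determined_def by blast
qed

lemma N_Nil_0_K: "scoef (N (0, i)) [] - sg ^ i \<in> K"
proof -
  let ?L = "scoef (N (0, i)) [] - sg ^ i" and ?C = "dE (S0 1) + sg"
  have "?L * ?C - ?C * ?L = dE (S0 1) * sg ^ i - sg ^ i * dE (S0 1)"
    using arg_cong[OF N_M[of "(0, i)"], of "\<lambda>f. scoef f []"]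
    by (simp add: M_Nil algebra_simps power_commutes)
  then have "?L * ?C - ?C * ?L \<in> K"
    by (simp add: tideal_diff[OF K] tideal_left[OF K] tideal_right[OF K] dE_K)
  moreover have "?L * p \<in> K"
    using arg_cong[OF N_Y[of "(0, i)"], of "\<lambda>f. scoef f []"]
    by (simp add: Y_Nil S_Nil S0_0 left_diff_distrib tideal_0[OF K])
  ultimately show ?thesis using det_K unfolding determined_def by blast
qed

lemma R_Nil_K: "scoef (R (Suc n)) [] \<in> K"
proof -
  have sumK: "(\<And>a. a \<in> A \<Longrightarrow> f a \<in> K) \<Longrightarrow> sum f A \<in> K" for A and f :: "nat \<Rightarrow> 'e"
    by (induction A rule: infinite_finite_induct) (auto simp: tideal_0[OF K] tideal_add[OF K])
  have "scoef (T (Suc n)) [] = - (\<Sum>k\<le>n. scoef (T k) [] * S0 (Suc (n - k)))"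
    by (simp add: T_Suc scoef_sum S_Nil Suc_diff_le)
  moreover have "(\<Sum>k\<le>n. scoef (T k) [] * S0 (Suc (n - k))) \<in> K"
    by (rule sumK) (simp add: tideal_left[OF K] S0_K)
  ultimately show ?thesis by (simp add: R_def alt_def tideal_uminus[OF K])
qed

lemma Q_Nil_K: "scoef (Q c d) [] \<in> K"
  by (induction c arbitrary: d) (simp_all add: R_Nil_K S_Nil S0_K tideal_diff[OF K] tideal_left[OF K])

lemma J_Nil_K: "scoef (J d * ps) [] \<in> K"
  by (simp add: J_def R_Nil_K tideal_right[OF K])

end

section \<open>Endomorphisms of a polynomial module\<close>

text \<open>Column-finite infinite matrices over \<open>'k\<close>. Finiteness of columns reflects
  that, for fixed upper entries, only finitely many lower indices have non-negative degree.\<close>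

typedef (overloaded) 'k endo = "{f :: 'k::comm_ring_1 poly \<Rightarrow> 'k poly.
    (\<forall>p q. f (p + q) = f p + f q) \<and> (\<forall>a p. f (smult a p) = smult a (f p))}"
  morphisms app Endo
  by (rule exI[of _ id]) simp

lemma app_add: "app f (p + q) = app f p + app f q"
  and app_smult: "app f (smult a p) = smult a (app f p)"
  using app[of f] by simp_all

lemma app_Endo: "(\<And>p q. f (p + q) = f p + f q) \<Longrightarrow> (\<And>a p. f (smult a p) = smult a (f p)) \<Longrightarrow> app (Endo f) = f"
  by (simp add: Endo_inverse)

lemma app_0 [simp]: "app f 0 = 0"
  using app_smult[of f 0 0] by simp

lemma app_uminus: "app f (- p) = - app f p"
  using app_smult[of f "- 1" p] by simp

lemma app_diff: "app f (p - q) = app f p - app f q"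
  using app_add[of f p "- q"] by (simp add: app_uminus)

lemma app_sum: "app f (sum g A) = (\<Sum>a\<in>A. app f (g a))"
  by (induction A rule: infinite_finite_induct) (auto simp: app_add)

instantiation endo :: (comm_ring_1) ring_1
begin

definition "0 = Endo (\<lambda>p. 0)"
definition "1 = Endo (\<lambda>p. p)"
definition "f + g = Endo (\<lambda>p. app f p + app g p)"
definition "f - g = Endo (\<lambda>p. app f p - app g p)"
definition "- f = Endo (\<lambda>p. - app f p)"
definition "f * g = Endo (\<lambda>p. app f (app g p))"

lemma app_ring [simp]:
  "app 0 p = 0" "app 1 p = p" "app (f + g) p = app f p + app g p"
  "app (f - g) p = app f p - app g p" "app (- f) p = - app f p" "app (f * g) p = app f (app g p)"
  by (simp_all add: zero_endo_def one_endo_def plus_endo_def minus_endo_def uminus_endo_def times_endo_def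
      app_Endo app_add app_smult smult_add_right smult_diff_right)

lemma endo_eq_iff: "f = g \<longleftrightarrow> (\<forall>p. app f p = app g p)"
  by (metis app_inject ext)

instance
proof
  have "app 0 1 \<noteq> app (1 :: 'a endo) 1" by simp
  then show "(0 :: 'a endo) \<noteq> 1" by metis
qed (simp_all add: endo_eq_iff app_add algebra_simps)

end

abbreviation ev :: "nat \<Rightarrow> 'k::comm_ring_1 poly" where
  "ev k \<equiv> monom 1 k"

lemma poly_expand: "degree p \<le> n \<Longrightarrow> p = (\<Sum>k\<le>n. smult (coeff p k) (ev k))"
  by (simp add: smult_monom poly_as_sum_of_monoms')

lemma app_expand: "degree p \<le> n \<Longrightarrow> app f p = (\<Sum>k\<le>n. smult (coeff p k) (app f (ev k)))"
  by (subst (1) poly_expand, assumption) (simp add: app_sum app_smult)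

lemma endo_eqI: assumes "\<And>k. app f (ev k) = app g (ev k)" shows "f = g"
proof -
  have "app f p = app g p" for p
    by (simp add: app_expand[OF order_refl, of f p] app_expand[OF order_refl, of g p] assms)
  then show ?thesis by (simp add: endo_eq_iff)
qed

lemma smult_sum_right: "smult a (sum f A) = (\<Sum>x\<in>A. smult a (f x))"
  by (induction A rule: infinite_finite_induct) (auto simp: smult_add_right)

definition lin :: "(nat \<Rightarrow> 'k::comm_ring_1 poly) \<Rightarrow> 'k endo" where
  "lin l = Endo (\<lambda>p. \<Sum>k\<le>degree p. smult (coeff p k) (l k))"

lemma app_lin: "app (lin l) p = (\<Sum>k\<le>degree p. smult (coeff p k) (l k))"
proof -
  have ext: "(\<Sum>k\<le>degree p. smult (coeff p k) (l k)) = (\<Sum>k\<le>n. smult (coeff p k) (l k))"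
    if "degree p \<le> n" for p n
    using that by (intro sum.mono_neutral_left) (auto simp: coeff_eq_0)
  have "app (Endo (\<lambda>p. \<Sum>k\<le>degree p. smult (coeff p k) (l k))) = (\<lambda>p. \<Sum>k\<le>degree p. smult (coeff p k) (l k))"
  proof (rule app_Endo)
    fix p q :: "'a poly"
    let ?n = "max (degree p) (degree q)"
    have n: "degree (p + q) \<le> ?n" "degree p \<le> ?n" "degree q \<le> ?n"
      by (simp_all add: degree_add_le_max)
    show "(\<Sum>k\<le>degree (p + q). smult (coeff (p + q) k) (l k))
      = (\<Sum>k\<le>degree p. smult (coeff p k) (l k)) + (\<Sum>k\<le>degree q. smult (coeff q k) (l k))"
      unfolding n[THEN ext] by (simp add: smult_add_left sum.distrib)
  next
    fix a and p :: "'a poly"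
    have "degree (smult a p) \<le> degree p" by (rule degree_smult_le)
    show "(\<Sum>k\<le>degree (smult a p). smult (coeff (smult a p) k) (l k)) = smult a (\<Sum>k\<le>degree p. smult (coeff p k) (l k))"
      unfolding ext[OF \<open>degree (smult a p) \<le> degree p\<close>] by (simp add: smult_sum_right)
  qed
  then show ?thesis by (simp add: lin_def)
qed

lemma app_lin_ev [simp]: "app (lin l) (ev k) = l k"
proof -
  have "app (lin l) (ev k) = (\<Sum>j\<le>k. smult (if k = j then 1 else 0) (l j))"
    by (simp add: app_lin degree_monom_eq)
  also have "\<dots> = (\<Sum>j\<le>k. if k = j then l j else 0)"
    by (intro sum.cong) auto
  finally show ?thesis by simp
qed

text \<open>Multiplication by \<open>H^1\<close> with entries \<open><H^1, H^j, H_i>\<close>: the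
  entry at i = j + 1 has degree zero and is 1, and those at i > j + 1 have negative degree.\<close>

definition cop :: "(nat \<Rightarrow> nat \<Rightarrow> 'k::comm_ring_1) \<Rightarrow> 'k endo" where
  "cop \<alpha> = lin (\<lambda>j. ev (Suc j) + (\<Sum>i\<le>j. smult (\<alpha> i j) (ev i)))"

definition shift :: "'k::comm_ring_1 endo" where
  "shift = cop (\<lambda>_ _. 0)"

definition vac :: "'k::comm_ring_1 endo" where
  "vac = lin (\<lambda>j. if j = 0 then 1 else 0)"

lemma app_cop_ev: "app (cop \<alpha>) (ev j) = ev (Suc j) + (\<Sum>i\<le>j. smult (\<alpha> i j) (ev i))"
  by (simp add: cop_def)

lemma app_shift_ev [simp]: "app shift (ev j) = ev (Suc j)"
  by (simp add: shift_def app_cop_ev)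

lemma app_vac_ev [simp]: "app vac (ev j) = (if j = 0 then 1 else 0)"
  by (simp add: vac_def)

lemma ev_0: "ev 0 = 1"
  by (simp add: monom_0)

lemma app_vac_1 [simp]: "app vac 1 = 1"
  using app_vac_ev[of 0] by (simp add: ev_0)

lemma app_shift_power: "app (shift ^ n) (ev j) = ev (n + j)"
  by (induction n) auto

lemma app_shift_power_1: "app (shift ^ n) 1 = ev n"
  using app_shift_power[of n 0] by (simp add: ev_0)

lemma coeff_app_shift: "coeff (app shift p) r = (case r of 0 \<Rightarrow> 0 | Suc r' \<Rightarrow> coeff p r')"
proof -
  have "app shift p = monom 1 1 * p"
  proof -
    have "app shift p = (\<Sum>k\<le>degree p. smult (coeff p k) (monom 1 1 * ev k))"
      by (simp add: app_expand[OF order_refl, of shift p] mult_monom)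
    also have "\<dots> = monom 1 1 * (\<Sum>k\<le>degree p. smult (coeff p k) (ev k))"
      by (simp add: sum_distrib_left)
    finally show ?thesis using poly_expand[of p, OF order_refl] by simp
  qed
  then show ?thesis by (simp add: coeff_monom_mult split: nat.split)
qed

text \<open>Prescribing \<open>L 1\<close> and the defect \<open>L C - P L = W\<close> determines \<open>L\<close> on the basis recursively,
  since \<open>C e\<^sub>j\<close> is \<open>e\<^bsub>j+1\<^esub>\<close> plus lower terms.\<close>

fun cyc_sol :: "(nat \<Rightarrow> nat \<Rightarrow> 'k::comm_ring_1) \<Rightarrow> 'k endo \<Rightarrow> 'k endo \<Rightarrow> 'k endo \<Rightarrow> nat \<Rightarrow> 'k poly" where
  "cyc_sol \<alpha> P W V 0 = app V 1"
| "cyc_sol \<alpha> P W V (Suc j) = app P (cyc_sol \<alpha> P W V j) + app W (ev j) - (\<Sum>i\<le>j. smult (\<alpha> i j) (cyc_sol \<alpha> P W V i))"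

lemma solvable_cop: "solvable (cop \<alpha>) vac"
  unfolding solvable_def
proof (intro allI exI conjI)
  fix P W V :: "'a endo"
  let ?L = "lin (cyc_sol \<alpha> P W V)"
  show "?L * cop \<alpha> - P * ?L = W"
    by (rule endo_eqI) (simp add: app_cop_ev app_add app_sum app_smult)
  show "?L * vac = V * vac"
  proof (rule endo_eqI)
    show "app (?L * vac) (ev k) = app (V * vac) (ev k)" for k
      using app_lin_ev[of "cyc_sol \<alpha> P W V" 0] by (simp add: ev_0)
  qed
qed

definition aideal :: "'k::comm_ring_1 set \<Rightarrow> bool" where
  "aideal I \<longleftrightarrow> 0 \<in> I \<and> (\<forall>a\<in>I. \<forall>b\<in>I. a + b \<in> I) \<and> (\<forall>a\<in>I. \<forall>r. r * a \<in> I)"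

definition polyI :: "'k::comm_ring_1 set \<Rightarrow> 'k poly set" where
  "polyI I = {p. \<forall>k. coeff p k \<in> I}"

definition endoI :: "'k::comm_ring_1 set \<Rightarrow> 'k endo set" where
  "endoI I = {f. \<forall>p. app f p \<in> polyI I}"

context
  fixes I :: "'k::comm_ring_1 set" assumes I: "aideal I"
begin

lemma aideal_facts:
  "0 \<in> I" "a \<in> I \<Longrightarrow> b \<in> I \<Longrightarrow> a + b \<in> I" "a \<in> I \<Longrightarrow> r * a \<in> I"
  using I by (auto simp: aideal_def)

lemma aideal_uminus: "a \<in> I \<Longrightarrow> - a \<in> I"
  using aideal_facts(3)[of a "- 1"] by simp

lemma aideal_sum: "(\<And>x. x \<in> A \<Longrightarrow> f x \<in> I) \<Longrightarrow> sum f A \<in> I"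
  by (induction A rule: infinite_finite_induct) (auto simp: aideal_facts)

lemma polyI_facts:
  "0 \<in> polyI I" "p \<in> polyI I \<Longrightarrow> q \<in> polyI I \<Longrightarrow> p + q \<in> polyI I"
  "p \<in> polyI I \<Longrightarrow> - p \<in> polyI I" "p \<in> polyI I \<Longrightarrow> smult a p \<in> polyI I"
  by (auto simp: polyI_def aideal_facts aideal_uminus)

lemma polyI_diff: "p \<in> polyI I \<Longrightarrow> q \<in> polyI I \<Longrightarrow> p - q \<in> polyI I"
  using polyI_facts(2)[of p "- q"] polyI_facts(3)[of q] by simp

lemma polyI_mult: "p \<in> polyI I \<Longrightarrow> q * p \<in> polyI I"
  by (simp add: polyI_def coeff_mult aideal_sum aideal_facts)

lemma polyI_sum: "(\<And>x. x \<in> A \<Longrightarrow> f x \<in> polyI I) \<Longrightarrow> sum f A \<in> polyI I"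
  by (induction A rule: infinite_finite_induct) (auto simp: polyI_facts)

lemma polyI_smult_left: "a \<in> I \<Longrightarrow> smult a p \<in> polyI I"
  by (simp add: polyI_def mult.commute[of a] aideal_facts)

lemma polyI_app: "p \<in> polyI I \<Longrightarrow> app f p \<in> polyI I"
proof -
  assume "p \<in> polyI I"
  then have "coeff p k \<in> I" for k by (simp add: polyI_def)
  then show "app f p \<in> polyI I"
    unfolding app_expand[OF order_refl, of f p] by (intro polyI_sum polyI_smult_left)
qed

lemma endoI_ev: assumes "\<And>k. app f (ev k) \<in> polyI I" shows "f \<in> endoI I"
proof -
  have "app f p \<in> polyI I" for p
    unfolding app_expand[OF order_refl, of f p] by (intro polyI_sum polyI_facts assms)
  then show ?thesis by (simp add: endoI_def)
qed

lemma tideal_endoI: "tideal (endoI I)"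
  by (auto simp: tideal_def endoI_def polyI_facts polyI_app)

lemma determined_cop: "determined (endoI I) (cop \<alpha>) vac"
  unfolding determined_def
proof (intro allI impI)
  fix L P :: "'k endo"
  assume A: "L * cop \<alpha> - P * L \<in> endoI I \<and> L * vac \<in> endoI I"
  show "L \<in> endoI I"
  proof (rule endoI_ev)
    show "app L (ev k) \<in> polyI I" for k
    proof (induction k rule: less_induct)
      case (less k)
      show ?case
      proof (cases k)
        case 0
        have "app (L * vac) 1 \<in> polyI I" using A unfolding endoI_def by blast
        then show ?thesis by (simp add: 0 ev_0)
      next
        case (Suc j)
        have "app (L * cop \<alpha> - P * L) (ev j) \<in> polyI I" using A unfolding endoI_def by blast
        moreover have "app P (app L (ev j)) \<in> polyI I" using less[of j] Suc by (simp add: polyI_app)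
        moreover have "(\<Sum>i\<le>j. smult (\<alpha> i j) (app L (ev i))) \<in> polyI I"
          using less Suc by (intro polyI_sum polyI_facts) auto
        moreover have "app L (ev k) = app (L * cop \<alpha> - P * L) (ev j) + app P (app L (ev j)) - (\<Sum>i\<le>j. smult (\<alpha> i j) (app L (ev i)))"
          by (simp add: Suc app_cop_ev app_add app_sum app_smult)
        ultimately show ?thesis by (metis polyI_facts(2) polyI_diff)
      qed
    qed
  qed
qed

text \<open>Commuting with the shift means being \<open>'k[x]\<close>-linear, hence being
  multiplication by the value at 1. Such operators commute with each other.\<close>

lemma app_commutant:
  assumes "a * shift - shift * a \<in> endoI I" shows "app a p - p * app a 1 \<in> polyI I"
proof -
  have "app a (ev k) - ev k * app a 1 \<in> polyI I" for k
  proof (induction k)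
    case 0 then show ?case by (simp add: ev_0 polyI_facts)
  next
    case (Suc k)
    have 1: "app a (ev (Suc k)) - app shift (app a (ev k)) \<in> polyI I"
      using assms by (auto simp: endoI_def dest: spec[of _ "ev k"])
    have s: "app shift p = ev 1 * p" for p :: "'k poly"
      by (rule poly_eqI) (simp add: coeff_app_shift coeff_monom_mult split: nat.split)
    have "app a (ev (Suc k)) - ev (Suc k) * app a 1
      = (app a (ev (Suc k)) - app shift (app a (ev k))) + ev 1 * (app a (ev k) - ev k * app a 1)"
      by (simp add: s right_diff_distrib mult.assoc[symmetric] mult_monom)
    then show ?case using 1 Suc polyI_facts(2) polyI_mult by metis
  qed
  moreover have "app a p - p * app a 1 = (\<Sum>k\<le>degree p. smult (coeff p k) (app a (ev k) - ev k * app a 1))"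
  proof -
    have "p * app a 1 = (\<Sum>k\<le>degree p. smult (coeff p k) (ev k * app a 1))"
      using arg_cong[OF poly_expand[of p, OF order_refl], of "\<lambda>q. q * app a 1"] by (simp add: sum_distrib_right)
    then show ?thesis
      by (simp add: app_expand[OF order_refl, of a p] smult_diff_right sum_subtractf)
  qed
  ultimately show ?thesis by (simp add: polyI_sum polyI_facts)
qed

lemma commutant_shift:
  assumes a: "a * shift - shift * a \<in> endoI I" and b: "b * shift - shift * b \<in> endoI I"
  shows "a * b - b * a \<in> endoI I"
proof -
  have "app a (app b p) - app b (app a p) \<in> polyI I" for p
  proof -
    have "app a (app b p) - app b (app a p) = (app a (app b p) - app b p * app a 1) - (app b (app a p) - app a p * app b 1)
        + app a 1 * (app b p - p * app b 1) - app b 1 * (app a p - p * app a 1)"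
      by (simp add: algebra_simps)
    then show ?thesis
      using app_commutant[OF a] app_commutant[OF b] polyI_facts(2) polyI_diff polyI_mult by metis
  qed
  then show ?thesis by (simp add: endoI_def)
qed

end

lemma aideal_zero: "aideal {0}"
  by (simp add: aideal_def)

lemma endoI_zero: "endoI {0} = {0}"
  by (auto simp: endoI_def polyI_def endo_eq_iff poly_eq_iff)

subsection \<open>Coefficientwise operators\<close>

definition additive_map :: "('k::comm_ring_1 \<Rightarrow> 'k) \<Rightarrow> bool" where
  "additive_map d \<longleftrightarrow> (\<forall>a b. d (a + b) = d a + d b)"

lemma additive_map_0: "additive_map d \<Longrightarrow> d 0 = 0"
  unfolding additive_map_def by (metis add_cancel_right_left)

definition coefm :: "('k::comm_ring_1 \<Rightarrow> 'k) \<Rightarrow> 'k endo \<Rightarrow> 'k endo" where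
  "coefm d f = lin (\<lambda>k. map_poly d (app f (ev k)))"

lemma app_coefm_ev: "app (coefm d f) (ev k) = map_poly d (app f (ev k))"
  by (simp add: coefm_def)

lemma map_poly_add: "additive_map d \<Longrightarrow> map_poly d (p + q) = map_poly d p + map_poly d q"
  by (rule poly_eqI) (simp add: coeff_map_poly additive_map_0, simp add: additive_map_def)

lemma coefm_add: "additive_map d \<Longrightarrow> coefm d (f + g) = coefm d f + coefm d g"
  by (rule endo_eqI) (simp add: app_coefm_ev map_poly_add)

text \<open>For a derivation \<open>d\<close> of the scalars, acting on entries is taking the
  commutator with the coefficientwise action on polynomials; hence it is again a derivation.\<close>

lemma app_coefm:
  assumes d: "derivation d" shows "app (coefm d f) p = map_poly d (app f p) - app f (map_poly d p)"
proof -
  have a: "additive_map d" using d by (simp add: additive_map_def derivation_def)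
  let ?D = "map_poly d"
  have sm: "?D (smult c q) = smult (d c) q + smult c (?D q)" for c q
    by (rule poly_eqI) (simp add: coeff_map_poly derivation_0[OF d] derivation_mult[OF d])
  have D0: "?D 0 = 0" by simp
  have su: "?D (sum g A) = (\<Sum>x\<in>A. ?D (g x))" for g :: "nat \<Rightarrow> 'a poly" and A
    by (induction A rule: infinite_finite_induct) (simp_all add: map_poly_add[OF a])
  have De: "?D (ev k) = 0" for k
    by (rule poly_eqI) (simp add: coeff_map_poly derivation_simps(1,2)[OF d])
  let ?n = "degree p"
  have "?D (app f p) = (\<Sum>k\<le>?n. smult (d (coeff p k)) (app f (ev k)) + smult (coeff p k) (?D (app f (ev k))))"
    by (simp add: app_expand[OF order_refl, of f p] su sm)
  moreover have "?D p = (\<Sum>k\<le>?n. smult (d (coeff p k)) (ev k))"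
    using arg_cong[OF poly_expand[of p, OF order_refl], of ?D] by (simp add: su sm De)
  ultimately show ?thesis
    by (simp add: app_expand[OF order_refl, of "coefm d f" p] app_coefm_ev app_sum app_smult sum.distrib)
qed

lemma derivation_coefm: assumes d: "derivation d" shows "derivation (coefm d)"
proof -
  have a: "additive_map d" using d by (simp add: additive_map_def derivation_def)
  have "coefm d (f * g) = coefm d f * g + f * coefm d g" for f g
    by (simp add: endo_eq_iff app_coefm[OF d] app_diff)
  then show ?thesis by (simp add: derivation_def coefm_add[OF a])
qed

lemma coefm_cop: "derivation d \<Longrightarrow> coefm d (cop \<alpha>) = cop (\<lambda>i j. d (\<alpha> i j)) - shift"
proof (rule endo_eqI)
  fix j assume d: "derivation d"
  have "map_poly d (ev (Suc j) + (\<Sum>i\<le>j. smult (\<alpha> i j) (ev i))) = (\<Sum>i\<le>j. smult (d (\<alpha> i j)) (ev i))"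
    by (rule poly_eqI) (simp add: coeff_map_poly derivation_simps(1,2)[OF d] derivation_sum[OF d]
        derivation_add[OF d] derivation_mult[OF d] coeff_sum if_distrib[of d] cong: if_cong)
  then show "app (coefm d (cop \<alpha>)) (ev j) = app (cop (\<lambda>i j. d (\<alpha> i j)) - shift) (ev j)"
    by (simp add: app_coefm_ev app_cop_ev)
qed

definition xdeg :: "'k::comm_ring_1 endo" where
  "xdeg = lin (\<lambda>k. smult (of_nat k) (ev k))"

lemma app_xdeg_ev: "app xdeg (ev k) = smult (of_nat k) (ev k)"
  by (simp add: xdeg_def)

lemma coeff_app_xdeg: "coeff (app xdeg p) i = of_nat i * coeff p i"
proof -
  have "coeff (app xdeg p) i = (\<Sum>k\<le>degree p. coeff p k * (of_nat k * (if k = i then 1 else 0)))"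
    by (simp add: app_expand[OF order_refl, of xdeg p] app_xdeg_ev coeff_sum mult.assoc)
  also have "\<dots> = (\<Sum>k\<le>degree p. if k = i then of_nat i * coeff p i else 0)"
    by (intro sum.cong) auto
  also have "\<dots> = of_nat i * coeff p i"
    by (simp add: coeff_eq_0)
  finally show ?thesis .
qed

text \<open>The entry in row i and column j gets degree \<open>d\<close> + i - j, so the shift has
  degree one.\<close>

definition grade :: "('k::comm_ring_1 \<Rightarrow> 'k) \<Rightarrow> 'k endo \<Rightarrow> 'k endo" where
  "grade d f = coefm d f + (xdeg * f - f * xdeg)"

lemma derivation_grade: "derivation d \<Longrightarrow> derivation (grade d)"
  unfolding grade_def by (rule derivation_plus[OF derivation_coefm derivation_comm])

lemma coeff_grade_ev:
  "derivation d \<Longrightarrow> coeff (app (grade d f) (ev j)) i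
    = d (coeff (app f (ev j)) i) + of_nat i * coeff (app f (ev j)) i - of_nat j * coeff (app f (ev j)) i"
  by (simp add: grade_def app_coefm_ev coeff_map_poly derivation_0 coeff_app_xdeg app_xdeg_ev app_smult)

section \<open>Weighted polynomial rings\<close>

alias lookup = Poly_Mapping.lookup
alias single = Poly_Mapping.single
alias keys = Poly_Mapping.keys

lemma pm_expand: "p = (\<Sum>m\<in>keys p. single m (lookup p m))"
proof (rule poly_mapping_eqI)
  fix k
  have "lookup (\<Sum>m\<in>keys p. single m (lookup p m)) k
      = (\<Sum>m\<in>keys p. if k = m then lookup p m else 0)"
    unfolding lookup_sum by (intro sum.cong refl) (auto simp: lookup_single when_def)
  also have "\<dots> = lookup p k"
    by (simp add: in_keys_iff)
  finally show "lookup p k = lookup (\<Sum>m\<in>keys p. single m (lookup p m)) k"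
    by simp
qed

lemma pm_induct:
  fixes p :: "'a \<Rightarrow>\<^sub>0 'b::comm_monoid_add"
  assumes "\<And>m c. P (single m c)" "\<And>p q. P p \<Longrightarrow> P q \<Longrightarrow> P (p + q)"
  shows "P p"
proof -
  have "P (\<Sum>m\<in>A. single m (f m))" for A and f
    using assms(1)[of _ 0] by (induction A rule: infinite_finite_induct) (auto intro: assms)
  then show ?thesis by (subst pm_expand)
qed

definition mweight :: "('v \<Rightarrow> nat) \<Rightarrow> ('v \<Rightarrow>\<^sub>0 nat) \<Rightarrow> nat" where
  "mweight w m = (\<Sum>v\<in>keys m. w v * lookup m v)"

lemma mweight_superset:
  "finite A \<Longrightarrow> keys m \<subseteq> A \<Longrightarrow> mweight w m = (\<Sum>v\<in>A. w v * lookup m v)"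
  unfolding mweight_def by (rule sum.mono_neutral_left) (auto simp: in_keys_iff)

lemma mweight_add: "mweight w (m + n) = mweight w m + mweight w n"
proof -
  let ?A = "keys m \<union> keys n"
  have A: "finite ?A" by simp
  have "keys (m + n) \<subseteq> ?A" by (rule keys_add)
  then show ?thesis
    by (simp add: mweight_superset[OF A] lookup_add sum.distrib algebra_simps)
qed

lemma mweight_single: "mweight w (single v k) = w v * k"
  by (simp add: mweight_def)

lemma mweight_0_iff: "(\<And>v. 0 < w v) \<Longrightarrow> mweight w m = 0 \<longleftrightarrow> m = 0"
proof
  assume w: "\<And>v. 0 < w v" and "mweight w m = 0"
  then have *: "\<forall>v\<in>keys m. w v * lookup m v = 0" by (simp add: mweight_def)
  have "v \<notin> keys m" for v
    using bspec[OF *, of v] w[of v] by (cases "lookup m v = 0") (auto simp: in_keys_iff)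
  then show "m = 0" by (metis keys_eq_empty ex_in_conv)
qed (simp add: mweight_def)

section \<open>The Euler operator on polynomials and its inverse\<close>

type_synonym 'v cpoly = "('v \<Rightarrow>\<^sub>0 nat) \<Rightarrow>\<^sub>0 complex"

definition euler :: "('v \<Rightarrow> nat) \<Rightarrow> 'v cpoly \<Rightarrow> 'v cpoly" where
  "euler w = Poly_Mapping.mapp (\<lambda>m c. of_nat (mweight w m) * c)"

text \<open>In weight zero the quotient is c / 0 = 0, so for positive weights this inverts
  \<open>euler\<close> on polynomials without constant term and drops the constant
  otherwise.\<close>

definition inv_euler :: "('v \<Rightarrow> nat) \<Rightarrow> 'v cpoly \<Rightarrow> 'v cpoly" where
  "inv_euler w = Poly_Mapping.mapp (\<lambda>m c. c / of_nat (mweight w m))"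

lemma lookup_euler: "lookup (euler w p) m = of_nat (mweight w m) * lookup p m"
  by (simp add: euler_def lookup_mapp when_def in_keys_iff)

lemma lookup_inv_euler: "lookup (inv_euler w p) m = lookup p m / of_nat (mweight w m)"
  by (simp add: inv_euler_def lookup_mapp when_def in_keys_iff)

lemma euler_add: "euler w (p + q) = euler w p + euler w q"
  by (rule poly_mapping_eqI) (simp add: lookup_euler lookup_add distrib_left)

lemma inv_euler_add: "inv_euler w (p + q) = inv_euler w p + inv_euler w q"
  by (rule poly_mapping_eqI) (simp add: lookup_inv_euler lookup_add add_divide_distrib)

lemma euler_single: "euler w (single m c) = single m (of_nat (mweight w m) * c)"
  by (rule poly_mapping_eqI) (simp add: lookup_euler lookup_single when_def)

lemma derivation_euler: "derivation (euler w)"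
proof -
  have "euler w (p * q) = euler w p * q + p * euler w q" for p q
  proof (induction p rule: pm_induct)
    case (1 m c)
    show ?case
    proof (induction q rule: pm_induct)
      case (1 n d)
      show ?case by (simp add: mult_single euler_single mweight_add single_add[symmetric] algebra_simps)
    qed (simp add: algebra_simps euler_add)
  qed (simp add: algebra_simps euler_add)
  then show ?thesis by (simp add: derivation_def euler_add)
qed

lemma lookup_mult_0: "lookup (p * q) 0 = lookup p 0 * lookup (q :: 'v cpoly) 0"
proof (induction p rule: pm_induct)
  case (1 m c)
  have 0: "m + n = 0 \<longleftrightarrow> m = 0 \<and> n = 0" for n :: "'v \<Rightarrow>\<^sub>0 nat"
    by (auto simp: poly_mapping_eq_iff lookup_add fun_eq_iff plus_poly_mapping.rep_eq)
  show ?case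
  proof (induction q rule: pm_induct)
    case (1 n d)
    show ?case using 0[of n] by (auto simp: mult_single lookup_single when_def)
  qed (simp add: distrib_left lookup_add)
qed (simp add: distrib_right lookup_add)

definition augI :: "'v cpoly set" where
  "augI = {p. lookup p 0 = 0}"

lemma aideal_augI: "aideal augI"
  by (auto simp: aideal_def augI_def lookup_add lookup_mult_0)

lemma lookup_of_nat_mult: "lookup (of_nat n * p) m = of_nat n * lookup (p :: 'v cpoly) m"
  by (induction n) (simp_all add: distrib_right lookup_add)

lemma lookup_of_int_mult: "lookup (of_int n * p) m = of_int n * lookup (p :: 'v cpoly) m"
  by (cases n rule: int_diff_cases) (simp add: left_diff_distrib lookup_minus lookup_of_nat_mult)

lemma euler_inv_euler: "(\<And>v. 0 < w v) \<Longrightarrow> p \<in> augI \<Longrightarrow> euler w (inv_euler w p) = p"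
proof (rule poly_mapping_eqI)
  fix m assume w: "\<And>v. 0 < w v" and "p \<in> augI"
  then have "mweight w m = 0 \<Longrightarrow> lookup p m = 0"
    by (simp add: mweight_0_iff[OF w] augI_def)
  then show "lookup (euler w (inv_euler w p)) m = lookup p m"
    by (simp add: lookup_euler lookup_inv_euler)
qed

lemma euler_eigen_neg: "euler w p = of_int n * p \<Longrightarrow> n < 0 \<Longrightarrow> p = 0"
proof (rule poly_mapping_eqI)
  fix m assume "euler w p = of_int n * p" and n: "n < 0"
  then have "of_int (int (mweight w m) - n) * lookup p m = 0"
    using lookup_euler[of w p m] by (auto simp: lookup_of_int_mult left_diff_distrib)
  moreover have "int (mweight w m) - n \<noteq> 0" using n by simp
  ultimately show "lookup p m = lookup 0 m"
    by (simp only: mult_eq_0_iff of_int_eq_0_iff) simp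
qed

lemma euler_eigen_0: "(\<And>v. 0 < w v) \<Longrightarrow> euler w p = 0 \<Longrightarrow> p = cst (lookup p 0)"
proof (rule poly_mapping_eqI)
  fix m assume w: "\<And>v. 0 < w v" and "euler w p = 0"
  then have "of_nat (mweight w m) * lookup p m = 0"
    using lookup_euler[of w p m] by simp
  then show "lookup p m = lookup (cst (lookup p 0)) m"
    by (auto simp: mweight_0_iff[OF w] cst_def lookup_single when_def)
qed

section \<open>The universal flow over the polynomial ring\<close>

definition varA :: "avar \<Rightarrow> apoly" where
  "varA v = single (single v 1) 1"

text \<open>The degree of \<open><H^1, H^j, H_i>\<close>; the subtraction does not truncate because
  i \<le> j.\<close>

definition wA :: "avar \<Rightarrow> nat" where
  "wA v = Suc (snd (Rep_avar v)) - fst (Rep_avar v)"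

text \<open>The column j = 0 is zero: \<open><H^1, H^0, H_0>\<close> has degree 1 and vanishes by
  the string relation.\<close>

definition alpha :: "nat \<Rightarrow> nat \<Rightarrow> apoly" where
  "alpha i j = (if i \<le> j \<and> 0 < j then varA (Abs_avar (i, j)) else 0)"

abbreviation eulA :: "apoly \<Rightarrow> apoly" where
  "eulA \<equiv> euler wA"

abbreviation ieulA :: "apoly \<Rightarrow> apoly" where
  "ieulA \<equiv> inv_euler wA"

lemma wA_pos: "0 < wA v"
  using Rep_avar[of v] by (auto simp: wA_def)

lemma eulA_varA: "eulA (varA v) = of_nat (wA v) * varA v"
  by (rule poly_mapping_eqI)
    (auto simp: varA_def lookup_euler lookup_of_nat_mult lookup_single when_def mweight_single)

lemma eulA_alpha: "eulA (alpha i j) = of_int (int j + 1 - int i) * alpha i j"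
proof (cases "i \<le> j \<and> 0 < j")
  case True
  then have "Rep_avar (Abs_avar (i, j)) = (i, j)" by (intro Abs_avar_inverse) simp
  then have "wA (Abs_avar (i, j)) = Suc j - i" by (simp add: wA_def)
  then have "eulA (alpha i j) = of_nat (Suc j - i) * alpha i j"
    unfolding alpha_def using True eulA_varA by simp
  also have "(of_nat (Suc j - i) :: apoly) = of_int (int j + 1 - int i)"
    using True by (simp add: of_nat_diff)
  finally show ?thesis .
qed (auto simp: alpha_def derivation_0[OF derivation_euler])

lemma alpha_augI: "alpha i j \<in> augI"
proof -
  have "single v (Suc 0) \<noteq> 0" for v :: avar
    by (auto dest: arg_cong[of _ _ "\<lambda>m. lookup m v"])
  then show ?thesis by (auto simp: alpha_def augI_def varA_def lookup_single when_def)
qed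

text \<open>The divisor relation prescribes the Euler derivative of each matrix; dividing by weights
  solves it, since the prescribed matrix has entries without constant term.\<close>

primrec S0A :: "nat \<Rightarrow> apoly endo" where
  "S0A 0 = 1"
| "S0A (Suc n) = coefm ieulA (cop alpha * S0A n - S0A n * shift)"

abbreviation KA :: "apoly endo set" where
  "KA \<equiv> endoI augI"

lemmas KA_simps = tideal_add[OF tideal_endoI[OF aideal_augI]] tideal_diff[OF tideal_endoI[OF aideal_augI]]
  tideal_left[OF tideal_endoI[OF aideal_augI]] tideal_right[OF tideal_endoI[OF aideal_augI]]

lemma additive_ieulA: "additive_map ieulA"
  by (simp add: additive_map_def inv_euler_add)

lemma coefm_KA: assumes "d 0 = 0" "\<And>a. d a \<in> augI" shows "coefm d f \<in> KA"
  by (rule endoI_ev[OF aideal_augI]) (simp add: app_coefm_ev polyI_def coeff_map_poly assms)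

lemma ieulA_0: "ieulA 0 = 0"
  by (rule additive_map_0[OF additive_ieulA])

lemma ieulA_augI: "ieulA a \<in> augI" and eulA_augI: "eulA a \<in> augI"
  by (simp_all add: augI_def lookup_inv_euler lookup_euler mweight_def)

lemma coefm_euler_inverse: assumes "f \<in> KA" shows "coefm eulA (coefm ieulA f) = f"
proof (rule endo_eqI, rule poly_eqI)
  fix k n
  have "coeff (app f (ev k)) n \<in> augI" using assms by (simp add: endoI_def polyI_def)
  then show "coeff (app (coefm eulA (coefm ieulA f)) (ev k)) n = coeff (app f (ev k)) n"
    by (simp add: app_coefm_ev coeff_map_poly ieulA_0 derivation_0[OF derivation_euler] euler_inv_euler wA_pos)
qed

lemma S0A_Suc_KA: "S0A (Suc n) \<in> KA"
  by (simp add: coefm_KA ieulA_0 ieulA_augI)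

lemma cop_shift_KA: "cop alpha - shift \<in> KA"
  by (rule endoI_ev[OF aideal_augI])
    (auto simp: app_cop_ev intro!: polyI_sum[OF aideal_augI] polyI_smult_left[OF aideal_augI] alpha_augI)

lemma coefm_S0A_Suc: "coefm eulA (S0A (Suc n)) = cop alpha * S0A n - S0A n * shift"
proof -
  have "cop alpha * S0A n - S0A n * shift \<in> KA"
    by (cases n) (simp_all only: S0A.simps(1) cop_shift_KA mult_1_left mult_1_right KA_simps S0A_Suc_KA)
  then show ?thesis by (simp add: coefm_euler_inverse)
qed

lemma coefm_S0A_1: "coefm eulA (S0A 1) + shift = cop alpha"
  using coefm_S0A_Suc[of 0] by simp

lemma grade_shift: "derivation d \<Longrightarrow> grade d shift = shift"
  by (rule endo_eqI, rule poly_eqI)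
    (auto simp: coeff_grade_ev derivation_simps(1,2) if_distrib[of d] cong: if_cong)

lemma grade_vac: "derivation d \<Longrightarrow> grade d vac = 0"
  by (rule endo_eqI, rule poly_eqI)
    (auto simp: coeff_grade_ev derivation_simps(1,2) coeff_1 if_distrib[of d] cong: if_cong)

lemma coefm_vac: "derivation d \<Longrightarrow> coefm d vac = 0"
  by (rule endo_eqI, rule poly_eqI)
    (auto simp: app_coefm_ev coeff_map_poly derivation_simps(1,2) coeff_1 if_distrib[of d] cong: if_cong)

lemma coefm_shift: "derivation d \<Longrightarrow> coefm d shift = 0"
  by (simp add: shift_def coefm_cop derivation_0)

lemma grade_cop: "grade eulA (cop alpha) = cop alpha"
proof (rule endo_eqI, rule poly_eqI)
  fix j n
  have c: "coeff (app (cop alpha) (ev j)) n = (if Suc j = n then 1 else 0) + (if n \<le> j then alpha n j else 0)"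
    by (simp add: app_cop_ev coeff_sum if_distrib[of "\<lambda>x. _ * x"] cong: if_cong)
  show "coeff (app (grade eulA (cop alpha)) (ev j)) n = coeff (app (cop alpha) (ev j)) n"
    by (simp only: coeff_grade_ev[OF derivation_euler] c)
      (auto simp: derivation_simps(1,2)[OF derivation_euler] eulA_alpha algebra_simps)
qed

lemma grade_ieulA: "grade eulA (coefm ieulA f) = coefm ieulA (grade eulA f)"
proof (rule endo_eqI, rule poly_eqI)
  fix j n
  have 1: "eulA (ieulA a) = ieulA (eulA a)" for a
    by (rule poly_mapping_eqI) (simp add: lookup_euler lookup_inv_euler)
  have 2: "ieulA (of_nat k * a) = of_nat k * ieulA a" for k a
    by (rule poly_mapping_eqI) (simp add: lookup_of_nat_mult lookup_inv_euler)
  have 3: "ieulA (a - b) = ieulA a - ieulA b" for a b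
    by (rule poly_mapping_eqI) (simp add: lookup_minus lookup_inv_euler diff_divide_distrib)
  show "coeff (app (grade eulA (coefm ieulA f)) (ev j)) n = coeff (app (coefm ieulA (grade eulA f)) (ev j)) n"
    by (simp add: coeff_grade_ev[OF derivation_euler] app_coefm_ev coeff_map_poly ieulA_0 1 2 3 inv_euler_add)
qed

lemma grade_S0A: "grade eulA (S0A n) = of_int (int n) * S0A n"
proof (induction n)
  case 0 then show ?case by (simp add: derivation_1[OF derivation_grade[OF derivation_euler]])
next
  case (Suc n)
  note d = derivation_grade[OF derivation_euler, of wA]
  have "grade eulA (cop alpha * S0A n - S0A n * shift) = of_int (int (Suc n)) * (cop alpha * S0A n - S0A n * shift)"
    using derivation_homogeneous_mult[OF d _ Suc, of "cop alpha" 1]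
      derivation_homogeneous_mult[OF d Suc, of shift 1]
    by (simp add: grade_cop grade_shift derivation_euler derivation_diff[OF d] right_diff_distrib algebra_simps)
  then show ?case
    using additive_of_int_mult[of "coefm ieulA" "int (Suc n)"] coefm_add[OF additive_ieulA]
    by (simp only: S0A.simps grade_ieulA)
qed

lemma grade_coefm: "derivation d \<Longrightarrow> grade d (coefm d a) = coefm d (grade d a)"
proof -
  assume d: "derivation d"
  have "coefm d xdeg = 0"
    by (rule endo_eqI, rule poly_eqI)
      (simp add: app_coefm_ev app_xdeg_ev coeff_map_poly derivation_simps(1,2)[OF d]
        derivation_of_int_mult[OF d, of "int _" 1, simplified] derivation_mult[OF d])
  then show ?thesis
    by (simp add: grade_def derivation_add[OF derivation_coefm[OF d]] derivation_diff[OF derivation_coefm[OF d]]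
        derivation_mult[OF derivation_coefm[OF d]])
qed

interpretation SA: seed shift vac "coefm eulA" S0A
proof unfold_locales
  show "coefm eulA (S0A (Suc n)) = (coefm eulA (S0A 1) + shift) * S0A n - S0A n * shift" for n
    by (simp only: coefm_S0A_1 coefm_S0A_Suc)
  show "S0A 1 * vac = 0"
  proof (rule endo_eqI)
    have "app (cop alpha) 1 = app shift 1"
      using app_cop_ev[of alpha 0] app_shift_power_1[of 1, where ?'a = apoly] by (simp add: ev_0 alpha_def)
    then show "app (S0A 1 * vac) (ev k) = app 0 (ev k)" for k
      using app_coefm_ev[of ieulA "cop alpha - shift" 0] by (simp add: ev_0)
  qed
  show "a * shift = shift * a \<Longrightarrow> b * shift = shift * b \<Longrightarrow> a * b = b * a" for a b :: "apoly endo"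
    using commutant_shift[OF aideal_zero, of a b] by (simp add: endoI_zero)
  show "determined {0} (coefm eulA (S0A 1) + shift) vac" "determined {0} shift (vac :: apoly endo)"
    unfolding coefm_S0A_1 unfolding shift_def using determined_cop[OF aideal_zero] by (simp_all only: endoI_zero)
  show "solvable shift (vac :: apoly endo)" "solvable (coefm eulA (S0A 1) + shift) vac"
    unfolding coefm_S0A_1 unfolding shift_def by (rule solvable_cop)+
qed (simp_all add: derivation_coefm derivation_euler coefm_shift coefm_vac)

definition flowA :: "(nat \<Rightarrow> (letter, apoly endo) ser) \<times> (letter \<Rightarrow> (letter, apoly endo) ser)" where
  "flowA = (SOME SN. flow shift vac (coefm eulA) S0A (fst SN) (snd SN))"

interpretation GA: graded_flow shift vac "coefm eulA" S0A "fst flowA" "snd flowA" "grade eulA" KA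
proof -
  have "flow shift vac (coefm eulA) S0A (fst flowA) (snd flowA)"
    unfolding flowA_def by (rule someI_ex) (use SA.flow_exists in auto)
  then interpret flow shift vac "coefm eulA" S0A "fst flowA" "snd flowA" .
  show "graded_flow shift vac (coefm eulA) S0A (fst flowA) (snd flowA) (grade eulA) KA"
  proof unfold_locales
    show "coefm eulA a \<in> KA" for a
      by (simp add: coefm_KA eulA_augI derivation_0[OF derivation_euler])
    show "determined KA (coefm eulA (S0A 1) + shift) vac"
      unfolding coefm_S0A_1 by (rule determined_cop[OF aideal_augI])
    show "a * shift - shift * a \<in> KA \<Longrightarrow> b * shift - shift * b \<in> KA \<Longrightarrow> a * b - b * a \<in> KA" for a b
      by (rule commutant_shift[OF aideal_augI])
  qed (simp_all add: derivation_grade derivation_euler grade_shift grade_vac grade_S0A grade_coefm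
      tideal_endoI aideal_augI S0A_Suc_KA del: S0A.simps of_int_of_nat_eq)
qed

section \<open>Correlators\<close>

abbreviation conths :: "'a list \<Rightarrow> nat set \<Rightarrow> 'a list" where
  "conths l S \<equiv> nths l ({..<length l} - S)"

definition corr :: "letter list \<Rightarrow> nat \<Rightarrow> nat \<Rightarrow> apoly" where
  "corr es d r = coeff (app (scoef (GA.J d * cs vac) es) 1) r"

lemma app_of_int_mult: "app (of_int k * f) p = of_int k * app f p"
  by (rule additive_of_int_mult) simp

lemma coeff_of_int_mult: "coeff (of_int k * p) r = of_int k * coeff (p :: 'a::comm_ring_1 poly) r"
  by (rule additive_of_int_mult) simp

lemma corr_mset: "mset es = mset es' \<Longrightarrow> corr es d r = corr es' d r"
  unfolding corr_def using symmetric_scoef_mset[OF GA.symmetric_J] by metis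

lemma sum_list_wt: "sum_list (map wt es) = int (sum_list (map fst es)) + int (sum_list (map snd es)) - int (length es)"
  by (induction es) (auto simp: wt_def)

lemma corr_euler: "eulA (corr es d r) = of_int (deg (Br es d r)) * corr es d r"
proof -
  let ?f = "scoef (GA.J d * cs vac) es"
  have "coeff (app (grade eulA ?f) (ev 0)) r = of_int (int d + 2 + sum_list (map wt es)) * coeff (app ?f (ev 0)) r"
    unfolding GA.scoef_gr_J app_of_int_mult coeff_of_int_mult ..
  then have "eulA (corr es d r) = of_int (int d + 2 + sum_list (map wt es)) * corr es d r - of_int (int r) * corr es d r"
    unfolding coeff_grade_ev[OF derivation_euler] by (simp add: ev_0 corr_def eq_diff_eq)
  also have "\<dots> = of_int (int d + 2 + sum_list (map wt es) - int r) * corr es d r"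
    by (simp only: of_int_diff left_diff_distrib)
  also have "int d + 2 + sum_list (map wt es) - int r = deg (Br es d r)"
    by (simp add: sum_list_wt)
  finally show ?thesis .
qed

lemma corr_neg: "deg (Br es d r) < 0 \<Longrightarrow> corr es d r = 0"
  by (rule euler_eigen_neg[OF corr_euler])

lemma corr_const: assumes "deg (Br es d r) = 0" shows "corr es d r = cst (lookup (corr es d r) 0)"
proof -
  have "eulA (corr es d r) = 0" unfolding corr_euler assms by simp
  then show ?thesis by (rule euler_eigen_0[where w = wA, OF wA_pos])
qed

lemma scoef_tsh:
  "scoef (tsh \<phi> f) es = (\<Sum>j<length es. case \<phi> (es ! j) of None \<Rightarrow> 0 | Some y \<Rightarrow> scoef f (es[j := y]))"
proof (induction es arbitrary: f)
  case (Cons x es)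
  have "scoef (tsh \<phi> f) (x # es) = (case \<phi> x of None \<Rightarrow> 0 | Some y \<Rightarrow> scoef f (y # es)) + scoef (tsh \<phi> (der x f)) es"
    by (simp add: scoef_Cons der_tsh dero_def split: option.splits)
  also have "scoef (tsh \<phi> (der x f)) es
      = (\<Sum>j<length es. case \<phi> (es ! j) of None \<Rightarrow> 0 | Some y \<Rightarrow> scoef f (x # es[j := y]))"
    by (simp add: Cons scoef_Cons cong: option.case_cong)
  finally show ?case
    by (simp add: sum.lessThan_Suc_shift del: sum.lessThan_Suc cong: option.case_cong)
qed simp

lemma coeff_app_tsh:
  "coeff (app (scoef (tsh \<phi> f) es) p) r
    = (\<Sum>j<length es. case \<phi> (es ! j) of None \<Rightarrow> 0 | Some y \<Rightarrow> coeff (app (scoef f (es[j := y])) p) r)"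
proof -
  have s: "app (sum g A) p = (\<Sum>x\<in>A. app (g x) p)" for g :: "nat \<Rightarrow> 'a endo" and A
    by (induction A rule: infinite_finite_induct) auto
  show ?thesis
    unfolding scoef_tsh s coeff_sum by (intro sum.cong refl) (simp split: option.split)
qed

text \<open>\<open>Jp 0\<close> is linear in the coordinates, so only words of one letter
  contribute. The value 1 is that of \<open><H^0, H^r, H_r>\<close>, the symbols excluded from
  (GW3).\<close>

lemma coeff_Jp:
  "coeff (app (scoef (GA.Jp d * cs vac) es) 1) r
    = (if d = 0 then (if es = [(0, r)] then 1 else 0) else corr es (d - 1) r)"
proof (cases d)
  case 0
  let ?h = "\<lambda>x. if fst x = 0 then cs (shift ^ snd x) else 0 :: (letter, apoly endo) ser"
  have h: "der y (?h x) = 0" for x y by simp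
  have b0: "bsum (\<lambda>x. 0 :: (letter, apoly endo) ser) = 0"
    using bsum_diff[of "\<lambda>x. 0 :: (letter, apoly endo) ser" "\<lambda>x. 0"] by simp
  have d: "der y (bsum ?h) = ?h y" for y
    unfolding der_bsum h b0 by (rule add_0_right)
  have "scoef (bsum ?h) es = (case es of [] \<Rightarrow> 0 | x # l \<Rightarrow> if l = [] \<and> fst x = 0 then shift ^ snd x else 0)"
    by (cases es) (auto simp: scoef_Cons d scoef_cs)
  then show ?thesis
    by (cases es) (auto simp: 0 GA.Jp_def scoef_mult_cs app_shift_power_1 prod_eq_iff)
qed (simp add: GA.Jp_def corr_def)

lemma corr_string:
  "corr ((0, 0) # es) d r
    = (\<Sum>j<length es. if fst (es ! j) = 0 then 0 else corr (es[j := (fst (es ! j) - 1, snd (es ! j))]) d r)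
    + (if d = 0 then (if es = [(0, r)] then 1 else 0) else corr es (d - 1) r)"
proof -
  have "corr ((0, 0) # es) d r = coeff (app (scoef (tsh lower (GA.J d * cs vac)) es) 1) r
      + coeff (app (scoef (GA.Jp d * cs vac) es) 1) r"
    unfolding corr_def scoef_Cons GA.string by simp
  then show ?thesis
    unfolding coeff_app_tsh coeff_Jp
    by (simp add: lower_def corr_def if_distrib[of "case_option _ _"] cong: if_cong)
qed

text \<open>The extra 1 is the value of \<open><H^1, H^(r-1), H_r>\<close>, a symbol of degree zero
  and therefore outside (GW4).\<close>

lemma corr_divisor:
  "corr ((0, 1) # es) d r = of_int (deg (Br es d r)) * corr es d r
    + (\<Sum>j<length es. if fst (es ! j) = 0 then 0 else corr (es[j := (fst (es ! j) - 1, snd (es ! j) + 1)]) d r)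
    + (if r = 0 then 0 else if d = 0 then (if es = [(0, r - 1)] then 1 else 0) else corr es (d - 1) (r - 1))"
proof -
  have "corr ((0, 1) # es) d r = coeff (app (scoef (smap (coefm eulA) (GA.J d * cs vac)) es) 1) r
      + coeff (app (scoef (tsh twist (GA.J d * cs vac)) es) 1) r
      + coeff (app (scoef (cs shift * (GA.Jp d * cs vac)) es) 1) r"
    unfolding corr_def scoef_Cons GA.divisor SA.delta_def by simp
  moreover have "coeff (app (scoef (smap (coefm eulA) (GA.J d * cs vac)) es) 1) r = eulA (corr es d r)"
    using app_coefm_ev[of eulA "scoef (GA.J d * cs vac) es" 0]
    by (simp add: ev_0 coeff_map_poly derivation_0[OF derivation_euler] corr_def)
  moreover have "coeff (app (scoef (cs shift * (GA.Jp d * cs vac)) es) 1) r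
      = (if r = 0 then 0 else if d = 0 then (if es = [(0, r - 1)] then 1 else 0) else corr es (d - 1) (r - 1))"
    by (simp only: scoef_cs_mult app_ring coeff_app_shift coeff_Jp) (simp split: nat.split)
  ultimately show ?thesis
    unfolding coeff_app_tsh corr_euler
    by (simp add: twist_def corr_def if_distrib[of "case_option _ _"] cong: if_cong)
qed

lemma coeff_app_mult:
  "coeff (app (scoef (F * U) es) 1) r = (\<Sum>S\<in>Pow {..<length es}.
     \<Sum>a\<le>degree (app (scoef U (nths es S)) 1). coeff (app (scoef U (nths es S)) 1) a
        * coeff (app (scoef F (conths es S)) (ev a)) r)"
proof -
  let ?n = "{..<length es}"
  have s: "app (sum g A) p = (\<Sum>x\<in>A. app (g x) p)" for g :: "nat set \<Rightarrow> 'a endo" and A p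
    by (induction A rule: infinite_finite_induct) auto
  have "scoef (F * U) es = (\<Sum>S\<in>Pow ?n. scoef F (nths es (?n - S)) * scoef U (nths es S))"
    unfolding scoef_mult_split
    by (rule sum.reindex_bij_witness[of _ "\<lambda>S. ?n - S" "\<lambda>S. ?n - S"]) (auto simp: double_diff)
  then show ?thesis
    by (simp add: s coeff_sum app_expand[OF order_refl, of _ "app (scoef U (nths es _)) 1"])
qed

lemma sum_support:
  fixes u :: "'k::comm_ring_1 poly"
  assumes "finite A" "\<And>a. a \<notin> A \<Longrightarrow> coeff u a * g a = 0"
  shows "(\<Sum>a\<le>degree u. coeff u a * g a) = (\<Sum>a\<in>A. coeff u a * g a)"
  by (rule sum.mono_neutral_cong) (use assms in \<open>auto simp: coeff_eq_0\<close>)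

lemma finite_deg: "finite {a. 0 \<le> deg (Br es d a) \<and> P a}"
  by (rule finite_subset[of _ "{..nat (deg (Br es d 0))}"]) auto

lemma corr_prod_0: "\<not> (0 \<le> deg (Br es d r) \<and> 0 \<le> deg (Br es' d' r')) \<Longrightarrow> corr es d r * corr es' d' r' = 0"
  by (metis corr_neg not_le mult_zero_left mult_zero_right)

text \<open>The operator \<open>R (Suc d)\<close> splits off on the left of
  \<open>der_der_J\<close>; its column a is the derivative of \<open>J d\<close> in the direction
  (0, a). Matrix multiplication supplies the sum over a.\<close>

lemma corr_trr_last:
  "corr (x # y # es) (Suc d) r = (\<Sum>S\<in>Pow {..<length es}.
     \<Sum>a\<in>{a. 0 \<le> deg (Br (x # y # nths es S) 0 a) \<and> 0 \<le> deg (Br ((0, a) # conths es S) d r)}.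
        corr (x # y # nths es S) 0 a * corr ((0, a) # conths es S) d r)"
proof -
  let ?U = "der y (der x (GA.J 0 * cs vac))"
  have "corr (x # y # es) (Suc d) r = coeff (app (scoef (GA.R (Suc d) * ?U) es) 1) r"
    unfolding corr_def scoef_Cons GA.der_der_J by (simp add: GA.R_0 mult.assoc)
  moreover have U: "coeff (app (scoef ?U l) 1) a = corr (x # y # l) 0 a" for l a
    unfolding corr_def scoef_Cons ..
  moreover have "coeff (app (scoef (GA.R (Suc d)) l) (ev a)) r = corr ((0, a) # l) d r" for l a
    unfolding corr_def scoef_Cons GA.der_J' by (simp add: scoef_mult_cs app_shift_power_1)
  moreover have "(\<Sum>a\<le>degree (app (scoef ?U l) 1). coeff (app (scoef ?U l) 1) a * corr ((0, a) # l') d r)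
      = (\<Sum>a\<in>{a. 0 \<le> deg (Br (x # y # l) 0 a) \<and> 0 \<le> deg (Br ((0, a) # l') d r)}.
          coeff (app (scoef ?U l) 1) a * corr ((0, a) # l') d r)" for l l'
  proof (rule sum_support[OF finite_deg])
    fix a assume "a \<notin> {a. 0 \<le> deg (Br (x # y # l) 0 a) \<and> 0 \<le> deg (Br ((0, a) # l') d r)}"
    then show "coeff (app (scoef ?U l) 1) a * corr ((0, a) # l') d r = 0"
      unfolding U mem_Collect_eq by (rule corr_prod_0)
  qed
  ultimately show ?thesis unfolding coeff_app_mult by simp
qed

text \<open>Here \<open>S (Suc c)\<close> splits off on the right. By \<open>Q_c_0\<close> it is the
  two-point series with lower entry \<open>H_a\<close>, and \<open>R d * N y\<close> is the other
  factor, applied to \<open>x^a\<close>.\<close>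

lemma corr_trr_first:
  "corr ((Suc c, i) # y # es) d r = (\<Sum>S\<in>Pow {..<length es}.
     \<Sum>a\<in>{a. 0 \<le> deg (Br ((c, i) # nths es S) 0 a) \<and> 0 \<le> deg (Br ((0, a) # y # conths es S) d r)}.
        corr ((c, i) # nths es S) 0 a * corr ((0, a) # y # conths es S) d r)"
proof -
  let ?U = "der (c, i) (GA.J 0 * cs vac)" and ?F = "GA.R d * snd flowA y"
  have "corr ((Suc c, i) # y # es) d r = coeff (app (scoef (?F * ?U) es) 1) r"
    unfolding corr_def scoef_Cons GA.der_der_J unfolding GA.der_J' by (simp add: GA.Q_c_0 mult.assoc)
  moreover have U: "coeff (app (scoef ?U l) 1) a = corr ((c, i) # l) 0 a" for l a
    unfolding corr_def scoef_Cons ..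
  moreover have "coeff (app (scoef ?F l) (ev a)) r = corr ((0, a) # y # l) d r" for l a
    unfolding corr_def scoef_Cons GA.der_der_J by (simp add: scoef_mult_cs app_shift_power_1 GA.S_0)
  moreover have "(\<Sum>a\<le>degree (app (scoef ?U l) 1). coeff (app (scoef ?U l) 1) a * corr ((0, a) # y # l') d r)
      = (\<Sum>a\<in>{a. 0 \<le> deg (Br ((c, i) # l) 0 a) \<and> 0 \<le> deg (Br ((0, a) # y # l') d r)}.
          coeff (app (scoef ?U l) 1) a * corr ((0, a) # y # l') d r)" for l l'
  proof (rule sum_support[OF finite_deg])
    fix a assume "a \<notin> {a. 0 \<le> deg (Br ((c, i) # l) 0 a) \<and> 0 \<le> deg (Br ((0, a) # y # l') d r)}"
    then show "coeff (app (scoef ?U l) 1) a * corr ((0, a) # y # l') d r = 0"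
      unfolding U mem_Collect_eq by (rule corr_prod_0)
  qed
  ultimately show ?thesis unfolding coeff_app_mult by simp
qed

lemma corr_base: "i \<le> j \<Longrightarrow> 0 < j \<Longrightarrow> corr [(0, 1), (0, j)] 0 i = alpha i j"
proof -
  assume ij: "i \<le> j" "0 < j"
  \<comment> \<open>\<open>der_der_J\<close> places \<open>N\<close> at the second letter, which
    should be \<open>H^1\<close> so that \<open>N\<close> is \<open>M\<close>.\<close>
  have "corr [(0, 1), (0, j)] 0 i = corr [(0, j), (0, 1)] 0 i" by (rule corr_mset) simp
  also have "\<dots> = coeff (app (cop alpha) (ev j)) i"
    unfolding corr_def scoef_Cons GA.der_der_J
    by (simp add: GA.N_01[simplified] GA.R_0 GA.S_0 GA.M_Nil[unfolded coefm_S0A_1] app_shift_power_1)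
  also have "\<dots> = alpha i j"
    using ij by (simp add: app_cop_ev coeff_sum if_distrib[of "\<lambda>x. _ * x"] cong: if_cong)
  finally show ?thesis .
qed

section \<open>Degree zero\<close>

lemma KA_lookup: "f \<in> KA \<Longrightarrow> lookup (coeff (app f 1) r) 0 = 0"
  by (simp add: endoI_def polyI_def augI_def)

definition corr0 :: "letter list \<Rightarrow> nat \<Rightarrow> nat \<Rightarrow> complex" where
  "corr0 es d r = lookup (corr es d r) 0"

lemma corr0_mset: "mset es = mset es' \<Longrightarrow> corr0 es d r = corr0 es' d r"
  unfolding corr0_def by (metis corr_mset)

lemma coeff_shift_power: "coeff (app (shift ^ i) p) r = (if i \<le> r then coeff p (r - i) else 0)"
  by (induction i arbitrary: r) (auto simp: coeff_app_shift split: nat.split)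

text \<open>Constant terms see only the classical product: an entry \<open>H^i\<close> acts as
  \<open>x^i\<close> times the entry \<open>H^0\<close>, which shifts the lower index.\<close>

lemma corr0_unit: "corr0 ((0, i) # y # es) d r = (if i \<le> r then corr0 ((0, 0) # y # es) d (r - i) else 0)"
proof -
  let ?J = "GA.J d * cs vac"
  let ?f = "der (0, i) (der y ?J) - cs (shift ^ i) * der (0, 0) (der y ?J)"
  have "scoef ?f es \<in> KA"
    using GA.der_der_J_K[of "length es" i y d] by (simp add: ap_def)
  from KA_lookup[OF this, of r]
  have "corr0 (y # (0, i) # es) d r = (if i \<le> r then corr0 (y # (0, 0) # es) d (r - i) else 0)"
    by (simp add: scoef_cs_mult coeff_shift_power lookup_minus corr0_def corr_def scoef_Cons split: if_splits)
  then show ?thesis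
    using corr0_mset[of "y # (0, i) # es" "(0, i) # y # es"] corr0_mset[of "y # (0, 0) # es" "(0, 0) # y # es"]
    by simp
qed

lemma corr0_Nil: "corr0 [] d r = 0"
  unfolding corr0_def corr_def by (rule KA_lookup[OF GA.J_Nil_K])

lemma corr0_single: "corr0 [x] d r = 0"
proof -
  have "scoef (GA.Q (fst x) d * cs (shift ^ snd x) * cs vac) [] \<in> KA"
    by (simp add: GA.Q_Nil_K KA_simps)
  then show ?thesis
    unfolding corr0_def corr_def scoef_Cons GA.der_J' by (rule KA_lookup)
qed

lemma corr0_two: "corr0 [(c, i), (b, j)] d r = (if c = 0 \<and> b = 0 \<and> d = 0 \<and> i + j = r then 1 else 0)"
proof -
  let ?f = "scoef (GA.R d * snd flowA (b, j) * fst flowA c * cs (shift ^ i) * cs vac) []"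
  have c: "corr0 [(c, i), (b, j)] d r = lookup (coeff (app ?f 1) r) 0"
    unfolding corr0_def corr_def scoef_Cons GA.der_der_J by simp
  show ?thesis
  proof (cases "c = 0 \<and> b = 0 \<and> d = 0")
    case True
    have "(scoef (snd flowA (0, j)) [] - shift ^ j) * (shift ^ i * vac) \<in> KA"
      by (rule tideal_right[OF tideal_endoI[OF aideal_augI]]) (rule GA.N_Nil_0_K)
    then have "?f - shift ^ j * (shift ^ i * vac) \<in> KA"
      using True by (simp add: GA.R_0 GA.S_0 scoef_1 left_diff_distrib mult.assoc)
    from KA_lookup[OF this, of r] show ?thesis
      unfolding c using True
      by (simp add: lookup_minus app_shift_power_1 app_shift_power add.commute split: if_splits)
  next
    case False
    then have False0: "\<not> (c = 0 \<and> b = 0 \<and> d = 0 \<and> i + j = r)" by blast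
    from False have "?f \<in> KA"
    proof -
      consider n where "d = Suc n" | n where "b = Suc n" | n where "c = Suc n"
        using False by (cases d; cases b; cases c) auto
      then show ?thesis
        by cases (simp_all add: KA_simps GA.R_Nil_K GA.N_Nil_Suc_K GA.S_Nil S0A_Suc_KA del: S0A.simps(2))
    qed
    from KA_lookup[OF this] show ?thesis unfolding c if_not_P[OF False0] .
  qed
qed

section \<open>Multinomial coefficients and (GW2)\<close>

definition pfact :: "nat list \<Rightarrow> nat" where
  "pfact L = prod_list (map fact L)"

lemma pfact_update: "j < length L \<Longrightarrow> L ! j = Suc k \<Longrightarrow> pfact L = Suc k * pfact (L[j := k])"
  by (induction L arbitrary: j) (auto simp: pfact_def nth_Cons algebra_simps split: nat.splits)

text \<open>Lowering \<open>L ! j\<close> multiplies the reciprocal product of factorials by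
  \<open>L ! j\<close>, and these numbers add up to D + 1.\<close>

lemma multinomial_pascal:
  assumes "sum_list L = Suc D"
  shows "(\<Sum>j<length L. if L ! j = 0 then 0 else of_nat (fact D) / of_nat (pfact (L[j := L ! j - 1])))
    = (of_nat (fact (Suc D)) / of_nat (pfact L) :: complex)"
proof -
  have "(if L ! j = 0 then 0 else of_nat (fact D) / of_nat (pfact (L[j := L ! j - 1])))
      = of_nat (L ! j) * (of_nat (fact D) / of_nat (pfact L) :: complex)" if "j < length L" for j
  proof (cases "L ! j")
    case (Suc k)
    have "of_nat (pfact L) = (of_nat (Suc k) * of_nat (pfact (L[j := k])) :: complex)"
      by (simp only: pfact_update[OF that Suc] of_nat_mult)
    then show ?thesis by (simp add: Suc del: of_nat_Suc)
  qed simp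
  then have "(\<Sum>j<length L. if L ! j = 0 then 0 else of_nat (fact D) / of_nat (pfact (L[j := L ! j - 1])))
    = (\<Sum>j<length L. of_nat (L ! j) * (of_nat (fact D) / of_nat (pfact L) :: complex))"
    by (intro sum.cong) auto
  also have "\<dots> = of_nat (sum_list L) * (of_nat (fact D) / of_nat (pfact L))"
    by (simp only: of_nat_sum sum_distrib_right sum_list_sum_nth atLeast0LessThan)
  finally show ?thesis by (simp add: assms algebra_simps)
qed

definition multinom :: "letter list \<Rightarrow> nat \<Rightarrow> complex" where
  "multinom es d = of_nat (fact (sum_list (map fst es @ [d]))) / of_nat (pfact (map fst es @ [d]))"

lemma multinom_string:
  assumes "sum_list (map fst es) + d = Suc D"
  shows "(\<Sum>j<length es. if fst (es ! j) = 0 then 0 else multinom (es[j := (fst (es ! j) - 1, snd (es ! j))]) d)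
    + (if d = 0 then 0 else multinom es (d - 1)) = multinom es d"
proof -
  let ?L = "map fst es @ [d]"
  have L: "sum_list ?L = Suc D" using assms by simp
  have 1: "multinom (es[j := (fst (es ! j) - 1, snd (es ! j))]) d = of_nat (fact D) / of_nat (pfact (?L[j := ?L ! j - 1]))"
    if "j < length es" "fst (es ! j) \<noteq> 0" for j
  proof -
    have l: "map fst (es[j := (fst (es ! j) - 1, snd (es ! j))]) @ [d] = ?L[j := ?L ! j - 1]"
      using that by (simp add: map_update list_update_append nth_append)
    have "sum_list (?L[j := ?L ! j - 1]) = D"
      using that L by (simp add: sum_list_update nth_append del: sum_list_append)
    then show ?thesis by (simp only: multinom_def l)
  qed
  have 2: "multinom es (d - 1) = of_nat (fact D) / of_nat (pfact (?L[length es := ?L ! length es - 1]))" if "d \<noteq> 0"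
  proof -
    have l: "map fst es @ [d - 1] = ?L[length es := ?L ! length es - 1]"
      by (simp add: list_update_append nth_append)
    have "sum_list (map fst es @ [d - 1]) = D" using assms that by simp
    then show ?thesis by (simp only: multinom_def l)
  qed
  have "(\<Sum>j<length es. if fst (es ! j) = 0 then 0 else multinom (es[j := (fst (es ! j) - 1, snd (es ! j))]) d)
    = (\<Sum>j<length es. if ?L ! j = 0 then 0 else of_nat (fact D) / of_nat (pfact (?L[j := ?L ! j - 1])))"
    by (intro sum.cong refl) (use 1 in \<open>auto simp: nth_append\<close>)
  moreover have "(if d = 0 then 0 else multinom es (d - 1))
    = (if ?L ! length es = 0 then 0 else of_nat (fact D) / of_nat (pfact (?L[length es := ?L ! length es - 1])))"
    using 2 by (simp add: nth_append)
  ultimately show ?thesis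
    using multinomial_pascal[OF L] by (simp add: multinom_def L[simplified] del: fact_Suc)
qed

lemma sum_list_ge_length: "\<forall>x\<in>set xs. 1 \<le> f x \<Longrightarrow> length xs \<le> sum_list (map f xs :: nat list)"
  by (induction xs) fastforce+

lemma sum_list_lower:
  fixes es :: "letter list"
  assumes "j < length es" "fst (es ! j) \<noteq> 0"
  shows "sum_list (map fst (es[j := (fst (es ! j) - 1, s)])) + 1 = sum_list (map fst es)"
proof -
  have "fst (es ! j) \<le> sum_list (map fst es)"
    by (intro member_le_sum_list) (simp only: set_map, intro imageI nth_mem assms(1), simp)
  then show ?thesis using assms by (simp add: map_update sum_list_update)
qed

lemma map_snd_update: "j < length es \<Longrightarrow> map snd (es[j := (k, snd (es ! j))]) = map snd es"
  by (simp add: map_update) (metis list_update_id nth_map)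

text \<open>With at least three upper entries there are two cases. An entry without \<tau> is turned
  into \<open>H^0\<close> and removed by the string relation, which matches the Pascal rule. If
  every entry carries a \<tau>, the topological recursion gives zero.\<close>

lemma corr0_eq:
  "corr0 es d r = (if sum_list (map fst es) + d + 2 = length es \<and> sum_list (map snd es) = r then multinom es d else 0)"
proof (induction "length es" arbitrary: es d r rule: less_induct)
  case less
  consider "es = []" | x where "es = [x]" | x y where "es = [x, y]" | "3 \<le> length es"
  proof (cases es)
    case (Cons x l)
    with that show thesis by (cases l; cases "tl l") auto
  qed (use that in simp)
  then show ?case
  proof cases
    case 3
    then show ?thesis
      by (cases x; cases y) (auto simp: corr0_two multinom_def pfact_def)
  next
    case 4
    show ?thesis
    proof (cases "\<exists>x\<in>set es. fst x = 0")
      case True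
      then obtain i where "(0, i) \<in> set es" by force
      then obtain es1 es2 where es: "es = es1 @ (0, i) # es2" by (meson split_list)
      have "es1 @ es2 \<noteq> []" using 4 es by auto
      then obtain y l where yl: "es1 @ es2 = y # l" by (meson list.exhaust)
      have m: "mset es = mset ((0, i) # y # l)" using es yl by (metis mset.simps(2) mset_append union_mset_add_mset_right)
      have len: "length es = Suc (length (y # l))" using mset_eq_length[OF m] by simp
      have sums: "sum_list (map fst es) = sum_list (map fst (y # l))" "sum_list (map snd es) = i + sum_list (map snd (y # l))"
      proof -
        have "sum_list (map f es) = sum_list (map f ((0, i) # y # l))" for f :: "letter \<Rightarrow> nat"
          unfolding sum_mset_sum_list[symmetric] mset_map m ..
        from this[of fst] this[of snd]
        show "sum_list (map fst es) = sum_list (map fst (y # l))" "sum_list (map snd es) = i + sum_list (map snd (y # l))"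
          by simp_all
      qed
      have mn: "multinom es d = multinom (y # l) d"
      proof -
        have "pfact (map fst es @ [d]) = pfact (map fst ((0, i) # y # l) @ [d])"
          unfolding pfact_def prod_mset_prod_list[symmetric] mset_map mset_append m ..
        then show ?thesis by (simp add: multinom_def sums pfact_def add.assoc mult.assoc)
      qed
      have y2: "2 \<le> length (y # l)" using 4 len by simp
      have IH: "corr0 es' d' r' = (if sum_list (map fst es') + d' + 2 = length es' \<and> sum_list (map snd es') = r' then multinom es' d' else 0)"
        if "length es' = length (y # l)" for es' d' r' using less[of es'] that len by simp
      have main: "corr0 ((0, 0) # y # l) d r'
        = (if sum_list (map fst (y # l)) + d + 1 = length (y # l) \<and> sum_list (map snd (y # l)) = r' then multinom (y # l) d else 0)" for r'
      proof -
        define e where "e = y # l"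
        note IH = IH[folded e_def] and y2 = y2[folded e_def]
        let ?u = "\<lambda>j. e[j := (fst (e ! j) - 1, snd (e ! j))]"
        have L: "lookup (sum g A) 0 = (\<Sum>j\<in>A. lookup (g j :: apoly) 0)" for g and A :: "nat set"
          by (rule lookup_sum)
        have "corr0 ((0, 0) # e) d r' = (\<Sum>j<length e. if fst (e ! j) = 0 then 0 else corr0 (?u j) d r')
            + (if d = 0 then 0 else corr0 e (d - 1) r')"
          unfolding corr0_def corr_string lookup_add L using y2
          by (auto intro!: sum.cong arg_cong2[of _ _ _ _ "(+)"])
        also have "\<dots> = (if sum_list (map fst e) + d + 1 = length e \<and> sum_list (map snd e) = r'
            then (\<Sum>j<length e. if fst (e ! j) = 0 then 0 else multinom (?u j) d) + (if d = 0 then 0 else multinom e (d - 1)) else 0)"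
        proof -
          define P where "P \<longleftrightarrow> sum_list (map fst e) + d + 1 = length e \<and> sum_list (map snd e) = r'"
          have 1: "corr0 (?u j) d r' = (if P then multinom (?u j) d else 0)"
            if "j < length e" "fst (e ! j) \<noteq> 0" for j
          proof -
            note sum_list_lower[OF that, of "snd (e ! j)"] map_snd_update[OF that(1), of "fst (e ! j) - 1"]
            then show ?thesis by (subst IH) (auto simp: P_def simp del: list_update.simps)
          qed
          have 2: "corr0 e (d - 1) r' = (if P then multinom e (d - 1) else 0)"
            if "d \<noteq> 0" using that by (subst IH) (auto simp: P_def simp del: list_update.simps)
          have "(\<Sum>j<length e. if fst (e ! j) = 0 then 0 else corr0 (?u j) d r')
            = (\<Sum>j<length e. if fst (e ! j) = 0 then 0 else
                (if P then multinom (?u j) d else 0))"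
            using 1 by (intro sum.cong) auto
          then show ?thesis unfolding P_def[symmetric] using 2 by (cases P) (simp_all cong: if_cong)
        qed
        also have "\<dots> = (if sum_list (map fst e) + d + 1 = length e \<and> sum_list (map snd e) = r' then multinom e d else 0)"
        proof (cases "sum_list (map fst e) + d + 1 = length e")
          case True
          with y2 have "sum_list (map fst e) + d = Suc (length e - 2)" by simp
          from multinom_string[OF this] show ?thesis by simp
        qed simp
        finally show ?thesis unfolding e_def .
      qed
      have "corr0 es d r = (if i \<le> r then corr0 ((0, 0) # y # l) d (r - i) else 0)"
        unfolding corr0_mset[OF m] by (rule corr0_unit)
      then show ?thesis
        unfolding main by (auto simp: mn sums len simp del: list.map sum_list.Cons length_Cons)
    next
      case False
      obtain x y l where xyl: "es = x # y # l"
      proof (cases es)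
        case (Cons x m)
        with 4 that show thesis by (cases m) auto
      qed (use 4 in simp)
      then obtain c where "fst x = Suc c" using False by (cases "fst x") auto
      then obtain i where es: "es = (Suc c, i) # y # l" using xyl by (cases x) auto
      have pos: "\<forall>x\<in>set es. 1 \<le> fst x" using False by (auto simp: Suc_le_eq)
      \<comment> \<open>All entries but the first carry a \<tau>, so there are too many \<tau>'s for
        a nonzero constant term.\<close>
      have z: "corr0 ((c, i) # nths l A) 0 a = 0" for A a
      proof (cases "nths l A = []")
        case True then show ?thesis by (simp add: corr0_single)
      next
        case False
        have "length (nths l A) \<le> length l" using length_nths[of l A] card_mono[of "{..<length l}" "{i. i < length l \<and> i \<in> A}"] by auto
        then have "length ((c, i) # nths l A) < length es" by (simp add: es)
        moreover have "\<forall>x\<in>set (nths l A). 1 \<le> fst x" using pos es by (auto dest: in_set_nthsD)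
        then have "length (nths l A) \<le> sum_list (map fst (nths l A))" by (rule sum_list_ge_length)
        ultimately show ?thesis using less[of "(c, i) # nths l A"] by auto
      qed
      have "corr0 es d r = 0"
        unfolding corr0_def es corr_trr_first lookup_sum lookup_mult_0 using z by (simp add: corr0_def)
      moreover have "length es \<le> sum_list (map fst es)" using pos by (rule sum_list_ge_length)
      ultimately show ?thesis by auto
    qed
  qed (auto simp: corr0_Nil corr0_single)
qed

lemma corr_deg_0:
  assumes "deg (Br es d r) = 0"
  shows "corr es d r = cst (of_nat (fact (sum_list (map fst es @ [d]))) / of_nat (prod_list (map fact (map fst es @ [d])))
    * (if int (sum_list (map fst es @ [d])) = int (length es + 1) - 3 then 1 else 0))"
proof -
  have "corr es d r = cst (corr0 es d r)"
    using corr_const[OF assms] unfolding corr0_def .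
  also have "corr0 es d r = multinom es d * (if int (sum_list (map fst es @ [d])) = int (length es + 1) - 3 then 1 else 0)"
    using assms unfolding corr0_eq by auto
  finally show ?thesis unfolding multinom_def pfact_def .
qed

section \<open>Evaluation of polynomials\<close>

text \<open>The formula of \<open>subst_hom\<close> for an arbitrary polynomial target, so that it
  serves both for r and for the evaluation back into A.\<close>

definition evalp :: "('v \<Rightarrow> 'u cpoly) \<Rightarrow> 'v cpoly \<Rightarrow> 'u cpoly" where
  "evalp f p = (\<Sum>m\<in>keys p. cst (lookup p m)
     * (\<Prod>v\<in>keys m. f v ^ lookup m v))"

lemma subst_hom_evalp: "subst_hom f p = evalp f p"
  by (simp add: subst_hom_def evalp_def)

lemma cst_ring: "cst 0 = 0" "cst 1 = 1" "cst (a + b) = cst a + cst b" "cst (a * b) = cst a * cst b"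
  "cst (a - b) = cst a - cst b"
  by (simp_all add: cst_def single_add mult_single single_diff)

lemma cst_of_int: "cst (of_int k) = of_int k"
  by (simp add: cst_def)

lemma evalp_superset:
  assumes "finite A" "keys p \<subseteq> A"
  shows "evalp f p = (\<Sum>m\<in>A. cst (lookup p m) * (\<Prod>v\<in>keys m. f v ^ lookup m v))"
  unfolding evalp_def by (rule sum.mono_neutral_left) (use assms in \<open>auto simp: in_keys_iff cst_ring\<close>)

lemma evalp_add: "evalp f (p + q) = evalp f p + evalp f q"
proof -
  let ?A = "keys p \<union> keys q"
  have A: "finite ?A" by simp
  have "keys (p + q) \<subseteq> ?A" by (rule keys_add)
  then show ?thesis
    by (simp add: evalp_superset[OF A] lookup_add cst_ring distrib_right sum.distrib)
qed

lemma evalp_single: "evalp f (single m c) = cst c * (\<Prod>v\<in>keys m. f v ^ lookup m v)"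
  by (subst evalp_superset[of "{m}"]) auto

lemma monomial_superset:
  assumes "finite A" "keys m \<subseteq> A"
  shows "(\<Prod>v\<in>keys m. f v ^ lookup m v) = (\<Prod>v\<in>A. (f v :: 'a::comm_ring_1) ^ lookup m v)"
  by (rule prod.mono_neutral_left) (use assms in \<open>auto simp: in_keys_iff\<close>)

lemma monomial_add:
  "(\<Prod>v\<in>keys (m + n). (f v :: 'a::comm_ring_1) ^ lookup (m + n) v)
    = (\<Prod>v\<in>keys m. f v ^ lookup m v) * (\<Prod>v\<in>keys n. f v ^ lookup n v)"
proof -
  let ?A = "keys m \<union> keys n"
  have A: "finite ?A" by simp
  have k: "keys (m + n) \<subseteq> ?A" "keys m \<subseteq> ?A" "keys n \<subseteq> ?A"
    by (simp_all add: keys_add)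
  show ?thesis
    unfolding k[THEN monomial_superset[OF A]] by (simp add: lookup_add power_add prod.distrib)
qed

lemma evalp_mult: "evalp f (p * q) = evalp f p * evalp f q"
proof (induction p rule: pm_induct)
  case (1 m c)
  show ?case
  proof (induction q rule: pm_induct)
    case (1 n d)
    show ?case by (simp add: mult_single evalp_single monomial_add cst_ring mult_ac)
  qed (simp add: distrib_left evalp_add)
qed (simp add: distrib_right evalp_add)

lemma evalp_cst: "evalp f (cst c) = cst c"
  by (simp add: cst_def evalp_single)

lemma evalp_diff: "evalp f (p - q) = evalp f p - evalp f q"
  using evalp_add[of f "p - q" q] by simp

lemma evalp_0 [simp]: "evalp f 0 = 0"
  by (simp add: evalp_def)

lemma evalp_sum: "evalp f (sum g A) = (\<Sum>a\<in>A. evalp f (g a))"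
  by (induction A rule: infinite_finite_induct) (auto simp: evalp_add)

lemma evalp_power: "evalp f (p ^ n) = evalp f p ^ n"
  using evalp_cst[of f 1] by (induction n) (auto simp: evalp_mult cst_ring)

lemma evalp_prod: "evalp f (prod g A) = (\<Prod>a\<in>A. evalp f (g a))"
  using evalp_cst[of f 1] by (induction A rule: infinite_finite_induct) (auto simp: evalp_mult cst_ring)

lemma evalp_evalp: "evalp g (evalp f p) = evalp (\<lambda>v. evalp g (f v)) p"
  by (simp add: evalp_def[of f] evalp_def[of "\<lambda>v. evalp g (f v)"] evalp_sum evalp_mult evalp_cst evalp_prod evalp_power)

lemma evalp_var: "evalp (\<lambda>v. single (single v 1) 1) p = p"
proof -
  have pw: "single (single v 1) 1 ^ k = (single (single v k) 1 :: 'a cpoly)"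
    for v :: 'a and k
    by (induction k) (simp_all add: mult_single single_add[symmetric])
  have pr: "(\<Prod>v\<in>A. single (g v) 1) = (single (\<Sum>v\<in>A. g v) 1 :: 'a cpoly)" for A and g :: "'a \<Rightarrow> 'a \<Rightarrow>\<^sub>0 nat"
    by (induction A rule: infinite_finite_induct) (simp_all add: mult_single)
  have "(\<Prod>v\<in>keys m. single (single v 1) 1 ^ lookup m v)
    = (single m 1 :: 'a cpoly)" for m
    unfolding pw pr pm_expand[symmetric] ..
  then have "evalp (\<lambda>v. single (single v 1) 1) p = (\<Sum>m\<in>keys p. single m (lookup p m))"
    unfolding evalp_def by (simp add: cst_def mult_single)
  then show ?thesis by (simp only: pm_expand[symmetric])
qed

section \<open>The evaluation kills the relations\<close>

text \<open>Evaluation of symbols at the model correlators. It kills \<open>Rel\<close> and is a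
  left inverse of the substitution defining r.\<close>

definition psi :: "fpoly \<Rightarrow> apoly" where
  "psi = evalp (\<lambda>s. case Rep_fsym s of Br es d r \<Rightarrow> corr es d r)"

lemma psi_X: "psi (X (Br es d r)) = corr es d r"
proof (cases "0 \<le> deg (Br es d r)")
  case True
  then have "Rep_fsym (Abs_fsym (Br es d r)) = Br es d r" by (intro Abs_fsym_inverse) simp
  with True show ?thesis by (simp add: psi_def X_def evalp_single cst_ring del: deg.simps)
next
  case False
  then show ?thesis using corr_neg[of es d r] by (simp add: X_def psi_def del: deg.simps)
qed

lemmas psi_simps = evalp_add evalp_mult evalp_diff evalp_sum evalp_cst

lemma XI_ilist: "XI (ilist es) (int d) (int r) = X (Br es d r)"
proof -
  have "map (\<lambda>(a, b). (nat a, nat b)) (ilist es) = es" by (induction es) (auto simp: ilist_def)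
  moreover have "\<forall>p\<in>set (ilist es). 0 \<le> fst p \<and> 0 \<le> snd p" by (auto simp: ilist_def)
  ultimately show ?thesis by (simp add: XI_def)
qed

lemma XI_ilist_d: "XI (ilist es) (int d - 1) (int r) = (if d = 0 then 0 else X (Br es (d - 1) r))"
  by (cases d) (simp add: XI_def, simp add: XI_ilist)

lemma XI_ilist_dr: "XI (ilist es) (int d - 1) (int r - 1) = (if d = 0 \<or> r = 0 then 0 else X (Br es (d - 1) (r - 1)))"
  by (cases d; cases r) (simp add: XI_def, simp add: XI_def, simp add: XI_def, simp add: XI_ilist)

lemma XI_update:
  assumes "j < length es"
  shows "XI ((ilist es)[j := (int a - 1, int b)]) (int d) (int r) = (if a = 0 then 0 else X (Br (es[j := (a - 1, b)]) d r))"
proof (cases "a = 0")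
  case True
  have "(int a - 1, int b) \<in> set ((ilist es)[j := (int a - 1, int b)])"
    by (rule set_update_memI) (simp add: ilist_def assms)
  then have "\<not> (\<forall>p\<in>set ((ilist es)[j := (int a - 1, int b)]). 0 \<le> fst p \<and> 0 \<le> snd p)"
    using True by (metis fst_conv int_ops(1) diff_0 neg_0_le_iff_le not_one_le_zero)
  with True show ?thesis by (simp only: XI_def) simp
next
  case False
  then have "(ilist es)[j := (int a - 1, int b)] = ilist (es[j := (a - 1, b)])"
    by (simp add: ilist_def map_update of_nat_diff)
  then show ?thesis using False by (simp add: XI_ilist)
qed

lemma XI_lower: "j < length es \<Longrightarrow>
    XI ((ilist es)[j := (fst (ilist es ! j) - 1, snd (ilist es ! j))]) (int d) (int r)
    = (if fst (es ! j) = 0 then 0 else X (Br (es[j := (fst (es ! j) - 1, snd (es ! j))]) d r))"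
  using XI_update[of j es "fst (es ! j)" "snd (es ! j)"] by (simp add: ilist_def case_prod_beta)

lemma XI_twist: "j < length es \<Longrightarrow>
    XI ((ilist es)[j := (fst (ilist es ! j) - 1, snd (ilist es ! j) + 1)]) (int d) (int r)
    = (if fst (es ! j) = 0 then 0 else X (Br (es[j := (fst (es ! j) - 1, snd (es ! j) + 1)]) d r))"
  using XI_update[of j es "fst (es ! j)" "snd (es ! j) + 1"] by (simp add: ilist_def case_prod_beta add.commute)

lemma sum_XI_lower: "(\<Sum>j<length es. XI ((ilist es)[j := (fst (ilist es ! j) - 1, snd (ilist es ! j))]) (int d) (int r))
    = (\<Sum>j<length es. if fst (es ! j) = 0 then 0 else X (Br (es[j := (fst (es ! j) - 1, snd (es ! j))]) d r))"
  by (rule sum.cong[OF refl]) (simp only: XI_lower lessThan_iff)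

lemma sum_XI_twist: "(\<Sum>j<length es. XI ((ilist es)[j := (fst (ilist es ! j) - 1, snd (ilist es ! j) + 1)]) (int d) (int r))
    = (\<Sum>j<length es. if fst (es ! j) = 0 then 0 else X (Br (es[j := (fst (es ! j) - 1, snd (es ! j) + 1)]) d r))"
  by (rule sum.cong[OF refl]) (simp only: XI_twist lessThan_iff)

lemma psi_if: "psi (if b then 0 else p) = (if b then 0 else psi p)"
  by (simp add: psi_def)

lemma psi_GW1: "g \<in> GW1 \<Longrightarrow> psi g = 0"
proof -
  assume "g \<in> GW1"
  then obtain es es' d r where g: "g = X (Br es d r) - X (Br es' d r)" and m: "mset es = mset es'"
    by (auto simp: GW1_def)
  have "psi g = corr es d r - corr es' d r"
    unfolding g psi_X[symmetric] by (simp add: psi_def evalp_diff)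
  then show ?thesis using corr_mset[OF m] by simp
qed

lemma psi_diff: "psi (p - q) = psi p - psi q" and psi_sum: "psi (sum h A) = (\<Sum>a\<in>A. psi (h a))"
  and psi_mult: "psi (p * q) = psi p * psi q" and psi_cst: "psi (cst c) = cst c" and psi_add: "psi (p + q) = psi p + psi q"
  for h :: "'a \<Rightarrow> fpoly"
  by (simp_all add: psi_def psi_simps)

lemma psi_GW2: "g \<in> GW2 \<Longrightarrow> psi g = 0"
  unfolding GW2_def by (auto simp only: mem_Collect_eq psi_diff psi_X psi_cst corr_deg_0) (simp only: corr_deg_0 diff_self)

lemma psi_GW3: "g \<in> GW3 \<Longrightarrow> psi g = 0"
proof -
  assume "g \<in> GW3"
  then obtain es d r where g: "g = X (Br ((0,0) # es) d r)
          - (\<Sum>j<length es. XI ((ilist es)[j := (fst (ilist es ! j) - 1, snd (ilist es ! j))]) (int d) (int r))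
          - XI (ilist es) (int d - 1) (int r)" and n: "\<not> (es = [(0, r)] \<and> d = 0)"
    by (auto simp: GW3_def)
  have "psi g = corr ((0, 0) # es) d r
      - (\<Sum>j<length es. if fst (es ! j) = 0 then 0 else corr (es[j := (fst (es ! j) - 1, snd (es ! j))]) d r)
      - (if d = 0 then 0 else corr es (d - 1) r)"
    unfolding g sum_XI_lower XI_ilist_d psi_diff psi_sum psi_if psi_X ..
  also have "\<dots> = 0"
    unfolding corr_string using n by auto
  finally show ?thesis .
qed

lemma psi_GW4: "g \<in> GW4 \<Longrightarrow> psi g = 0"
proof -
  assume "g \<in> GW4"
  then obtain es d r where g: "g = X (Br ((0,1) # es) d r)
          - cst (of_int (deg (Br ((0,1) # es) d r))) * X (Br es d r)
          - (\<Sum>s<length es. XI ((ilist es)[s := (fst (ilist es ! s) - 1, snd (ilist es ! s) + 1)]) (int d) (int r))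
          - XI (ilist es) (int d - 1) (int r - 1)" and n: "0 < deg (Br ((0,1) # es) d r)"
    by (auto simp: GW4_def simp del: deg.simps)
  have D: "deg (Br ((0,1) # es) d r) = deg (Br es d r)" by simp
  \<comment> \<open>In positive degree the exceptional summand of \<open>corr_divisor\<close> cannot
    occur.\<close>
  have ex: "\<not> (d = 0 \<and> r \<noteq> 0 \<and> es = [(0, r - 1)])" using n by auto
  have "psi g = corr ((0, 1) # es) d r - of_int (deg (Br es d r)) * corr es d r
      - (\<Sum>j<length es. if fst (es ! j) = 0 then 0 else corr (es[j := (fst (es ! j) - 1, snd (es ! j) + 1)]) d r)
      - (if d = 0 \<or> r = 0 then 0 else corr es (d - 1) (r - 1))"
    unfolding g D sum_XI_twist XI_ilist_dr psi_diff psi_sum psi_if psi_X psi_mult psi_cst unfolding cst_of_int ..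
  also have "\<dots> = 0"
    unfolding corr_divisor using ex by (auto simp del: deg.simps)
  finally show ?thesis .
qed

lemma psi_GW5a: "g \<in> GW5a \<Longrightarrow> psi g = 0"
proof -
  assume "g \<in> GW5a"
  then obtain es d1 j1 d2 j2 d3 r where
    g: "g = X (Br (es @ [(d1,j1),(d2,j2)]) d3 r)
          - (\<Sum>S1\<in>Pow {..<length es}.
               \<Sum>a\<in>{a. 0 \<le> deg (Br ((d1 - 1, j1) # nths es S1) 0 a) \<and>
                       0 \<le> deg (Br ((0, a) # conths es S1 @ [(d2, j2)]) d3 r)}.
                 X (Br ((d1 - 1, j1) # nths es S1) 0 a) *
                 X (Br ((0, a) # conths es S1 @ [(d2, j2)]) d3 r))" and "1 \<le> d1"
    by (auto simp: GW5a_def simp del: deg.simps)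
  then obtain c where d1: "d1 = Suc c" by (cases d1) auto
  have m: "corr (es @ [(d1,j1),(d2,j2)]) d3 r = corr ((Suc c, j1) # (d2, j2) # es) d3 r"
    by (rule corr_mset) (simp add: d1)
  have m': "corr ((0, a) # l @ [(d2, j2)]) d3 r = corr ((0, a) # (d2, j2) # l) d3 r"
    and D: "deg (Br ((0, a) # l @ [(d2, j2)]) d3 r) = deg (Br ((0, a) # (d2, j2) # l) d3 r)" for a l
    by (rule corr_mset) simp_all
  show ?thesis
    unfolding g psi_diff psi_sum psi_mult psi_X D m m' corr_trr_first by (simp add: d1 del: deg.simps)
qed

lemma psi_GW5b: "g \<in> GW5b \<Longrightarrow> psi g = 0"
proof -
  assume "g \<in> GW5b"
  then obtain es d1 j1 d2 j2 d3 r where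
    g: "g = X (Br (es @ [(d1,j1),(d2,j2)]) d3 r)
          - (\<Sum>S1\<in>Pow {..<length es}.
               \<Sum>a\<in>{a. 0 \<le> deg (Br (nths es S1 @ [(d1, j1), (d2, j2)]) 0 a) \<and>
                       0 \<le> deg (Br ((0, a) # conths es S1) (d3 - 1) r)}.
                 X (Br (nths es S1 @ [(d1, j1), (d2, j2)]) 0 a) *
                 X (Br ((0, a) # conths es S1) (d3 - 1) r))" and "1 \<le> d3"
    by (auto simp: GW5b_def simp del: deg.simps)
  then obtain c where d3: "d3 = Suc c" by (cases d3) auto
  have m: "corr (l @ [(d1,j1),(d2,j2)]) d r = corr ((d1, j1) # (d2, j2) # l) d r"
    and D: "deg (Br (l @ [(d1,j1),(d2,j2)]) d r) = deg (Br ((d1, j1) # (d2, j2) # l) d r)" for l d r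
    by (rule corr_mset) simp_all
  show ?thesis
    unfolding g psi_diff psi_sum psi_mult psi_X D m d3 corr_trr_last by (simp del: deg.simps)
qed

lemma psi_Rel: "p \<in> Rel \<Longrightarrow> psi p = 0"
  unfolding Rel_def
proof (induction rule: ideal_gen.induct)
  case (gen g)
  then show ?case using psi_GW1 psi_GW2 psi_GW3 psi_GW4 psi_GW5a psi_GW5b by blast
qed (simp add: psi_def, simp_all add: psi_add psi_mult)

lemma psi_phi: "psi (subst_hom phi q) = q"
proof -
  have "psi (phi v) = varA v" for v
  proof -
    have R: "fst (Rep_avar v) \<le> snd (Rep_avar v)" "0 < snd (Rep_avar v)" using Rep_avar[of v] by auto
    then show ?thesis
      by (simp add: phi_def psi_X corr_base[OF R, simplified] alpha_def Rep_avar_inverse)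
  qed
  then show ?thesis
    by (simp add: subst_hom_evalp psi_def evalp_evalp varA_def evalp_var[simplified])
qed

lemma inj_r_map: "inj r_map"
proof (rule injI)
  fix q q' assume "r_map q = r_map q'"
  then have "rel_eq (subst_hom phi q) (subst_hom phi q')"
    by (simp add: r_map_def gw.abs_eq_iff)
  then have "psi (subst_hom phi q - subst_hom phi q') = 0" by (simp add: rel_eq_def psi_Rel)
  then show "q = q'" by (simp add: psi_diff psi_phi)
qed

section \<open>Reconstruction\<close>

lemma Rel_0: "0 \<in> Rel" and Rel_add: "p \<in> Rel \<Longrightarrow> q \<in> Rel \<Longrightarrow> p + q \<in> Rel"
  and Rel_mult: "p \<in> Rel \<Longrightarrow> q * p \<in> Rel"
  by (simp_all add: Rel_def ideal_gen.intros)

text \<open>Representatives of classes in the image of r; surjectivity is the claim that this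
  subalgebra is everything.\<close>

definition Gen :: "fpoly set" where
  "Gen = {p. \<exists>q. p - subst_hom phi q \<in> Rel}"

lemma Gen_Rel: "p \<in> Rel \<Longrightarrow> p \<in> Gen"
  unfolding Gen_def by (rule CollectI, rule exI[of _ 0]) (simp add: subst_hom_evalp)

lemma Gen_cst: "cst c \<in> Gen"
  unfolding Gen_def by (rule CollectI, rule exI[of _ "cst c"]) (simp add: subst_hom_evalp evalp_cst Rel_0)

lemma Gen_add: "p \<in> Gen \<Longrightarrow> q \<in> Gen \<Longrightarrow> p + q \<in> Gen"
proof -
  assume "p \<in> Gen" "q \<in> Gen"
  then obtain a b where "p - subst_hom phi a \<in> Rel" "q - subst_hom phi b \<in> Rel" by (auto simp: Gen_def)
  then have "(p - subst_hom phi a) + (q - subst_hom phi b) \<in> Rel" by (rule Rel_add)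
  then have "(p + q) - subst_hom phi (a + b) \<in> Rel" by (simp add: subst_hom_evalp evalp_add algebra_simps)
  then show ?thesis by (auto simp: Gen_def)
qed

lemma Gen_mult: "p \<in> Gen \<Longrightarrow> q \<in> Gen \<Longrightarrow> p * q \<in> Gen"
proof -
  assume "p \<in> Gen" "q \<in> Gen"
  then obtain a b where ab: "p - subst_hom phi a \<in> Rel" "q - subst_hom phi b \<in> Rel" by (auto simp: Gen_def)
  have "q * (p - subst_hom phi a) + subst_hom phi a * (q - subst_hom phi b) \<in> Rel"
    by (intro Rel_add Rel_mult ab)
  then have "(p * q) - subst_hom phi (a * b) \<in> Rel" by (simp add: subst_hom_evalp evalp_mult algebra_simps)
  then show ?thesis by (auto simp: Gen_def)
qed

lemma Gen_uminus: "p \<in> Gen \<Longrightarrow> - p \<in> Gen"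
  using Gen_mult[OF Gen_cst[of "- 1"], of p] by (simp add: cst_def single_uminus)

lemma Gen_diff: "p \<in> Gen \<Longrightarrow> q \<in> Gen \<Longrightarrow> p - q \<in> Gen"
  using Gen_add[of p "- q"] Gen_uminus by simp

lemma Gen_0: "0 \<in> Gen"
  by (rule Gen_Rel[OF Rel_0])

lemma Gen_sum: "(\<And>x. x \<in> A \<Longrightarrow> f x \<in> Gen) \<Longrightarrow> sum f A \<in> Gen"
  by (induction A rule: infinite_finite_induct) (auto simp: Gen_0 Gen_add)

lemma Gen_cong: "p - q \<in> Rel \<Longrightarrow> q \<in> Gen \<Longrightarrow> p \<in> Gen"
  using Gen_add[OF Gen_Rel[of "p - q"], of q] by simp

lemma Gen_scale: "c \<noteq> 0 \<Longrightarrow> cst c * p \<in> Gen \<Longrightarrow> p \<in> Gen"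
proof -
  assume c: "c \<noteq> 0" and p: "cst c * p \<in> Gen"
  have "cst (1 / c) * (cst c * p) = p"
    using c by (simp add: mult.assoc[symmetric] cst_ring(4)[symmetric]) (simp add: cst_ring)
  then show ?thesis using Gen_mult[OF Gen_cst p, of "1 / c"] by simp
qed

lemma relation: "g \<in> GW1 \<union> GW2 \<union> GW3 \<union> GW4 \<union> GW5a \<union> GW5b \<Longrightarrow> g \<in> Rel"
  unfolding Rel_def by (rule ideal_gen.gen)

lemma X_neg: "deg (Br es d r) < 0 \<Longrightarrow> X (Br es d r) = 0"
  by (simp add: X_def)

lemma X_mset: "mset es = mset es' \<Longrightarrow> X (Br es d r) - X (Br es' d r) \<in> Rel"
  by (rule relation) (auto simp: GW1_def)

lemma Gen_mset: "mset es = mset es' \<Longrightarrow> X (Br es' d r) \<in> Gen \<Longrightarrow> X (Br es d r) \<in> Gen"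
  using Gen_cong[OF X_mset] .

lemma deg_0_relation: "deg (Br es d r) = 0 \<Longrightarrow> X (Br es d r) - cst (of_nat (fact (sum_list (map fst es @ [d]))) /
     of_nat (prod_list (map fact (map fst es @ [d])))
    * (if int (sum_list (map fst es @ [d])) = int (length es + 1) - 3 then 1 else 0)) \<in> Rel"
  by (rule relation) (use GW2_def in blast)

lemma Gen_deg_0: "deg (Br es d r) = 0 \<Longrightarrow> X (Br es d r) \<in> Gen"
  using Gen_cong[OF deg_0_relation Gen_cst] .

text \<open>Without \<tau>'s the condition \<open>M = 1\<close> in (GW2) forces n = 3, that is, two
  upper entries.\<close>

lemma Rel_deg_0:
  assumes "deg (Br es 0 r) = 0" "\<forall>x\<in>set es. fst x = 0" "length es \<noteq> 2"
  shows "X (Br es 0 r) \<in> Rel"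
proof -
  have "sum_list (map fst es @ [0]) = 0" using assms(2) by simp
  then have "\<not> int (sum_list (map fst es @ [0])) = int (length es + 1) - 3" using assms(3) by linarith
  from deg_0_relation[OF assms(1), unfolded if_not_P[OF this]] show ?thesis
    by (simp add: cst_ring)
qed

lemma string_primary:
  assumes "\<forall>x\<in>set es. fst x = 0" "0 < deg (Br ((0, 0) # es) 0 r)"
  shows "X (Br ((0, 0) # es) 0 r) \<in> Rel"
proof -
  have "\<not> (es = [(0, r)] \<and> (0::nat) = 0)" using assms(2) by auto
  then have "X (Br ((0,0) # es) 0 r)
          - (\<Sum>j<length es. XI ((ilist es)[j := (fst (ilist es ! j) - 1, snd (ilist es ! j))]) (int 0) (int r))
          - XI (ilist es) (int 0 - 1) (int r) \<in> GW3" (is "?g \<in> _")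
    unfolding GW3_def by blast
  then have "?g \<in> Rel"
    by (intro relation) blast
  moreover have "(\<Sum>j<length es. if fst (es ! j) = 0 then 0 else X (Br (es[j := (fst (es ! j) - 1, snd (es ! j))]) 0 r)) = 0"
    by (rule sum.neutral) (use assms(1) in auto)
  ultimately show ?thesis unfolding sum_XI_lower XI_ilist_d by simp
qed

lemma divisor_relation:
  assumes "0 < deg (Br es d r)"
  shows "X (Br ((0, 1) # es) d r) - cst (of_int (deg (Br es d r))) * X (Br es d r)
    - (\<Sum>j<length es. if fst (es ! j) = 0 then 0 else X (Br (es[j := (fst (es ! j) - 1, snd (es ! j) + 1)]) d r))
    - (if d = 0 \<or> r = 0 then 0 else X (Br es (d - 1) (r - 1))) \<in> Rel"
proof -
  have D: "deg (Br ((0, 1) # es) d r) = deg (Br es d r)" by simp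
  have "X (Br ((0,1) # es) d r)
          - cst (of_int (deg (Br ((0,1) # es) d r))) * X (Br es d r)
          - (\<Sum>s<length es. XI ((ilist es)[s := (fst (ilist es ! s) - 1, snd (ilist es ! s) + 1)]) (int d) (int r))
          - XI (ilist es) (int d - 1) (int r - 1) \<in> GW4"
    unfolding GW4_def using assms D by (intro CollectI exI[of _ es] exI[of _ d] exI[of _ r]) simp
  then show ?thesis
    unfolding D sum_XI_twist XI_ilist_dr by (intro relation) blast
qed

lemma trr_first_relation:
  assumes "0 \<le> deg (Br (es @ [(Suc c, i), y]) d r)"
  shows "X (Br (es @ [(Suc c, i), y]) d r)
    - (\<Sum>S\<in>Pow {..<length es}. \<Sum>a\<in>{a. 0 \<le> deg (Br ((c, i) # nths es S) 0 a) \<and>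
                       0 \<le> deg (Br ((0, a) # conths es S @ [y]) d r)}.
        X (Br ((c, i) # nths es S) 0 a) * X (Br ((0, a) # conths es S @ [y]) d r)) \<in> Rel" (is "?g \<in> Rel")
proof -
  obtain d2 j2 where y: "y = (d2, j2)" by (cases y)
  have "?g \<in> GW5a"
    unfolding GW5a_def y using assms[unfolded y]
    by (intro CollectI exI[of _ es] exI[of _ "Suc c"] exI[of _ i] exI[of _ d2] exI[of _ j2] exI[of _ d] exI[of _ r]) (simp del: deg.simps)
  then show ?thesis by (intro relation) blast
qed

lemma trr_last_relation:
  assumes "0 \<le> deg (Br (es @ [x, y]) (Suc d) r)"
  shows "X (Br (es @ [x, y]) (Suc d) r)
    - (\<Sum>S\<in>Pow {..<length es}. \<Sum>a\<in>{a. 0 \<le> deg (Br (nths es S @ [x, y]) 0 a) \<and>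
                       0 \<le> deg (Br ((0, a) # conths es S) d r)}.
        X (Br (nths es S @ [x, y]) 0 a) * X (Br ((0, a) # conths es S) d r)) \<in> Rel" (is "?g \<in> Rel")
proof -
  obtain d1 j1 d2 j2 where xy: "x = (d1, j1)" "y = (d2, j2)" by (cases x; cases y)
  have "?g \<in> GW5b"
    unfolding GW5b_def xy using assms[unfolded xy]
    by (intro CollectI exI[of _ es] exI[of _ d1] exI[of _ j1] exI[of _ d2] exI[of _ j2] exI[of _ "Suc d"] exI[of _ r]) (simp del: deg.simps)
  then show ?thesis by (intro relation) blast
qed

lemma mset_nths_split:
  "(\<And>j. j < length l \<Longrightarrow> j \<in> A \<longleftrightarrow> j \<notin> B) \<Longrightarrow> mset (nths l A) + mset (nths l B) = mset l"
proof (induction l arbitrary: A B)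
  case (Cons x l)
  have "mset (nths l {j. Suc j \<in> A}) + mset (nths l {j. Suc j \<in> B}) = mset l"
    by (rule Cons.IH) (use Cons.prems in auto)
  then show ?case using Cons.prems[of 0] by (auto simp: nths_Cons)
qed simp

lemma nths_split:
  fixes l :: "letter list" and S :: "nat set"
  defines "l1 \<equiv> nths l S" and "l2 \<equiv> conths l S"
  shows "length l1 + length l2 = length l"
    and "sum_list (map fst l1) + sum_list (map fst l2) = sum_list (map fst l)"
    and "sum_list (map snd l1) + sum_list (map snd l2) = sum_list (map snd l)"
    and "set l1 \<union> set l2 = set l"
    and "length l2 = 0 \<Longrightarrow> mset l1 = mset l"
proof -
  have m: "mset l = mset l1 + mset l2"
    unfolding assms by (rule mset_nths_split[symmetric]) auto
  then show "length l1 + length l2 = length l" by (metis size_mset size_union)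
  show "sum_list (map fst l1) + sum_list (map fst l2) = sum_list (map fst l)"
    "sum_list (map snd l1) + sum_list (map snd l2) = sum_list (map snd l)"
    unfolding sum_mset_sum_list[symmetric] mset_map m by simp_all
  show "set l1 \<union> set l2 = set l"
    unfolding set_mset_mset[symmetric] m by simp
  show "length l2 = 0 \<Longrightarrow> mset l1 = mset l" using m by simp
qed

context
  fixes m k :: nat
  assumes IH: "\<And>es d r. deg (Br es d r) < int m \<or> (deg (Br es d r) = int m \<and> sum_list (map fst es) + d < k)
    \<Longrightarrow> X (Br es d r) \<in> Gen"
begin

text \<open>Each product on the right of (GW5) has non-negative degrees adding up to m and k - 1
  remaining \<tau>'s, so each factor falls under \<open>IH\<close>.\<close>

lemma Gen_descendant_2:
  assumes "deg (Br es d r) = int m" "sum_list (map fst es) + d = k" "0 < k" "2 \<le> length es"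
  shows "X (Br es d r) \<in> Gen"
proof (cases "\<exists>x\<in>set es. fst x \<noteq> 0")
  case True
  then obtain c i where "(Suc c, i) \<in> set es" by (metis not0_implies_Suc prod.collapse)
  then obtain es1 es2 where es: "es = es1 @ (Suc c, i) # es2" by (meson split_list)
  then have "es1 @ es2 \<noteq> []" using assms(4) by auto
  then obtain y l where yl: "es1 @ es2 = l @ [y]" by (meson rev_exhaust)
  have ms: "mset es = mset (l @ [(Suc c, i), y])"
    using es arg_cong[OF yl, of mset] by simp
  have sums: "length es = length l + 2" "sum_list (map fst es) = sum_list (map fst (l @ [(Suc c, i), y]))"
    "sum_list (map snd es) = sum_list (map snd (l @ [(Suc c, i), y]))"
    unfolding sum_mset_sum_list[symmetric] mset_map ms using mset_eq_length[OF ms] by simp_all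
  show ?thesis
  proof (rule Gen_mset[OF ms], rule Gen_cong[OF trr_first_relation], goal_cases)
    case 1
    show ?case using assms(1) sums by simp
  next
    case 2
    show ?case
    proof (intro Gen_sum Gen_mult)
      fix S a assume "a \<in> {a. 0 \<le> deg (Br ((c, i) # nths l S) 0 a) \<and> 0 \<le> deg (Br ((0, a) # conths l S @ [y]) d r)}"
      then have a: "0 \<le> deg (Br ((c, i) # nths l S) 0 a)" "0 \<le> deg (Br ((0, a) # conths l S @ [y]) d r)" by auto
      note n = nths_split(1-3)[of l S]
      show "X (Br ((c, i) # nths l S) 0 a) \<in> Gen" "X (Br ((0, a) # conths l S @ [y]) d r) \<in> Gen"
        using a n assms(1-3) sums by (intro IH; simp; linarith)+
    qed
  qed
next
  case False
  then have "sum_list (map fst es) = 0" by (auto simp: sum_list_eq_0_iff)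
  with assms(2,3) have "d \<noteq> 0" by linarith
  then obtain d' where d: "d = Suc d'" by (cases d) auto
  obtain l x y where es: "es = l @ [x, y]"
  proof -
    have "es \<noteq> []" using assms(4) by auto
    then obtain l' y where 1: "es = l' @ [y]" by (meson rev_exhaust)
    then have "l' \<noteq> []" using assms(4) by auto
    then obtain l x where "l' = l @ [x]" by (meson rev_exhaust)
    with 1 that show thesis by simp
  qed
  show ?thesis
    unfolding es d
  proof (rule Gen_cong[OF trr_last_relation], goal_cases)
    case 1
    show ?case using assms(1) unfolding es d by simp
  next
    case 2
    show ?case
    proof (intro Gen_sum Gen_mult)
      fix S a assume "a \<in> {a. 0 \<le> deg (Br (nths l S @ [x, y]) 0 a) \<and> 0 \<le> deg (Br ((0, a) # conths l S) d' r)}"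
      then have a: "0 \<le> deg (Br (nths l S @ [x, y]) 0 a)" "0 \<le> deg (Br ((0, a) # conths l S) d' r)" by auto
      note n = nths_split(1-3)[of l S]
      show "X (Br (nths l S @ [x, y]) 0 a) \<in> Gen" "X (Br ((0, a) # conths l S) d' r) \<in> Gen"
        using a n assms(1-3) unfolding es d by (intro IH; simp; linarith)+
    qed
  qed
qed

text \<open>(GW4) read backwards: the symbol is recovered by dividing by its degree m, while the
  remaining terms have the same degree and one \<tau> less.\<close>

lemma Gen_divisor:
  assumes "deg (Br es d r) = int m" "sum_list (map fst es) + d = k" "0 < m" "X (Br ((0, 1) # es) d r) \<in> Gen"
  shows "X (Br es d r) \<in> Gen"
proof -
  let ?s = "\<Sum>j<length es. if fst (es ! j) = 0 then 0 else X (Br (es[j := (fst (es ! j) - 1, snd (es ! j) + 1)]) d r)"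
  let ?t = "if d = 0 \<or> r = 0 then 0 else X (Br es (d - 1) (r - 1))"
  have s: "?s \<in> Gen"
  proof (rule Gen_sum)
    fix j assume j: "j \<in> {..<length es}"
    show "(if fst (es ! j) = 0 then 0 else X (Br (es[j := (fst (es ! j) - 1, snd (es ! j) + 1)]) d r)) \<in> Gen"
    proof (cases "fst (es ! j) = 0")
      case False
      let ?e = "es[j := (fst (es ! j) - 1, snd (es ! j) + 1)]"
      have 1: "sum_list (map fst ?e) + 1 = sum_list (map fst es)"
        using sum_list_lower[of j es] j False by simp
      have "snd (es ! j) \<le> sum_list (map snd es)"
        by (intro member_le_sum_list) (simp only: set_map, intro imageI nth_mem, use j in simp, simp)
      then have 2: "sum_list (map snd ?e) = sum_list (map snd es) + 1"
        using j by (simp add: map_update sum_list_update)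
      have "X (Br ?e d r) \<in> Gen" by (rule IH) (use 1 2 assms(1,2) in simp)
      then show ?thesis using False by simp
    qed (simp add: Gen_0)
  qed
  have t: "?t \<in> Gen"
  proof (cases "d = 0 \<or> r = 0")
    case False
    then have "X (Br es (d - 1) (r - 1)) \<in> Gen"
      by (intro IH) (use assms(1,2) in \<open>auto simp: of_nat_diff\<close>)
    then show ?thesis using False by simp
  qed (simp add: Gen_0)
  have "0 < deg (Br es d r)" using assms by simp
  from Gen_diff[OF Gen_diff[OF Gen_diff[OF assms(4) Gen_Rel[OF divisor_relation[OF this]]] s] t]
  have "cst (of_int (int m)) * X (Br es d r) \<in> Gen"
    unfolding assms(1) by (simp add: algebra_simps)
  then show ?thesis by (rule Gen_scale[rotated]) (use assms(3) in simp)
qed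

end

text \<open>Positive degree means r \<le> j, so for j > 0 the three-point symbol is the image of a
  variable; for j = 0 the string relation kills it. Dividing by the degree gives the two-point
  symbol.\<close>

lemma Gen_two_point:
  assumes "0 < deg (Br [(0, j)] 0 r)" shows "X (Br [(0, j)] 0 r) \<in> Gen" "X (Br [(0, 1), (0, j)] 0 r) \<in> Gen"
proof -
  show 1: "X (Br [(0, 1), (0, j)] 0 r) \<in> Gen"
  proof (cases "j = 0")
    case True
    then have "X (Br ((0, 0) # [(0, 1)]) 0 r) \<in> Gen" using assms by (intro Gen_Rel string_primary) auto
    then show ?thesis unfolding True by (rule Gen_mset[rotated]) simp
  next
    case False
    define v where "v = Abs_avar (r, j)"
    have "Rep_avar v = (r, j)" unfolding v_def using assms False by (intro Abs_avar_inverse) simp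
    then have "X (Br [(0, 1), (0, j)] 0 r) = subst_hom phi (single (single v 1) 1)"
      by (simp add: subst_hom_evalp evalp_single cst_ring phi_def)
    then show ?thesis unfolding Gen_def by (intro CollectI exI[of _ "single (single v 1) 1"]) (simp add: Rel_0)
  qed
  have "X (Br ((0, 1) # [(0, j)]) 0 r) - cst (of_int (deg (Br [(0, j)] 0 r))) * X (Br [(0, j)] 0 r) \<in> Rel"
    using divisor_relation[OF assms] by simp
  from Gen_diff[OF 1 Gen_Rel[OF this]] have "cst (of_int (deg (Br [(0, j)] 0 r))) * X (Br [(0, j)] 0 r) \<in> Gen"
    by simp
  then show "X (Br [(0, j)] 0 r) \<in> Gen"
    by (rule Gen_scale[rotated]) (unfold of_int_eq_0_iff, use assms in linarith)
qed

lemma Gen_primary: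
  fixes m :: nat
  assumes IH: "\<And>es d r. deg (Br es d r) < int m \<Longrightarrow> X (Br es d r) \<in> Gen" and m: "0 < m"
  shows "deg (Br es 0 r) = int m \<Longrightarrow> \<forall>x\<in>set es. fst x = 0 \<Longrightarrow> 2 \<le> length es \<Longrightarrow> X (Br es 0 r) \<in> Gen"
proof (induction "length es" arbitrary: es r rule: less_induct)
  case less
  note IHL = less.hyps
  \<comment> \<open>A degree-zero factor lies in \<open>Rel\<close> unless it has exactly two upper
    entries. Otherwise either both degrees are below m or the partner needs an argument of its own;
    that partner is the obligation left to each use.\<close>
  have prod_Gen: "X (Br e1 0 a) * X (Br e2 0 r) \<in> Gen"
    if "deg (Br e1 0 a) + deg (Br e2 0 r) = int m" "0 \<le> deg (Br e1 0 a)" "0 \<le> deg (Br e2 0 r)"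
      "\<forall>x\<in>set e1. fst x = 0" "\<forall>x\<in>set e2. fst x = 0"
      "deg (Br e1 0 a) = 0 \<Longrightarrow> length e1 = 2 \<Longrightarrow> X (Br e2 0 r) \<in> Gen"
      "deg (Br e2 0 r) = 0 \<Longrightarrow> length e2 = 2 \<Longrightarrow> X (Br e1 0 a) \<in> Gen" for e1 e2 a r
  proof -
    have R1: "X (Br e1 0 a) * X (Br e2 0 r) \<in> Gen" if "X (Br e1 0 a) \<in> Rel"
      using Gen_Rel[OF Rel_mult[OF that, of "X (Br e2 0 r)"]] by (simp add: mult.commute)
    have R2: "X (Br e1 0 a) * X (Br e2 0 r) \<in> Gen" if "X (Br e2 0 r) \<in> Rel"
      using Gen_Rel[OF Rel_mult[OF that, of "X (Br e1 0 a)"]] .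
    have "deg (Br e1 0 a) = 0 \<or> deg (Br e2 0 r) = 0 \<or> deg (Br e1 0 a) < int m \<and> deg (Br e2 0 r) < int m"
      using that(1-3) by linarith
    then consider "deg (Br e1 0 a) = 0" | "deg (Br e2 0 r) = 0" | "deg (Br e1 0 a) < int m" "deg (Br e2 0 r) < int m"
      by blast
    then show ?thesis
    proof cases
      case 1
      then show ?thesis
        using R1 Rel_deg_0[OF 1 that(4)] Gen_mult[OF Gen_deg_0[OF 1] that(6)[OF 1]] by blast
    next
      case 2
      then show ?thesis
        using R2 Rel_deg_0[OF 2 that(5)] Gen_mult[OF that(7)[OF 2] Gen_deg_0[OF 2]] by blast
    next
      case 3 then show ?thesis by (intro Gen_mult IH)
    qed
  qed
  \<comment> \<open>Without \<tau>'s, (GW4) strips \<open>H^1\<close> and leaves only the degree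
    times a symbol with fewer entries.\<close>
  have hyperplane: "X (Br e 0 r') \<in> Gen"
    if "(0, 1) \<in> set e" "length e = length es" "deg (Br e 0 r') = int m" "\<forall>x\<in>set e. fst x = 0" for e r'
  proof -
    from that(1) obtain e1 e2 where e: "e = e1 @ (0, 1) # e2" by (meson split_list)
    define l where "l = e1 @ e2"
    have ms: "mset e = mset ((0, 1) # l)" by (simp add: e l_def)
    have l: "length l + 1 = length es" "deg (Br l 0 r') = int m" "\<forall>x\<in>set l. fst x = 0"
      using that(2-4) by (auto simp: e l_def)
    have pos: "0 < deg (Br l 0 r')" using l m by simp
    have z: "(\<Sum>j<length l. if fst (l ! j) = 0 then 0 else X (Br (l[j := (fst (l ! j) - 1, snd (l ! j) + 1)]) 0 r')) = 0"
      by (rule sum.neutral) (use l(3) in auto)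
    have "X (Br ((0, 1) # l) 0 r') \<in> Gen"
    proof (cases "2 \<le> length l")
      case True
      have "X (Br l 0 r') \<in> Gen" using l True by (intro IHL) auto
      then have "cst (of_int (deg (Br l 0 r'))) * X (Br l 0 r') \<in> Gen" by (intro Gen_mult Gen_cst)
      from Gen_add[OF Gen_Rel[OF divisor_relation[OF pos]] this] show ?thesis
        unfolding z by simp
    next
      case False
      then have "length l = 1" using l(1) less.prems(3) by simp
      then obtain j where "l = [(0, j)]" using l(3) by (cases l) auto
      then show ?thesis using Gen_two_point(2) pos by simp
    qed
    then show ?thesis by (rule Gen_mset[OF ms])
  qed
  have "X (Br ((0, i) # (0, j) # l) 0 r') \<in> Gen"
    if "length l + 2 = length es" "deg (Br ((0, i) # (0, j) # l) 0 r') = int m" "\<forall>x\<in>set l. fst x = 0" for i j l r'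
    using that
  proof (induction i arbitrary: j l r')
    case 0
    then show ?case using m by (intro Gen_Rel string_primary) auto
  next
    case (Suc i)
    show ?case
    proof (cases "i = 0")
      case True
      then show ?thesis using Suc.prems by (intro hyperplane) auto
    next
      case False
      \<comment> \<open>(GW4) for \<open>H^1\<close> together with \<tau>_1 H^i produces the wanted
        symbol with \<open>H^(i+1)\<close> exactly once, as the term where the \<tau> is
        removed.\<close>
      let ?e = "(1, i) # (0, j) # l"
      have d: "deg (Br ?e 0 r') = int m" using Suc.prems by simp
      have fl: "sum_list (map fst l) = 0" using Suc.prems(3) by (simp add: sum_list_eq_0_iff)
      \<comment> \<open>Beside a degree-zero three-point factor the partner has as many entries as
        \<open>es\<close>: it either contains \<open>H^1\<close>, so that \<open>hyperplane\<close>
        applies, or it starts with \<open>H^i\<close>, so that the induction on the exponent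
        does.\<close>
      have A: "X (Br ((0, 1) # ?e) 0 r') \<in> Gen"
      proof (rule Gen_mset[of _ "((0, j) # l) @ [(Suc 0, i), (0, 1)]"])
        let ?c = "(0, j) # l"
        show "X (Br (?c @ [(Suc 0, i), (0, 1)]) 0 r') \<in> Gen"
        proof (rule Gen_cong[OF trr_first_relation], goal_cases)
          case 1 show ?case using Suc.prems(2) by simp
        next
          case 2
          show ?case
          proof (intro Gen_sum)
            fix S a
            define l1 l2 where l12: "l1 = nths ?c S" "l2 = conths ?c S"
            assume "a \<in> {a. 0 \<le> deg (Br ((0, i) # nths ?c S) 0 a) \<and> 0 \<le> deg (Br ((0, a) # conths ?c S @ [(0, 1)]) 0 r')}"
            then have a: "0 \<le> deg (Br ((0, i) # l1) 0 a)" "0 \<le> deg (Br ((0, a) # l2 @ [(0, 1)]) 0 r')"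
              unfolding l12 by auto
            note n = nths_split[of ?c S, folded l12]
            have f: "\<forall>x\<in>set ?c. fst x = 0" using Suc.prems(3) by simp
            have f12: "\<forall>x\<in>set l1. fst x = 0" "\<forall>x\<in>set l2. fst x = 0" using f n(4) by blast+
            have dd: "deg (Br ((0, i) # l1) 0 a) + deg (Br ((0, a) # l2 @ [(0, 1)]) 0 r') = int m"
              using n(1-3) Suc.prems(2) by simp
            have "X (Br ((0, i) # l1) 0 a) * X (Br ((0, a) # l2 @ [(0, 1)]) 0 r') \<in> Gen"
            proof (rule prod_Gen[OF dd a])
              assume 0: "deg (Br ((0, i) # l1) 0 a) = 0" "length ((0, i) # l1) = 2"
              show "X (Br ((0, a) # l2 @ [(0, 1)]) 0 r') \<in> Gen"
              proof (rule hyperplane)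
                show "length ((0, a) # l2 @ [(0, 1)]) = length es" using n(1) 0(2) Suc.prems(1) by simp
                show "deg (Br ((0, a) # l2 @ [(0, 1)]) 0 r') = int m" using dd 0(1) by simp
              qed (use f12 in auto)
            next
              assume 0: "deg (Br ((0, a) # l2 @ [(0, 1)]) 0 r') = 0" "length ((0, a) # l2 @ [(0, 1)]) = 2"
              then have ms: "mset ((0, i) # l1) = mset ((0, i) # ?c)" using n(5) by simp
              have "deg (Br ((0, i) # ?c) 0 a) = int m"
                using dd 0 n(1-3) by simp
              then have "X (Br ((0, i) # ?c) 0 a) \<in> Gen" using Suc.prems by (intro Suc.IH) auto
              then show "X (Br ((0, i) # l1) 0 a) \<in> Gen" by (rule Gen_mset[OF ms])
            qed (use f12 in auto)
            then show "X (Br ((0, i) # nths ?c S) 0 a) * X (Br ((0, a) # conths ?c S @ [(0, 1)]) 0 r') \<in> Gen"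
              unfolding l12 .
          qed
        qed
      qed simp
      \<comment> \<open>One entry fewer than before: now the partner of a degree-zero three-point
        factor is shorter than \<open>es\<close>, or is a two-point symbol.\<close>
      have B: "X (Br ?e 0 r') \<in> Gen"
      proof (rule Gen_mset[of _ "l @ [(Suc 0, i), (0, j)]"])
        show "X (Br (l @ [(Suc 0, i), (0, j)]) 0 r') \<in> Gen"
        proof (rule Gen_cong[OF trr_first_relation], goal_cases)
          case 1 show ?case using Suc.prems(2) by simp
        next
          case 2
          show ?case
          proof (intro Gen_sum)
            fix S a
            let ?l1 = "nths l S" and ?l2 = "conths l S"
            assume "a \<in> {a. 0 \<le> deg (Br ((0, i) # ?l1) 0 a) \<and> 0 \<le> deg (Br ((0, a) # ?l2 @ [(0, j)]) 0 r')}"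
            then have a: "0 \<le> deg (Br ((0, i) # ?l1) 0 a)" "0 \<le> deg (Br ((0, a) # ?l2 @ [(0, j)]) 0 r')" by auto
            note n = nths_split[of l S]
            have f12: "\<forall>x\<in>set ?l1. fst x = 0" "\<forall>x\<in>set ?l2. fst x = 0" using Suc.prems(3) n(4) by blast+
            have dd: "deg (Br ((0, i) # ?l1) 0 a) + deg (Br ((0, a) # ?l2 @ [(0, j)]) 0 r') = int m"
              using n(1-3) Suc.prems(2) by simp
            show "X (Br ((0, i) # ?l1) 0 a) * X (Br ((0, a) # ?l2 @ [(0, j)]) 0 r') \<in> Gen"
            proof (rule prod_Gen[OF dd a])
              assume 0: "deg (Br ((0, i) # ?l1) 0 a) = 0" "length ((0, i) # ?l1) = 2"
              show "X (Br ((0, a) # ?l2 @ [(0, j)]) 0 r') \<in> Gen"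
              proof (rule IHL)
                show "length ((0, a) # ?l2 @ [(0, j)]) < length es" using n(1) 0(2) Suc.prems(1) by simp
                show "deg (Br ((0, a) # ?l2 @ [(0, j)]) 0 r') = int m" using dd 0(1) by simp
              qed (use f12 in auto)
            next
              assume 0: "deg (Br ((0, a) # ?l2 @ [(0, j)]) 0 r') = 0" "length ((0, a) # ?l2 @ [(0, j)]) = 2"
              have d1: "deg (Br ((0, i) # ?l1) 0 a) = int m" using dd 0(1) by simp
              show "X (Br ((0, i) # ?l1) 0 a) \<in> Gen"
              proof (cases "?l1")
                case Nil
                have "X (Br [(0, i)] 0 a) \<in> Gen"
                  by (rule Gen_two_point(1)) (use d1 m Nil in simp)
                then show ?thesis using Nil by simp
              next
                case (Cons x l')
                have "length ?l1 = length l" using n(1) 0(2) by simp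
                then show ?thesis
                  using Suc.prems(1) d1 f12(1) Cons by (intro IHL) auto
              qed
            qed (use f12 in auto)
          qed
        qed
      qed simp
      have z: "(\<Sum>q<length ?e. if fst (?e ! q) = 0 then 0 else X (Br (?e[q := (fst (?e ! q) - 1, snd (?e ! q) + 1)]) 0 r'))
        = X (Br ((0, Suc i) # (0, j) # l) 0 r')"
      proof -
        have "(\<Sum>q<length l. if fst (l ! q) = 0 then 0 else X (Br ((1, i) # (0, j) # l[q := (fst (l ! q) - 1, snd (l ! q) + 1)]) 0 r')) = 0"
          by (rule sum.neutral) (use Suc.prems(3) in auto)
        then show ?thesis by (simp add: sum.lessThan_Suc_shift del: sum.lessThan_Suc cong: if_cong)
      qed
      have pos: "0 < deg (Br ?e 0 r')" using d m by simp
      from divisor_relation[OF pos] z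
      have "X (Br ((0, 1) # ?e) 0 r') - cst (of_int (deg (Br ?e 0 r'))) * X (Br ?e 0 r') - X (Br ((0, Suc i) # (0, j) # l) 0 r') \<in> Rel"
        by simp
      from Gen_diff[OF Gen_diff[OF A Gen_mult[OF Gen_cst[of "of_int (deg (Br ?e 0 r'))"] B]] Gen_Rel[OF this]]
      show ?thesis by (simp del: deg.simps)
    qed
  qed
  moreover obtain i j l where es: "es = (0, i) # (0, j) # l"
  proof (cases es)
    case (Cons x l)
    with less.prems that show thesis by (cases l; cases x; cases "hd l") auto
  qed (use less.prems in simp)
  ultimately show ?case using less.prems by simp
qed

text \<open>Lexicographic induction on the degree and the number of \<tau>'s. Neither decreases when
  \<open>H^1\<close> is added, so symbols with two or more upper entries are settled before those
  with one, and these before those with none.\<close>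

lemma X_in_Gen: "X (Br es d r) \<in> Gen"
proof -
  have "deg (Br es d r) = int m \<Longrightarrow> sum_list (map fst es) + d = k \<Longrightarrow> X (Br es d r) \<in> Gen" for m k es d r
  proof (induction m arbitrary: k es d r rule: less_induct)
    case (less m)
    note IHm = less.IH
    have low: "X (Br es d r) \<in> Gen" if "deg (Br es d r) < int m" for es d r
    proof (cases "deg (Br es d r) < 0")
      case False
      then show ?thesis using that by (intro IHm[of "nat (deg (Br es d r))"]) auto
    qed (simp add: X_neg Gen_0 del: deg.simps)
    show ?case
    proof (cases "m = 0")
      case True
      then show ?thesis using less.prems(1) by (intro Gen_deg_0) simp
    next
      case False
      then have mpos: "0 < m" by simp
      have "deg (Br es d r) = int m \<Longrightarrow> sum_list (map fst es) + d = k \<Longrightarrow> X (Br es d r) \<in> Gen" for k es d r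
      proof (induction k arbitrary: es d r rule: less_induct)
        case (less k)
        have IH: "X (Br es d r) \<in> Gen" if "deg (Br es d r) < int m \<or> (deg (Br es d r) = int m \<and> sum_list (map fst es) + d < k)" for es d r
          using that low less.IH by blast
        have two: "X (Br es d r) \<in> Gen"
          if "deg (Br es d r) = int m" "sum_list (map fst es) + d = k" "2 \<le> length es" for es d r
        proof (cases "k = 0")
          case True
          then have "d = 0" "\<forall>x\<in>set es. fst x = 0" using that(2) by auto
          then show ?thesis using Gen_primary[where m = m, OF low mpos _ _ that(3)] that(1) by metis
        next
          case False
          then show ?thesis using Gen_descendant_2[OF IH that(1,2) _ that(3)] by blast
        qed
        have one: "X (Br es d r) \<in> Gen"
          if "deg (Br es d r) = int m" "sum_list (map fst es) + d = k" "1 \<le> length es" for es d r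
          by (rule Gen_divisor[OF IH that(1,2) mpos], assumption, rule two) (use that in simp_all)
        show ?case
          by (rule Gen_divisor[OF IH less.prems mpos], assumption, rule one) (use less.prems in simp_all)
      qed
      then show ?thesis using less.prems by blast
    qed
  qed
  from this[of es d r "nat (deg (Br es d r))"] show ?thesis
    by (cases "deg (Br es d r) < 0") (simp_all add: X_neg Gen_0 del: deg.simps)
qed

lemma surj_r_map: "surj r_map"
proof -
  have var: "single (single v 1) 1 \<in> Gen" for v :: fsym
  proof -
    obtain es d r where R: "Rep_fsym v = Br es d r" by (cases "Rep_fsym v")
    have "X (Rep_fsym v) = single (single v 1) 1"
      using Rep_fsym[of v] by (simp add: X_def Rep_fsym_inverse)
    then show ?thesis using X_in_Gen[of es d r] R by simp
  qed
  have pow: "p \<in> Gen \<Longrightarrow> p ^ n \<in> Gen" for p n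
    using Gen_cst[of 1] by (induction n) (auto simp: cst_ring Gen_mult)
  have prd: "(\<And>v. v \<in> A \<Longrightarrow> f v \<in> Gen) \<Longrightarrow> prod f A \<in> Gen" for A :: "fsym set" and f
    using Gen_cst[of 1] by (induction A rule: infinite_finite_induct) (auto simp: cst_ring Gen_mult)
  have all: "p \<in> Gen" for p
  proof -
    have "evalp (\<lambda>v. single (single v 1) 1) p \<in> Gen"
      unfolding evalp_def by (intro Gen_sum Gen_mult Gen_cst prd pow var)
    then show ?thesis by (simp only: evalp_var)
  qed
  have "\<exists>q. r_map q = g" for g
  proof -
    obtain p where g: "g = abs_gw p" by (induction g rule: gw.abs_induct) blast
    obtain q where "p - subst_hom phi q \<in> Rel" using all[of p] by (auto simp: Gen_def)
    then have "abs_gw p = r_map q" by (simp add: r_map_def gw.abs_eq_iff rel_eq_def)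
    then show ?thesis using g by auto
  qed
  then show ?thesis unfolding surj_def by metis
qed

theorem theorem3p1:
  shows "bij r_map"
  using inj_r_map surj_r_map by (simp add: bij_def)

end
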